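(* Let $0<\alpha\le 1$ and $1<p<\infty$. Let $\Phi:(0,\infty)\to(0,\infty)$ be an increasing function satisfying the doubling condition $\Phi(2r)\le D\cdot\Phi(r)$ for all $r>0$, with a constant $D=D(\Phi)$ independent of $r$ such that $1\le D(\Phi)<2^n$. Then there is a constant $C>0$ such that for every sequence $\vec f=(f_1,f_2,\ldots)$ of locally integrable functions on $\mathbb R^n$ ($C$ being independent of $\vec f$), $$\bigg\|\bigg(\sum_{j=1}^\infty\big|\mathcal S_\alpha(f_j)\big|^2\bigg)^{1/2}\bigg\|_{L^{p,\Phi}}\leq C\,\bigg\|\bigg(\sum_{j=1}^\infty\big|f_j\big|^2\bigg)^{1/2}\bigg\|_{L^{p,\Phi}}.$$
   Context: Intrinsic square function. For $0<\alpha\le1$, let $\mathcal C_\alpha$ be the family of functions $\varphi$ on $\mathbb R^n$ such that $\varphi$ is supported in $\{x\in\mathbb R^n:|x|\le1\}$, $\int_{\mathbb R^n}\varphi(x)\,dx=0$, and $|\varphi(x)-\varphi(x')|\le|x-x'|^\alpha$ for all $x,x'\in\mathbb R^n$. Write $\varphi_t(x)=t^{-n}\varphi(x/t)$ for $t>0$. For $f\in L^1_{loc}(\mathbb R^n)$ and $(y,t)\in\mathbb R^{n+1}_+=\mathbb R^n\times(0,\infty)$ set $$A_\alpha(f)(y,t)=\sup_{\varphi\in\mathcal C_\alpha}|f*\varphi_t(y)|=\sup_{\varphi\in\mathcal C_\alpha}\left|\int_{\mathbb R^n}\varphi_t(y-z)f(z)\,dz\right|,$$ and $$\mathcal S_\alpha(f)(x)=\left(\iint_{\Gamma(x)}\big(A_\alpha(f)(y,t)\big)^2\frac{dy\,dt}{t^{n+1}}\right)^{1/2},\qquad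 \Gamma(x)=\{(y,t)\in\mathbb R^{n+1}_+:|x-y|<t\}.$$ Generalized Morrey space. For $1\le p<\infty$, $L^{p,\Phi}=L^{p,\Phi}(\mathbb R^n)$ is the space of locally integrable functions $f$ on $\mathbb R^n$ for which there is a constant $C>0$ such that for every $x_0\in\mathbb R^n$ and all $r>0$, $$\int_{B(x_0,r)}|f(x)|^p\,dx\le C^p\,\Phi(r),$$ where $B(x_0,r)=\{x\in\mathbb R^n:|x-x_0|<r\}$. The norm $\|f\|_{L^{p,\Phi}}$ is the smallest such constant $C$ (and $+\infty$ if there is none). *)

theory Defs
  imports "HOL-Analysis.Analysis"
begin

text \<open>
  The ambient space \<open>\<real>\<^sup>n\<close> is a type \<open>'a :: euclidean_space\<close> with \<open>n = DIM('a)\<close>. Functions on it are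
  complex-valued, and so are the test functions; for real-valued \<open>f\<close> the supremum below is the same
  over real and over complex test functions, since a test function may be multiplied by a
  unimodular constant and replaced by its real part.
\<close>

definition locally_integrable :: "('a::euclidean_space \<Rightarrow> complex) \<Rightarrow> bool" where
  "locally_integrable f \<longleftrightarrow> (\<forall>K. compact K \<longrightarrow> set_integrable lebesgue K f)"

text \<open>Only exponents \<open>p > 0\<close> are used; then \<open>0\<close> is sent to \<open>0\<close> and \<open>\<infinity>\<close> to \<open>\<infinity>\<close>.\<close>

definition ennreal_powr :: "ennreal \<Rightarrow> real \<Rightarrow> ennreal" where
  "ennreal_powr x p = (if x = \<infinity> then \<infinity> else ennreal (enn2real x powr p))"

subsection \<open>Intrinsic square function\<close>

definition test_functions :: "real \<Rightarrow> ('a::euclidean_space \<Rightarrow> complex) set" where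
  "test_functions \<alpha> =
     {\<phi>. (\<forall>x. norm x > 1 \<longrightarrow> \<phi> x = 0) \<and>
         (\<integral>x. \<phi> x \<partial>lebesgue) = 0 \<and>
         (\<forall>x x'. norm (\<phi> x - \<phi> x') \<le> norm (x - x') powr \<alpha>)}"

definition dilate :: "real \<Rightarrow> ('a::euclidean_space \<Rightarrow> complex) \<Rightarrow> 'a \<Rightarrow> complex" where
  "dilate t \<phi> x = (1 / t ^ DIM('a)) *\<^sub>R \<phi> (x /\<^sub>R t)"

definition intrinsic_sup :: "real \<Rightarrow> ('a::euclidean_space \<Rightarrow> complex) \<Rightarrow> 'a \<Rightarrow> real \<Rightarrow> ennreal" where
  "intrinsic_sup \<alpha> f y t =
     (SUP \<phi>\<in>test_functions \<alpha>. ennreal (norm (\<integral>z. dilate t \<phi> (y - z) * f z \<partial>lebesgue)))"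

definition vertical_cone :: "'a::euclidean_space \<Rightarrow> ('a \<times> real) set" where
  "vertical_cone x = {(y, t). t > 0 \<and> norm (x - y) < t}"

definition intrinsic_square :: "real \<Rightarrow> ('a::euclidean_space \<Rightarrow> complex) \<Rightarrow> 'a \<Rightarrow> ennreal" where
  "intrinsic_square \<alpha> f x =
     ennreal_powr
       (\<integral>\<^sup>+q\<in>vertical_cone x. (intrinsic_sup \<alpha> f (fst q) (snd q))\<^sup>2 / ennreal (snd q ^ (DIM('a) + 1)) \<partial>lebesgue)
       (1 / 2)"

subsection \<open>Generalized Morrey norm\<close>

text \<open>
  The square functions and the \<open>\<ell>\<^sup>2\<close>-norms of sequences are nonnegative and may be infinite on a
  null set, so the Morrey norm is defined for functions with values in \<open>[0, \<infinity>]\<close>. A function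
  that is not locally integrable (in particular, not measurable) has norm \<open>\<infinity>\<close>, the infimum of the
  empty set.
\<close>

definition locally_integrable_ext :: "('a::euclidean_space \<Rightarrow> ennreal) \<Rightarrow> bool" where
  "locally_integrable_ext g \<longleftrightarrow>
     g \<in> borel_measurable lebesgue \<and> (\<forall>K. compact K \<longrightarrow> (\<integral>\<^sup>+x\<in>K. g x \<partial>lebesgue) < \<infinity>)"

definition morrey_norm :: "real \<Rightarrow> (real \<Rightarrow> real) \<Rightarrow> ('a::euclidean_space \<Rightarrow> ennreal) \<Rightarrow> ennreal" where
  "morrey_norm p \<Phi> g =
     Inf {ennreal C | C. C > 0 \<and> locally_integrable_ext g \<and>
            (\<forall>x0 r. r > 0 \<longrightarrow>
               (\<integral>\<^sup>+x\<in>ball x0 r. ennreal_powr (g x) p \<partial>lebesgue) \<le> ennreal (C powr p * \<Phi> r))}"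

definition l2_seq :: "(nat \<Rightarrow> 'a \<Rightarrow> ennreal) \<Rightarrow> 'a \<Rightarrow> ennreal" where
  "l2_seq g x = ennreal_powr (\<Sum>j. (g j x)\<^sup>2) (1 / 2)"

end

theory Submission
  imports Defs
begin

text \<open>
  The test functions of \<open>\<C>\<^sub>\<alpha>\<close> are Hoelder continuous with mean zero, so dilates of two of them at scales
  \<open>r \<le> r'\<close> have inner product \<open>O((r/r')\<^sup>\<alpha> r'\<^sup>-\<^sup>n)\<close>, and vanishing inner product if their supports are
  disjoint. After discretising the upper half space by lattices of spacing \<open>2\<^sup>k\<close>, Schur's test and
  Bessel's inequality bound the square function on \<open>L\<^sup>2\<close>; a sum over \<open>j\<close> costs nothing here.

  The bound on \<open>L\<^sup>p(\<ell>\<^sup>2)\<close> follows by cutting at the level sets of the maximal function \<open>M\<close>. For \<open>p > 2\<close>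
  one has \<open>\<integral> S(f)\<^sup>2 w \<le> C \<integral> |f|\<^sup>2 M w\<close>: a ball on which the average of \<open>w\<close> exceeds \<open>l\<close> lies in
  \<open>{M w > l}\<close>, so it only sees the restriction of \<open>f\<close> to that set; integrate the \<open>L\<^sup>2\<close> bound over \<open>l\<close>,
  take \<open>w = S(f)\<^sup>p\<^sup>-\<^sup>2\<close> and absorb. For \<open>p < 2\<close>, with \<open>F = |f|\<close> and \<open>\<Omega> = {M F > l}\<close>, average \<open>f\<close> inside \<open>\<Omega>\<close> over
  balls whose radius is a quarter of the distance to the complement. The averaged function is bounded by
  \<open>C l\<close> on \<open>\<Omega>\<close>, and the error is summable over the balls that leave \<open>\<Omega>\<close>, so
  \<open>\<integral> S(f)\<^sup>2\<close> over the complement of \<open>\<Omega>\<close> is at most \<open>C (\<integral> F\<^sup>2 + l \<integral> F)\<close>, the first integral over the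
  complement of \<open>\<Omega>\<close> and the second over \<open>\<Omega>\<close>. Integrating in \<open>l\<close> and \<open>F \<le> M F\<close> give the claim.

  On a ball \<open>B\<close> of radius \<open>r\<close>, the small balls inside \<open>2B\<close> see only the restriction of \<open>f\<close> to \<open>2B\<close>. The
  others have radius \<open>R > r/2\<close>; they contribute at most \<open>C (\<Phi>(4R) / R\<^sup>n)\<^sup>1\<^sup>/\<^sup>p\<close> each, and these sum
  geometrically because \<open>D < 2\<^sup>n\<close>.
\<close>

subsection \<open>Powers and the layer cake formula\<close>

text \<open>The square function is built from suprema over uncountably many test functions and is
  only sublinear, so there is no kernel to estimate and no adjoint to pass to. What replaces them is
  locality: the coefficient of a ball depends on f only through its values on that ball. Hence f may
  be cut off to any set containing the balls under consideration, and the arguments become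
  selections of balls, with one L^2 inequality behind the global bounds.

  The passage to a lattice serves three ends. Test functions can be picked independently for each of
  finitely many balls. For finitely many balls the quantity to be bounded is finite as soon as the
  right-hand side is, so it may be absorbed. Monotone convergence then recovers the full square
  function, because no constant depends on the finite set.

  The Hoelder classes survive a change of ball up to a factor, which is what allows a point (y, t)
  to be moved to a lattice ball. Sequences are handled by summing the squared coefficients ball by
  ball; Minkowski's inequality brings the l^2 norm inside the averages.\<close>

lemma ennreal_powr_ennreal [simp]: "0 \<le> x \<Longrightarrow> ennreal_powr (ennreal x) p = ennreal (x powr p)"
  by (simp add: ennreal_powr_def)

lemma ennreal_powr_top [simp]: "ennreal_powr top p = top"
  by (simp add: ennreal_powr_def)

lemma ennreal_powr_zero [simp]: "ennreal_powr 0 p = 0"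
  by (simp add: ennreal_powr_def)

lemma ennreal_powr_one [simp]: "ennreal_powr x 1 = x"
  by (cases x) auto

lemma ennreal_powr_mono:
  assumes "x \<le> y" "0 < p"
  shows "ennreal_powr x p \<le> ennreal_powr y p"
  using assms by (cases x; cases y) (auto intro!: ennreal_leI powr_mono2 simp: top_unique)

lemma ennreal_powr_powr:
  assumes "0 < p" "0 < q"
  shows "ennreal_powr (ennreal_powr x p) q = ennreal_powr x (p * q)"
  using assms by (cases x) (auto simp: powr_powr)

lemma ennreal_powr_mult:
  assumes "0 < p"
  shows "ennreal_powr (x * y) p = ennreal_powr x p * ennreal_powr y p"
proof (cases "x = 0 \<or> y = 0")
  case False
  then show ?thesis
    using assms by (cases x; cases y)
      (auto simp: ennreal_mult[symmetric] powr_mult ennreal_top_mult ennreal_mult_top)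
qed auto

lemma ennreal_powr_add:
  assumes "0 < a" "0 < b"
  shows "ennreal_powr x a * ennreal_powr x b = ennreal_powr x (a + b)"
  using assms by (cases x) (auto simp: ennreal_mult[symmetric] powr_add)

lemma ennreal_powr_two [simp]: "ennreal_powr x 2 = x\<^sup>2"
  by (cases x) (auto simp: ennreal_power power_top_ennreal)

lemma ennreal_powr_half_power2 [simp]: "(ennreal_powr x (1/2))\<^sup>2 = x"
  using ennreal_powr_powr[of "1/2" 2 x] by simp

lemma ennreal_powr_power2:
  assumes "0 < p"
  shows "ennreal_powr (x\<^sup>2) p = ennreal_powr x (2 * p)"
  using ennreal_powr_powr[of 2 p x] assms by simp

lemma ennreal_powr_less_iff:
  assumes "0 < p"
  shows "ennreal_powr x p < ennreal_powr y p \<longleftrightarrow> x < y"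
proof -
  have "x \<le> y" if "ennreal_powr x p \<le> ennreal_powr y p" for x y
    using ennreal_powr_mono[OF that, of "1/p"] assms by (simp add: ennreal_powr_powr)
  then show ?thesis
    using ennreal_powr_mono[OF _ assms] by (meson not_le)
qed

lemma ennreal_powr_measurable [measurable]: "(\<lambda>x. ennreal_powr x p) \<in> borel_measurable borel"
  unfolding ennreal_powr_def by measurable

lemma ennreal_powr_add_le:
  assumes "0 < p"
  shows "ennreal_powr (x + y) p \<le> ennreal (2 powr p) * (ennreal_powr x p + ennreal_powr y p)"
proof -
  have "x + y \<le> 2 * max x y"
    by (metis add_mono max.cobounded1 max.cobounded2 mult_2)
  then have "ennreal_powr (x + y) p \<le> ennreal_powr (2 * max x y) p"
    using assms by (rule ennreal_powr_mono)
  also have "\<dots> = ennreal (2 powr p) * ennreal_powr (max x y) p"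
    using assms ennreal_powr_ennreal[of 2 p] by (simp add: ennreal_powr_mult)
  also have "ennreal_powr (max x y) p \<le> ennreal_powr x p + ennreal_powr y p"
    by (simp add: max_def)
  finally show ?thesis by (simp add: mult_left_mono)
qed

text \<open>The power with exponent \<open>1/p\<close> is a monotone inverse, so the map is an order
  isomorphism of [0, \<infinity>] and commutes with suprema.\<close>

lemma ennreal_powr_SUP:
  assumes "0 < p" "I \<noteq> {}"
  shows "ennreal_powr (SUP i\<in>I. f i) p = (SUP i\<in>I. ennreal_powr (f i) p)"
proof (rule antisym)
  let ?s = "SUP i\<in>I. ennreal_powr (f i) p"
  have "f i \<le> ennreal_powr ?s (1/p)" if "i \<in> I" for i
  proof -
    have "f i = ennreal_powr (ennreal_powr (f i) p) (1/p)"
      using assms by (simp add: ennreal_powr_powr)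
    also have "\<dots> \<le> ennreal_powr ?s (1/p)"
      using assms that by (intro ennreal_powr_mono SUP_upper) auto
    finally show ?thesis .
  qed
  then have "(SUP i\<in>I. f i) \<le> ennreal_powr ?s (1/p)" by (rule SUP_least)
  then have "ennreal_powr (SUP i\<in>I. f i) p \<le> ennreal_powr (ennreal_powr ?s (1/p)) p"
    using assms by (intro ennreal_powr_mono)
  then show "ennreal_powr (SUP i\<in>I. f i) p \<le> ?s"
    using assms by (simp add: ennreal_powr_powr)
next
  show "(SUP i\<in>I. ennreal_powr (f i) p) \<le> ennreal_powr (SUP i\<in>I. f i) p"
    using assms by (intro SUP_least ennreal_powr_mono SUP_upper)
qed

text \<open>Serves to pass from finite integrals of powers over bounded sets to local
  integrability.\<close>

lemma ennreal_le_one_plus_powr: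
  assumes "1 \<le> p"
  shows "x \<le> 1 + ennreal_powr x p"
proof (cases x)
  case (real r)
  have "r \<le> 1 + r powr p"
  proof (cases "r \<le> 1")
    case False
    then have "r powr 1 \<le> r powr p" using assms by (intro powr_mono) auto
    then show ?thesis using False by simp
  qed (simp add: add_increasing2)
  then show ?thesis using real
    by (metis ennreal_1 ennreal_leI ennreal_plus ennreal_powr_ennreal powr_ge_zero zero_le_one)
qed auto

lemma nn_integral_powr_below:
  assumes "- 1 < a"
  shows "(\<integral>\<^sup>+l. ennreal (l powr a) * indicator {l. 0 < l \<and> ennreal l < v} l \<partial>lborel)
           = ennreal (1 / (a + 1)) * ennreal_powr v (a + 1)"
proof -
  have fin: "(\<integral>\<^sup>+l. ennreal (l powr a) * indicator {l. 0 < l \<and> ennreal l < ennreal r} l \<partial>lborel)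
       = ennreal (r powr (a+1) / (a+1))" if "0 \<le> r" for r
  proof -
    have "(\<integral>\<^sup>+l. ennreal (l powr a) * indicator {l. 0 < l \<and> ennreal l < ennreal r} l \<partial>lborel)
        = (\<integral>\<^sup>+l. ennreal (l powr a) * indicator {0..r} l \<partial>lborel)"
      by (intro nn_integral_cong_AE, use AE_lborel_singleton[of 0] AE_lborel_singleton[of r] in eventually_elim)
         (use that in \<open>auto simp: indicator_def ennreal_less_iff\<close>)
    also have "\<dots> = ennreal (r powr (a+1) / (a+1))"
      using that assms
      by (intro nn_integral_has_integral_lebesgue' has_integral_powr_from_0) auto
    finally show ?thesis .
  qed
  show ?thesis
  proof (cases v)
    case (real r)
    then show ?thesis using assms fin[of r] by (simp add: ennreal_mult[symmetric])
  next
    case top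
    have "ennreal N \<le> (\<integral>\<^sup>+l. ennreal (l powr a) * indicator {l. 0 < l \<and> ennreal l < v} l \<partial>lborel)" if "0 \<le> N" for N
    proof -
      \<comment> \<open>Chosen so that the integral truncated at \<open>r\<close> equals
        \<open>N\<close>; as \<open>N\<close> is arbitrary, the full integral is infinite.\<close>
      define r where "r = (N * (a+1)) powr (1/(a+1))"
      have "ennreal N = ennreal (r powr (a+1) / (a+1))"
        using assms that by (simp add: r_def powr_powr)
      also have "\<dots> = (\<integral>\<^sup>+l. ennreal (l powr a) * indicator {l. 0 < l \<and> ennreal l < ennreal r} l \<partial>lborel)"
        by (rule fin[symmetric]) (simp add: r_def)
      also have "\<dots> \<le> (\<integral>\<^sup>+l. ennreal (l powr a) * indicator {l. 0 < l \<and> ennreal l < v} l \<partial>lborel)"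
        by (intro nn_integral_mono) (auto simp: indicator_def top)
      finally show ?thesis .
    qed
    then have "(\<integral>\<^sup>+l. ennreal (l powr a) * indicator {l. 0 < l \<and> ennreal l < v} l \<partial>lborel) = top"
      (is "?I = top")
    proof (cases ?I)
      case (real r)
      then show ?thesis
        using \<open>\<And>N. 0 \<le> N \<Longrightarrow> ennreal N \<le> ?I\<close>[of "r + 1"] by simp
    qed
    then show ?thesis using assms by (simp add: top ennreal_mult_top)
  qed
qed

lemma nn_integral_powr_above:
  assumes "e < - 1" "0 < r"
  shows "(\<integral>\<^sup>+l. ennreal (l powr e) * indicator {l. 0 < l \<and> ennreal r \<le> ennreal l} l \<partial>lborel)
           = ennreal (r powr (e + 1) / (- e - 1))"
proof -
  have "(\<integral>\<^sup>+l. ennreal (l powr e) * indicator {l. 0 < l \<and> ennreal r \<le> ennreal l} l \<partial>lborel)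
      = (\<integral>\<^sup>+l. ennreal (l powr e) * indicator {r..} l \<partial>lborel)"
    using assms by (intro nn_integral_cong) (auto simp: indicator_def ennreal_le_iff2)
  also have "\<dots> = ennreal (- (r powr (e + 1)) / (e + 1))"
    using assms by (intro nn_integral_has_integral_lebesgue' has_integral_powr_to_inf) auto
  also have "- (r powr (e + 1)) / (e + 1) = r powr (e + 1) / (- e - 1)"
    using assms by (simp add: field_simps)
  finally show ?thesis .
qed

text \<open>Tonelli's theorem applied to the region under the graph of \<open>g\<close>. The weight
  is carried along because later uses integrate a function over the level sets of a maximal function
  instead of measuring these sets.\<close>

lemma layer_cake:
  assumes [measurable]: "g \<in> borel_measurable (lborel :: 'a::euclidean_space measure)"
    and [measurable]: "w \<in> borel_measurable (lborel :: 'a measure)" and "- 1 < a"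
  shows "(\<integral>\<^sup>+x. w x * ennreal_powr (g x) (a + 1) \<partial>lborel) =
    ennreal (a + 1) * (\<integral>\<^sup>+l. ennreal (l powr a) * indicator {0<..} l *
       (\<integral>\<^sup>+x. w x * indicator {x. ennreal l < g x} x \<partial>lborel) \<partial>lborel)"
proof -
  have "(\<integral>\<^sup>+l. ennreal (l powr a) * indicator {0<..} l * (\<integral>\<^sup>+x. w x * indicator {x. ennreal l < g x} x \<partial>lborel) \<partial>lborel)
     = (\<integral>\<^sup>+l. (\<integral>\<^sup>+x. ennreal (l powr a) * indicator {0<..} l * (w x * indicator {x. ennreal l < g x} x) \<partial>lborel) \<partial>lborel)"
    by (intro nn_integral_cong nn_integral_cmult[symmetric]) measurable
  also have "\<dots> = (\<integral>\<^sup>+x. (\<integral>\<^sup>+l. ennreal (l powr a) * indicator {0<..} l * (w x * indicator {x. ennreal l < g x} x) \<partial>lborel) \<partial>lborel)"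
    unfolding indicator_def by (rule lborel_pair.Fubini') measurable
  also have "\<dots> = (\<integral>\<^sup>+x. w x * (\<integral>\<^sup>+l. ennreal (l powr a) * indicator {l. 0 < l \<and> ennreal l < g x} l \<partial>lborel) \<partial>lborel)"
    by (subst nn_integral_cmult[symmetric]) (auto intro!: nn_integral_cong simp: indicator_def mult.commute)
  also have "\<dots> = (\<integral>\<^sup>+x. w x * (ennreal (1 / (a + 1)) * ennreal_powr (g x) (a + 1)) \<partial>lborel)"
    using assms by (simp add: nn_integral_powr_below)
  also have "\<dots> = ennreal (1 / (a + 1)) * (\<integral>\<^sup>+x. w x * ennreal_powr (g x) (a + 1) \<partial>lborel)"
    by (subst nn_integral_cmult[symmetric]) (auto simp: ac_simps)
  finally show ?thesis
    using assms by (simp add: mult.assoc[symmetric] ennreal_mult[symmetric])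
qed

subsection \<open>The maximal function\<close>

abbreviation ball_vol :: "'a::euclidean_space itself \<Rightarrow> real" where
  "ball_vol _ \<equiv> unit_ball_vol (real DIM('a))"

lemma ball_vol_pos: "0 < ball_vol TYPE('a::euclidean_space)"
  by (simp add: unit_ball_vol_pos)

lemma emeasure_ball':
  fixes y :: "'a::euclidean_space"
  assumes "0 \<le> r"
  shows "emeasure lborel (ball y r) = ennreal (ball_vol TYPE('a) * r ^ DIM('a))"
  using assms by (simp add: emeasure_ball)

lemma ball_borel_measurable [measurable]: "ball (y::'a::euclidean_space) r \<in> sets borel"
  by simp

text \<open>The uncentred Hardy-Littlewood maximal function. Uncentred, because then a ball with
  average above \<open>c\<close> lies entirely in the level set of \<open>c\<close>; this makes
  level sets open, and it is the form in which balls are sorted by level later on.\<close>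

definition hlmax :: "('a::euclidean_space \<Rightarrow> ennreal) \<Rightarrow> 'a \<Rightarrow> ennreal" where
  "hlmax h x = (SUP (y, r)\<in>{(y, r). 0 < r \<and> x \<in> ball y r}.
     (\<integral>\<^sup>+z\<in>ball y r. h z \<partial>lborel) / ennreal (ball_vol TYPE('a) * r ^ DIM('a)))"

lemma hlmax_ge:
  fixes y :: "'a::euclidean_space"
  assumes "x \<in> ball y r"
  shows "(\<integral>\<^sup>+z\<in>ball y r. h z \<partial>lborel) / ennreal (ball_vol TYPE('a) * r ^ DIM('a)) \<le> hlmax h x"
proof -
  have "0 < r" using assms by (metis le_less_trans mem_ball zero_le_dist)
  then show ?thesis
    unfolding hlmax_def using assms by (intro SUP_upper2[of "(y, r)"]) auto
qed

lemma ennreal_divide_le_iff: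
  assumes "0 < c"
  shows "a / ennreal c \<le> b \<longleftrightarrow> a \<le> ennreal c * b"
  using assms by (cases a; cases b)
    (auto simp: divide_ennreal ennreal_mult[symmetric] field_simps ennreal_top_divide ennreal_mult_top
      ennreal_mult_top top_unique)

lemma ball_integral_le_hlmax:
  fixes y :: "'a::euclidean_space"
  assumes "x \<in> ball y r"
  shows "(\<integral>\<^sup>+z\<in>ball y r. h z \<partial>lborel) \<le> ennreal (ball_vol TYPE('a) * r ^ DIM('a)) * hlmax h x"
proof -
  have "0 < r" using assms by (metis le_less_trans mem_ball zero_le_dist)
  then show ?thesis
    using hlmax_ge[OF assms, of h] ball_vol_pos[where 'a='a]
    by (simp add: ennreal_divide_le_iff)
qed

lemma less_hlmax_iff:
  fixes x :: "'a::euclidean_space"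
  shows "c < hlmax h x \<longleftrightarrow> (\<exists>y r. 0 < r \<and> x \<in> ball y r \<and>
    c < (\<integral>\<^sup>+z\<in>ball y r. h z \<partial>lborel) / ennreal (ball_vol TYPE('a) * r ^ DIM('a)))"
  unfolding hlmax_def less_SUP_iff by auto

lemma open_hlmax: "open {x. c < hlmax h x}"
  unfolding open_contains_ball
proof safe
  fix x assume "c < hlmax h x"
  then obtain y r where yr: "0 < r" "x \<in> ball y r"
    "c < (\<integral>\<^sup>+z\<in>ball y r. h z \<partial>lborel) / ennreal (ball_vol TYPE('a) * r ^ DIM('a))"
    unfolding less_hlmax_iff by blast
  obtain e where e: "e > 0" "ball x e \<subseteq> ball y r"
    using yr(2) open_ball open_contains_ball by blast
  then show "\<exists>e>0. ball x e \<subseteq> {x. c < hlmax h x}"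
    unfolding less_hlmax_iff using yr by blast
qed

lemma hlmax_measurable [measurable]: "hlmax h \<in> borel_measurable borel"
  by (rule borel_measurableI_greater) (simp add: open_hlmax)

section \<open>Covering arguments and the maximal theorem\<close>

lemma emeasure_UN_le_nn_integral:
  assumes "countable I" "\<And>i. i \<in> I \<Longrightarrow> X i \<in> sets M"
  shows "emeasure M (\<Union>i\<in>I. X i) \<le> (\<integral>\<^sup>+i. emeasure M (X i) \<partial>count_space I)"
proof -
  have "emeasure M (\<Union>i\<in>I. X i) = (\<integral>\<^sup>+x. indicator (\<Union>i\<in>I. X i) x \<partial>M)"
    using assms by (intro nn_integral_indicator[symmetric]) auto
  also have "\<dots> \<le> (\<integral>\<^sup>+x. (\<integral>\<^sup>+i. indicator (X i) x \<partial>count_space I) \<partial>M)"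
  proof (rule nn_integral_mono)
    fix x
    show "indicator (\<Union>i\<in>I. X i) x \<le> (\<integral>\<^sup>+i. indicator (X i) x \<partial>count_space I)"
    proof (cases "x \<in> (\<Union>i\<in>I. X i)")
      case True
      then obtain i where "i \<in> I" "x \<in> X i" by auto
      then show ?thesis
        using nn_integral_ge_point[of i I "\<lambda>i. indicator (X i) x"] True by (simp add: indicator_def)
    qed auto
  qed
  also have "\<dots> = (\<integral>\<^sup>+i. (\<integral>\<^sup>+x. indicator (X i) x \<partial>M) \<partial>count_space I)"
    using assms by (intro nn_integral_count_space_nn_integral) auto
  also have "\<dots> = (\<integral>\<^sup>+i. emeasure M (X i) \<partial>count_space I)"
    using assms by (intro nn_integral_cong) auto
  finally show ?thesis .
qed

lemma nn_integral_UN_disjoint: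
  fixes h :: "'a \<Rightarrow> ennreal"
  assumes [measurable]: "h \<in> borel_measurable M"
    and "countable I" "\<And>i. i \<in> I \<Longrightarrow> X i \<in> sets M" "disjoint_family_on X I"
  shows "(\<integral>\<^sup>+i. (\<integral>\<^sup>+x\<in>X i. h x \<partial>M) \<partial>count_space I) = (\<integral>\<^sup>+x\<in>(\<Union>i\<in>I. X i). h x \<partial>M)"
proof -
  have "emeasure (density M h) (\<Union>i\<in>I. X i) = (\<integral>\<^sup>+i. emeasure (density M h) (X i) \<partial>count_space I)"
    using assms by (intro emeasure_UN_countable) auto
  also have "\<dots> = (\<integral>\<^sup>+i. (\<integral>\<^sup>+x\<in>X i. h x \<partial>M) \<partial>count_space I)"
    using assms by (intro nn_integral_cong) (auto simp: emeasure_density)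
  moreover have "(\<Union>i\<in>I. X i) \<in> sets M"
    using assms by (intro sets.countable_UN') auto
  ultimately show ?thesis
    by (simp add: emeasure_density)
qed

text \<open>Vitali: among the balls with average above \<open>l\<close>, a disjoint subfamily covers
  the level set after enlargement by 5, whence the constant 5^n. Disjointness lets the integrals of
  \<open>h\<close> over the chosen balls add up to at most the total integral.\<close>

lemma hlmax_weak_type:
  fixes h :: "'a::euclidean_space \<Rightarrow> ennreal"
  assumes [measurable]: "h \<in> borel_measurable borel" and l: "0 < l"
  shows "ennreal l * emeasure lborel {x. ennreal l < hlmax h x} \<le> ennreal (5 ^ DIM('a)) * (\<integral>\<^sup>+x. h x \<partial>lborel)"
proof (cases "(\<integral>\<^sup>+x. h x \<partial>lborel)")
  case top
  then show ?thesis by (simp add: ennreal_mult_top)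
next
  case (real H)
  let ?n = "DIM('a)" and ?o = "ball_vol TYPE('a)"
  define K :: "('a \<times> real) set" where
    "K = {(y, r). 0 < r \<and> ennreal l < (\<integral>\<^sup>+z\<in>ball y r. h z \<partial>lborel) / ennreal (?o * r ^ ?n)}"
  have o: "0 < ?o" by (rule ball_vol_pos)
  have key: "ennreal l * emeasure lborel (ball y r) \<le> (\<integral>\<^sup>+z\<in>ball y r. h z \<partial>lborel)" if "(y, r) \<in> K" for y r
  proof -
    have "0 < r" "ennreal l < (\<integral>\<^sup>+z\<in>ball y r. h z \<partial>lborel) / ennreal (?o * r ^ ?n)"
      using that by (auto simp: K_def)
    then show ?thesis
      using o ennreal_divide_le_iff[of "?o * r ^ ?n" "(\<integral>\<^sup>+z\<in>ball y r. h z \<partial>lborel)" "ennreal l"]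
      by (auto simp: emeasure_ball' mult.commute not_less[symmetric])
  qed
  \<comment> \<open>The covering lemma asks for bounded radii. The total mass \<open>H\<close>
    bounds l times the volume of each ball, hence r^n, and r \<le> 1 + r^n turns this into a bound
    for r itself.\<close>
  have rbd: "0 < r \<and> r \<le> 1 + H / (l * ?o)" if "(y, r) \<in> K" for y r
  proof -
    have r: "0 < r" using that by (auto simp: K_def)
    have "ennreal (l * (?o * r ^ ?n)) \<le> (\<integral>\<^sup>+z\<in>ball y r. h z \<partial>lborel)"
      using key[OF that] r l o by (simp add: emeasure_ball' ennreal_mult)
    also have "\<dots> \<le> (\<integral>\<^sup>+z. h z \<partial>lborel)"
      by (intro nn_integral_mono) (auto simp: indicator_def)
    finally have "l * (?o * r ^ ?n) \<le> H" using real by simp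
    then have "r ^ ?n \<le> H / (l * ?o)" using l o by (simp add: field_simps)
    moreover have "r \<le> 1 + r ^ ?n"
    proof (cases "r \<le> 1")
      case False
      then show ?thesis using self_le_power[of r ?n] by simp
    qed (use r in \<open>simp add: add_increasing2\<close>)
    ultimately show ?thesis using r by simp
  qed
  obtain C where C: "countable C" "C \<subseteq> K"
     "pairwise (\<lambda>i j. disjnt (ball (fst i) (snd i)) (ball (fst j) (snd j))) C"
     "{x. ennreal l < hlmax h x} \<subseteq> (\<Union>i\<in>C. ball (fst i) (5 * snd i))"
  proof (rule Vitali_covering_lemma_balls[where S="{x. ennreal l < hlmax h x}" and K=K and a=fst and r=snd and B="1 + H / (l * ?o)"])
    show "{x. ennreal l < hlmax h x} \<subseteq> (\<Union>i\<in>K. ball (fst i) (snd i))"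
      unfolding less_hlmax_iff K_def by fastforce
  qed (use rbd in auto)
  have disj: "disjoint_family_on (\<lambda>i. ball (fst i) (snd i)) C"
    using C(3) by (auto simp: disjoint_family_on_def pairwise_def disjnt_def)
  have "emeasure lborel {x. ennreal l < hlmax h x} \<le> emeasure lborel (\<Union>i\<in>C. ball (fst i) (5 * snd i))"
    using C by (intro emeasure_mono) auto
  also have "\<dots> \<le> (\<integral>\<^sup>+i. emeasure lborel (ball (fst i) (5 * snd i)) \<partial>count_space C)"
    using C by (intro emeasure_UN_le_nn_integral) auto
  also have "\<dots> = (\<integral>\<^sup>+i. ennreal (5 ^ ?n) * emeasure lborel (ball (fst i) (snd i)) \<partial>count_space C)"
    using C(2) rbd o by (intro nn_integral_cong)
      (force simp: emeasure_ball' ennreal_mult[symmetric] power_mult_distrib ac_simps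
        intro!: arg_cong[where f=ennreal] less_imp_le)
  also have "\<dots> = ennreal (5 ^ ?n) * (\<integral>\<^sup>+i. emeasure lborel (ball (fst i) (snd i)) \<partial>count_space C)"
    by (rule nn_integral_cmult) auto
  finally have "ennreal l * emeasure lborel {x. ennreal l < hlmax h x}
      \<le> ennreal (5 ^ ?n) * (ennreal l * (\<integral>\<^sup>+i. emeasure lborel (ball (fst i) (snd i)) \<partial>count_space C))"
    by (simp add: mult.left_commute mult_left_mono)
  also have "ennreal l * (\<integral>\<^sup>+i. emeasure lborel (ball (fst i) (snd i)) \<partial>count_space C)
      = (\<integral>\<^sup>+i. ennreal l * emeasure lborel (ball (fst i) (snd i)) \<partial>count_space C)"
    by (rule nn_integral_cmult[symmetric]) auto
  also have "\<dots> \<le> (\<integral>\<^sup>+i. (\<integral>\<^sup>+z\<in>ball (fst i) (snd i). h z \<partial>lborel) \<partial>count_space C)"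
    using C(2) key by (intro nn_integral_mono) auto
  also have "\<dots> = (\<integral>\<^sup>+z\<in>(\<Union>i\<in>C. ball (fst i) (snd i)). h z \<partial>lborel)"
    using C disj by (intro nn_integral_UN_disjoint) auto
  also have "\<dots> \<le> (\<integral>\<^sup>+z. h z \<partial>lborel)"
    by (intro nn_integral_mono) (auto simp: indicator_def)
  finally show ?thesis by (simp add: mult_left_mono)
qed

text \<open>The part of \<open>h\<close> below l/2 contributes at most l/2 to any average, so the
  part above has maximal function larger than l/2 on the level set. Applying the weak type bound at
  height l/2 costs the factor 2. With the truncation on the right, the inequality can be integrated
  over all levels.\<close>

lemma hlmax_weak_type_truncated:
  fixes h :: "'a::euclidean_space \<Rightarrow> ennreal"
  assumes [measurable]: "h \<in> borel_measurable borel" and l: "0 < l"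
  shows "ennreal l * emeasure lborel {x. ennreal l < hlmax h x}
      \<le> ennreal (2 * 5 ^ DIM('a)) * (\<integral>\<^sup>+x. h x * indicator {x. ennreal l < 2 * h x} x \<partial>lborel)"
proof -
  let ?o = "ball_vol TYPE('a)"
  define g where "g = (\<lambda>x. h x * indicator {x. ennreal l < 2 * h x} x)"
  have g[measurable]: "g \<in> borel_measurable borel" unfolding g_def by measurable
  have hg: "h x \<le> ennreal (l/2) + g x" for x
  proof (cases "ennreal l < 2 * h x")
    case False
    then have "2 * h x \<le> 2 * ennreal (l/2)"
      using l ennreal_mult[of 2 "l/2"] by (simp add: not_less)
    then have "h x \<le> ennreal (l/2)"
      using ennreal_mult_le_mult_iff[of 2] by simp
    then show ?thesis by (simp add: add_increasing2)
  qed (simp add: g_def)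
  have "{x. ennreal l < hlmax h x} \<subseteq> {x. ennreal (l/2) < hlmax g x}"
  proof safe
    fix x assume "ennreal l < hlmax h x"
    then obtain y r where yr: "0 < r" "x \<in> ball y r"
      "ennreal l < (\<integral>\<^sup>+z\<in>ball y r. h z \<partial>lborel) / ennreal (?o * r ^ DIM('a))"
      unfolding less_hlmax_iff by blast
    define v where "v = ?o * r ^ DIM('a)"
    have v: "0 < v" using yr ball_vol_pos[where 'a='a] by (simp add: v_def)
    have "(\<integral>\<^sup>+z\<in>ball y r. h z \<partial>lborel) \<le> (\<integral>\<^sup>+z\<in>ball y r. (ennreal (l/2) + g z) \<partial>lborel)"
      by (intro nn_integral_mono mult_right_mono hg) auto
    also have "\<dots> = ennreal (l/2) * ennreal v + (\<integral>\<^sup>+z\<in>ball y r. g z \<partial>lborel)"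
    proof -
      have "(\<integral>\<^sup>+z. ennreal (l/2) * indicator (ball y r) z \<partial>lborel) = ennreal (l/2) * ennreal v"
        using yr by (subst nn_integral_cmult_indicator) (simp_all add: emeasure_ball' v_def)
      then show ?thesis unfolding distrib_right by (subst nn_integral_add) auto
    qed
    finally have 1: "(\<integral>\<^sup>+z\<in>ball y r. h z \<partial>lborel) \<le> ennreal (l/2) * ennreal v + (\<integral>\<^sup>+z\<in>ball y r. g z \<partial>lborel)" .
    have "ennreal (l/2) < (\<integral>\<^sup>+z\<in>ball y r. g z \<partial>lborel) / ennreal v"
    proof (rule ccontr)
      assume "\<not> ennreal (l/2) < (\<integral>\<^sup>+z\<in>ball y r. g z \<partial>lborel) / ennreal v"
      then have "(\<integral>\<^sup>+z\<in>ball y r. g z \<partial>lborel) \<le> ennreal v * ennreal (l/2)"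
        using v by (simp add: ennreal_divide_le_iff not_less)
      with 1 have "(\<integral>\<^sup>+z\<in>ball y r. h z \<partial>lborel) \<le> ennreal (l/2) * ennreal v + ennreal v * ennreal (l/2)"
        by (meson add_left_mono order_trans)
      also have "\<dots> = ennreal v * ennreal l"
        using v l by (simp add: ennreal_mult[symmetric] ennreal_plus[symmetric] del: ennreal_plus)
      finally show False
        using yr(3) ennreal_divide_le_iff[OF v] by (metis not_less v_def)
    qed
    then show "ennreal (l/2) < hlmax g x"
      unfolding less_hlmax_iff using yr v_def by blast
  qed
  then have "ennreal l * emeasure lborel {x. ennreal l < hlmax h x}
      \<le> 2 * (ennreal (l/2) * emeasure lborel {x. ennreal (l/2) < hlmax g x})"
    using l ennreal_mult[of 2 "l/2"] by (auto simp: mult.assoc[symmetric] intro!: mult_left_mono emeasure_mono)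
  also have "\<dots> \<le> 2 * (ennreal (5 ^ DIM('a)) * (\<integral>\<^sup>+x. g x \<partial>lborel))"
    using l by (intro mult_left_mono hlmax_weak_type) auto
  finally show ?thesis by (simp add: g_def ennreal_mult mult.assoc)
qed

text \<open>Marcinkiewicz interpolation done by hand. In the constant, \<open>q\<close> comes from
  the layer cake formula, 2 * 5^n from the truncated weak type bound, and 2^(q-1)/(q-1) from
  integrating l^(q-2) up to 2 h.\<close>

lemma hlmax_strong_type:
  fixes h :: "'a::euclidean_space \<Rightarrow> ennreal"
  assumes [measurable]: "h \<in> borel_measurable borel" and q: "1 < q"
  shows "(\<integral>\<^sup>+x. ennreal_powr (hlmax h x) q \<partial>lborel)
    \<le> ennreal (q * (2 * 5 ^ DIM('a)) * 2 powr (q - 1) / (q - 1)) * (\<integral>\<^sup>+x. ennreal_powr (h x) q \<partial>lborel)"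
proof -
  let ?c = "2 * 5 ^ DIM('a) :: real"
  have "(\<integral>\<^sup>+x. ennreal_powr (hlmax h x) q \<partial>lborel) = (\<integral>\<^sup>+x. 1 * ennreal_powr (hlmax h x) (q - 1 + 1) \<partial>lborel)"
    by simp
  also have "\<dots> = ennreal (q - 1 + 1) * (\<integral>\<^sup>+l. ennreal (l powr (q - 1)) * indicator {0<..} l *
       (\<integral>\<^sup>+x. 1 * indicator {x. ennreal l < hlmax h x} x \<partial>(lborel::'a measure)) \<partial>lborel)"
    using q by (intro layer_cake) auto
  also have "\<dots> \<le> ennreal (q - 1 + 1) * (\<integral>\<^sup>+l. ennreal ?c * (ennreal (l powr (q - 2)) * indicator {0<..} l *
       (\<integral>\<^sup>+x. h x * indicator {x. ennreal l < 2 * h x} x \<partial>lborel)) \<partial>lborel)"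
  proof (intro mult_left_mono nn_integral_mono)
    fix l :: real
    show "ennreal (l powr (q - 1)) * indicator {0<..} l *
       (\<integral>\<^sup>+x. 1 * indicator {x. ennreal l < hlmax h x} x \<partial>(lborel::'a measure))
      \<le> ennreal ?c * (ennreal (l powr (q - 2)) * indicator {0<..} l *
       (\<integral>\<^sup>+x. h x * indicator {x. ennreal l < 2 * h x} x \<partial>lborel))"
    proof (cases "0 < l")
      case True
      have "ennreal (l powr (q - 1)) = ennreal (l powr (q - 2)) * ennreal l"
        using True by (simp add: ennreal_mult[symmetric] powr_diff power2_eq_square)
      then have "ennreal (l powr (q - 1)) * emeasure lborel {x. ennreal l < hlmax h x}
         = ennreal (l powr (q - 2)) * (ennreal l * emeasure lborel {x. ennreal l < hlmax h x})"
        by (simp add: mult.assoc)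
      also have "\<dots> \<le> ennreal (l powr (q - 2)) * (ennreal ?c * (\<integral>\<^sup>+x. h x * indicator {x. ennreal l < 2 * h x} x \<partial>lborel))"
        using True by (intro mult_left_mono hlmax_weak_type_truncated) auto
      finally show ?thesis using True by (simp add: mult.left_commute)
    qed simp
  qed simp
  also have "\<dots> = ennreal q * (ennreal ?c * (\<integral>\<^sup>+l. (ennreal (l powr (q - 2)) * indicator {0<..} l *
       (\<integral>\<^sup>+x. h x * indicator {x. ennreal l < 2 * h x} x \<partial>lborel)) \<partial>lborel))"
    unfolding indicator_def by (subst nn_integral_cmult) auto
  also have "(\<integral>\<^sup>+l. (ennreal (l powr (q - 2)) * indicator {0<..} l *
       (\<integral>\<^sup>+x. h x * indicator {x. ennreal l < 2 * h x} x \<partial>lborel)) \<partial>lborel)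
     = ennreal (1 / (q - 1)) * (\<integral>\<^sup>+x. h x * ennreal_powr (2 * h x) (q - 1) \<partial>lborel)"
  proof -
    have "(\<integral>\<^sup>+x. h x * ennreal_powr (2 * h x) (q - 2 + 1) \<partial>lborel) = ennreal (q - 2 + 1) * (\<integral>\<^sup>+l. (ennreal (l powr (q - 2)) * indicator {0<..} l *
       (\<integral>\<^sup>+x. h x * indicator {x. ennreal l < 2 * h x} x \<partial>lborel)) \<partial>lborel)"
      using q by (intro layer_cake) auto
    then show ?thesis using q by (simp add: mult.assoc[symmetric] ennreal_mult[symmetric])
  qed
  also have "(\<integral>\<^sup>+x. h x * ennreal_powr (2 * h x) (q - 1) \<partial>lborel)
     = (\<integral>\<^sup>+x. ennreal (2 powr (q - 1)) * ennreal_powr (h x) q \<partial>lborel)"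
  proof (intro nn_integral_cong)
    fix x
    have "h x * ennreal_powr (2 * h x) (q - 1) = ennreal_powr 2 (q - 1) * (ennreal_powr (h x) 1 * ennreal_powr (h x) (q - 1))"
      using q by (simp add: ennreal_powr_mult ac_simps)
    also have "\<dots> = ennreal (2 powr (q - 1)) * ennreal_powr (h x) q"
      using q ennreal_powr_ennreal[of 2] by (subst ennreal_powr_add) auto
    finally show "h x * ennreal_powr (2 * h x) (q - 1) = ennreal (2 powr (q - 1)) * ennreal_powr (h x) q" .
  qed
  also have "\<dots> = ennreal (2 powr (q - 1)) * (\<integral>\<^sup>+x. ennreal_powr (h x) q \<partial>lborel)"
    by (rule nn_integral_cmult) auto
  also have "ennreal q * (ennreal ?c * (ennreal (1 / (q - 1)) * (ennreal (2 powr (q - 1)) * (\<integral>\<^sup>+x. ennreal_powr (h x) q \<partial>lborel))))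
     = ennreal (q * (?c * ((1 / (q - 1)) * 2 powr (q - 1)))) * (\<integral>\<^sup>+x. ennreal_powr (h x) q \<partial>lborel)"
  proof -
    have "ennreal a * (ennreal b * (ennreal c * (ennreal d * I))) = ennreal (a * (b * (c * d))) * I"
      if "0 \<le> a" "0 \<le> b" "0 \<le> c" "0 \<le> d" for a b c d :: real and I
      using that by (simp add: ennreal_mult mult.assoc)
    then show ?thesis using q by simp
  qed
  also have "q * (?c * ((1 / (q - 1)) * 2 powr (q - 1))) = q * ?c * 2 powr (q - 1) / (q - 1)"
    by simp
  finally show ?thesis .
qed

text \<open>Half of the Lebesgue differentiation theorem: a Vitali covering of
  \<open>{hlmax h \<le> a < b < h}\<close> by balls inside a neighbourhood of almost the same measure.\<close>

lemma AE_le_hlmax: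
  fixes h :: "'a::euclidean_space \<Rightarrow> ennreal"
  assumes [measurable]: "h \<in> borel_measurable borel"
  shows "AE x in lborel. h x \<le> hlmax h x"
proof -
  let ?o = "ball_vol TYPE('a)"
  have null: "emeasure lborel {x \<in> ball 0 N. hlmax h x \<le> ennreal a \<and> ennreal b < h x} = 0"
    if ab: "0 \<le> a" "a < b" for N a b :: real
  proof -
    define E where "E = {x \<in> ball 0 N. hlmax h x \<le> ennreal a \<and> ennreal b < h x}"
    have E[measurable]: "E \<in> sets borel" unfolding E_def by measurable
    have "emeasure lborel E \<le> emeasure lborel (ball (0::'a) N)"
      by (intro emeasure_mono) (auto simp: E_def)
    also have "\<dots> < \<infinity>" by (rule emeasure_lborel_ball_finite)
    finally obtain m where m: "0 \<le> m" "emeasure lborel E = ennreal m"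
      by (cases "emeasure lborel E") auto
    \<comment> \<open>As \<open>e\<close> tends to 0 this reads b m \<le> a m, which forces m = 0
      because a < b.\<close>
    have bound: "b * m \<le> a * (m + e)" if e: "0 < e" for e
    proof -
      obtain U where U: "open U" "E \<subseteq> U" "emeasure lborel (U - E) \<le> ennreal e"
        using outer_regular_lborel_le[OF E e] by blast
      \<comment> \<open>Each of these balls meets \<open>E\<close>, where the maximal function is at
        most \<open>a\<close>, so \<open>h\<close> has average at most \<open>a\<close> on it; lying
        in \<open>U\<close>, disjoint ones have total measure at most m + e.\<close>
      define K :: "('a \<times> real) set" where
        "K = {(y, r). 0 < r \<and> ball y r \<subseteq> U \<and> ball y r \<inter> E \<noteq> {}}"
      obtain C where C: "countable C" "C \<subseteq> K"
         "pairwise (\<lambda>i j. disjnt (ball (fst i) (snd i)) (ball (fst j) (snd j))) C"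
         "negligible (E - (\<Union>i\<in>C. ball (fst i) (snd i)))"
      proof (rule Vitali_covering_theorem_balls[where S=E and K=K and a=fst and r=snd])
        fix x and d :: real assume "x \<in> E" "0 < d"
        then obtain r where r: "0 < r" "ball x r \<subseteq> U"
          using U open_contains_ball by blast
        moreover have "x \<in> ball x (min r (d/2)) \<inter> E"
          using r \<open>x \<in> E\<close> \<open>0 < d\<close> by simp
        ultimately have "(x, min r (d/2)) \<in> K"
          using \<open>0 < d\<close> unfolding K_def by fastforce
        then show "\<exists>i. i \<in> K \<and> x \<in> ball (fst i) (snd i) \<and> snd i < d"
          using r \<open>0 < d\<close> by (intro exI[of _ "(x, min r (d/2))"]) auto
      qed blast
      define W where "W = (\<Union>i\<in>C. ball (fst i) (snd i))"
      have W[measurable]: "W \<in> sets borel" unfolding W_def by (intro borel_open open_UN) auto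
      have disj: "disjoint_family_on (\<lambda>i. ball (fst i) (snd i)) C"
        using C(3) by (auto simp: disjoint_family_on_def pairwise_def disjnt_def)
      have "E - W \<in> null_sets lborel"
        using C(4) unfolding W_def[symmetric] negligible_iff_null_sets
        by (simp add: null_sets_completion_iff)
      then have AEW: "AE x in lborel. x \<in> E \<longrightarrow> x \<in> W"
        by (rule AE_not_in[THEN eventually_mono]) auto
      have inE: "ennreal b < h x" if "x \<in> E" for x using that by (simp add: E_def)
      from AEW have "ennreal b * emeasure lborel E \<le> (\<integral>\<^sup>+x\<in>W. h x \<partial>lborel)"
        by (subst nn_integral_cmult_indicator[symmetric])
           (auto intro!: nn_integral_mono_AE elim!: eventually_mono simp: indicator_def of_bool_def inE less_imp_le)
      also have "\<dots> = (\<integral>\<^sup>+i. (\<integral>\<^sup>+x\<in>ball (fst i) (snd i). h x \<partial>lborel) \<partial>count_space C)"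
        unfolding W_def using C disj by (intro nn_integral_UN_disjoint[symmetric]) auto
      also have "\<dots> \<le> (\<integral>\<^sup>+i. (\<integral>\<^sup>+x\<in>ball (fst i) (snd i). ennreal a \<partial>lborel) \<partial>count_space C)"
      proof (rule nn_integral_mono)
        fix i assume "i \<in> space (count_space C)"
        then have "i \<in> K" using C by auto
        then obtain y r x where i: "i = (y, r)" "0 < r" "x \<in> ball y r" "x \<in> E"
          unfolding K_def by (cases i) blast
        then have "(\<integral>\<^sup>+z\<in>ball y r. h z \<partial>lborel) \<le> ennreal (?o * r ^ DIM('a)) * hlmax h x"
          by (intro ball_integral_le_hlmax) auto
        also have "\<dots> \<le> ennreal (?o * r ^ DIM('a)) * ennreal a"
          using i by (intro mult_left_mono) (auto simp: E_def)
        finally show "(\<integral>\<^sup>+x\<in>ball (fst i) (snd i). h x \<partial>lborel) \<le> (\<integral>\<^sup>+x\<in>ball (fst i) (snd i). ennreal a \<partial>lborel)"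
          using i by (simp add: nn_integral_cmult_indicator emeasure_ball' mult.commute)
      qed
      also have "\<dots> = (\<integral>\<^sup>+x\<in>W. ennreal a \<partial>lborel)"
        unfolding W_def using C disj by (intro nn_integral_UN_disjoint) auto
      also have "\<dots> = ennreal a * emeasure lborel W"
        by (simp add: nn_integral_cmult_indicator)
      also have "\<dots> \<le> ennreal a * emeasure lborel U"
      proof (intro mult_left_mono emeasure_mono)
        have "ball (fst i) (snd i) \<subseteq> U" if "i \<in> C" for i
          using that C(2) unfolding K_def by (cases i) auto
        then show "W \<subseteq> U" unfolding W_def by blast
      qed (use U in auto)
      also have "emeasure lborel U = emeasure lborel (U - E) + emeasure lborel E"
        using U by (subst plus_emeasure) (auto simp: Un_absorb2)
      also have "ennreal a * (emeasure lborel (U - E) + emeasure lborel E) \<le> ennreal a * (ennreal e + ennreal m)"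
        using U m by (intro mult_left_mono add_right_mono) auto
      finally show ?thesis
        using m ab e by (simp add: ennreal_mult[symmetric] ennreal_plus[symmetric] add.commute del: ennreal_plus)
    qed
    have "m = 0"
    proof (rule ccontr)
      assume "m \<noteq> 0"
      \<comment> \<open>An \<open>e\<close> small enough that a e < (b - a) m, contradicting the
        bound.\<close>
      then have "0 < (b - a) * m / (a + 1)" using m ab by simp
      from bound[OF this] have "(b - a) * m \<le> a * ((b - a) * m / (a + 1))"
        by (simp add: algebra_simps)
      moreover have "a * ((b - a) * m / (a + 1)) < (b - a) * m"
        using m ab \<open>m \<noteq> 0\<close> by (simp add: field_simps)
      ultimately show False by simp
    qed
    then show ?thesis using m by (simp add: E_def)
  qed
  \<comment> \<open>Rational pairs keep the exceptional sets countable in number; the radius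
    \<open>N\<close> makes each of them a set of finite measure.\<close>
  have "AE x in lborel. \<forall>N::nat. \<forall>a b::rat. 0 \<le> a \<and> a < b \<longrightarrow>
      \<not> (x \<in> ball 0 (real N) \<and> hlmax h x \<le> ennreal (of_rat a) \<and> ennreal (of_rat b) < h x)"
    unfolding AE_all_countable
  proof (intro allI)
    fix N :: nat and a b :: rat
    show "AE x in lborel. 0 \<le> a \<and> a < b \<longrightarrow>
      \<not> (x \<in> ball 0 (real N) \<and> hlmax h x \<le> ennreal (of_rat a) \<and> ennreal (of_rat b) < h x)"
    proof (cases "0 \<le> a \<and> a < b")
      case True
      then have "{x \<in> ball 0 (real N). hlmax h x \<le> ennreal (of_rat a) \<and> ennreal (of_rat b) < h x} \<in> null_sets lborel"
        using null[of "of_rat a" "of_rat b" "real N"] by (intro null_setsI) (auto simp: of_rat_less)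
      then show ?thesis
        by (rule AE_not_in[THEN eventually_mono]) auto
    qed auto
  qed
  then show ?thesis
  proof eventually_elim
    case (elim x)
    show ?case
    proof (rule ccontr)
      assume "\<not> h x \<le> hlmax h x"
      then have "hlmax h x < h x" by simp
      then obtain a where a: "hlmax h x < ennreal (real_of_rat a)" "ennreal (real_of_rat a) < h x"
        using ennreal_rat_dense by blast
      obtain b where b: "ennreal (real_of_rat a) < ennreal (real_of_rat b)" "ennreal (real_of_rat b) < h x"
        using ennreal_rat_dense[OF a(2)] by blast
      have "0 < real_of_rat a"
      proof (rule ccontr)
        assume "\<not> 0 < real_of_rat a"
        then have "ennreal (real_of_rat a) = 0" by (intro ennreal_neg) auto
        then show False using a(1) by simp
      qed
      then have "0 \<le> a" "a < b"
        using b(1) by (auto simp: ennreal_less_iff of_rat_less)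
      moreover obtain N :: nat where "norm x < real N" using reals_Archimedean2 by blast
      ultimately show False using elim a b by (auto simp: less_imp_le)
    qed
  qed
qed

subsection \<open>Bump functions\<close>

text \<open>The functions \<open>z \<mapsto> \<phi>\<^sub>r(q - z)\<close> with \<open>\<phi> \<in> \<C>\<^sub>\<alpha>\<close>, described intrinsically.\<close>

definition bump :: "real \<Rightarrow> 'a::euclidean_space \<Rightarrow> real \<Rightarrow> ('a \<Rightarrow> complex) \<Rightarrow> bool" where
  "bump \<alpha> q r \<psi> \<longleftrightarrow> (\<forall>z. z \<notin> ball q r \<longrightarrow> \<psi> z = 0) \<and> (\<integral>z. \<psi> z \<partial>lborel) = 0 \<and>
     (\<forall>z z'. norm (\<psi> z - \<psi> z') \<le> norm (z - z') powr \<alpha> / r powr (real DIM('a) + \<alpha>))"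

definition bump_sup :: "real \<Rightarrow> ('a::euclidean_space \<Rightarrow> complex) \<Rightarrow> 'a \<Rightarrow> real \<Rightarrow> ennreal" where
  "bump_sup \<alpha> f q r = (SUP \<psi>\<in>Collect (bump \<alpha> q r). ennreal (norm (\<integral>z. \<psi> z * f z \<partial>lborel)))"

lemma hoelder_continuous:
  fixes \<psi> :: "'a::real_normed_vector \<Rightarrow> complex"
  assumes "0 < \<alpha>" and "\<And>z z'. norm (\<psi> z - \<psi> z') \<le> norm (z - z') powr \<alpha> / c"
  shows "continuous_on UNIV \<psi>"
proof -
  have "isCont \<psi> x" for x
  proof -
    have "((\<lambda>z. norm (z - x)) \<longlongrightarrow> 0) (at x)"
      by (intro tendsto_norm_zero LIM_zero tendsto_ident_at)
    then have "((\<lambda>z. norm (z - x) powr \<alpha>) \<longlongrightarrow> 0) (at x)"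
      using assms(1) by (intro tendsto_zero_powrI[where b=\<alpha>]) (auto intro: always_eventually)
    then have "((\<lambda>z. norm (z - x) powr \<alpha> / c) \<longlongrightarrow> 0) (at x)"
      by (rule tendsto_divide_zero)
    then have "((\<lambda>z. \<psi> z - \<psi> x) \<longlongrightarrow> 0) (at x)"
      by (rule Lim_null_comparison[rotated]) (use assms(2) in \<open>simp add: always_eventually\<close>)
    then show ?thesis unfolding isCont_def using LIM_zero_iff by blast
  qed
  then show ?thesis by (simp add: continuous_at_imp_continuous_on)
qed

lemma bump_continuous:
  assumes "0 < \<alpha>" "bump \<alpha> q r \<psi>"
  shows "continuous_on UNIV \<psi>"
  using assms hoelder_continuous[of \<alpha> \<psi>] unfolding bump_def by blast

lemma bump_measurable:
  assumes "0 < \<alpha>" "bump \<alpha> q r \<psi>"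
  shows "\<psi> \<in> borel_measurable borel"
  using bump_continuous[OF assms] by (rule borel_measurable_continuous_onI)

lemma bump_outside: "bump \<alpha> q r \<psi> \<Longrightarrow> z \<notin> ball q r \<Longrightarrow> \<psi> z = 0"
  unfolding bump_def by blast

lemma bump_integral: "bump \<alpha> q r \<psi> \<Longrightarrow> (\<integral>z. \<psi> z \<partial>lborel) = 0"
  unfolding bump_def by blast

lemma bump_hoelder:
  fixes q :: "'a::euclidean_space"
  shows "bump \<alpha> q r \<psi> \<Longrightarrow> norm (\<psi> z - \<psi> z') \<le> norm (z - z') powr \<alpha> / r powr (real DIM('a) + \<alpha>)"
  unfolding bump_def by blast

text \<open>Size follows from smoothness and support: the value at z is compared with the value 0 at
  a point at distance 2r from the centre, hence at distance at most 3r from z, and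
  \<open>3 powr \<alpha>\<close> is at most 3.\<close>

lemma bump_bound:
  fixes q :: "'a::euclidean_space"
  assumes "0 < \<alpha>" "\<alpha> \<le> 1" "0 < r" "bump \<alpha> q r \<psi>"
  shows "norm (\<psi> z) \<le> 3 / r ^ DIM('a)"
proof (cases "z \<in> ball q r")
  case True
  obtain b :: 'a where b: "b \<in> Basis" using nonempty_Basis by blast
  define x where "x = q + (2 * r) *\<^sub>R b"
  have nx: "norm (x - q) = 2 * r" using b assms by (simp add: x_def)
  then have "x \<notin> ball q r" using assms by (simp add: dist_norm norm_minus_commute)
  then have "norm (\<psi> z) = norm (\<psi> z - \<psi> x)" using assms bump_outside by fastforce
  also have "\<dots> \<le> norm (z - x) powr \<alpha> / r powr (real DIM('a) + \<alpha>)"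
    using assms by (intro bump_hoelder) auto
  also have "\<dots> \<le> (3 * r) powr \<alpha> / r powr (real DIM('a) + \<alpha>)"
  proof (intro divide_right_mono powr_mono2)
    have "norm (z - x) \<le> norm (z - q) + norm (x - q)"
      using norm_triangle_ineq4[of "z - q" "x - q"] by simp
    then show "norm (z - x) \<le> 3 * r"
      using True nx by (simp add: dist_norm norm_minus_commute)
  qed (use assms in auto)
  also have "\<dots> = 3 powr \<alpha> / r ^ DIM('a)"
    using assms by (simp add: powr_mult powr_add powr_realpow)
  also have "\<dots> \<le> 3 / r ^ DIM('a)"
    using assms powr_mono[of \<alpha> 1 3] by (intro divide_right_mono) auto
  finally show ?thesis .
next
  case False
  then show ?thesis using assms bump_outside by fastforce
qed

lemma integrable_bounded_ball:
  fixes \<psi> :: "'a::euclidean_space \<Rightarrow> complex"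
  assumes "\<psi> \<in> borel_measurable borel" "\<And>z. z \<notin> ball q r \<Longrightarrow> \<psi> z = 0" "\<And>z. norm (\<psi> z) \<le> B"
  shows "integrable lborel \<psi>"
proof (rule Bochner_Integration.integrable_bound)
  show "integrable lborel (\<lambda>z. B * indicator (ball q r) z :: real)"
    using emeasure_lborel_ball_finite[of q r] by (intro integrable_mult_right integrable_real_indicator) auto
  show "AE z in lborel. norm (\<psi> z) \<le> norm (B * indicator (ball q r) z :: real)"
    using assms(2,3) by (auto intro!: always_eventually simp: indicator_def intro: order_trans[OF _ abs_ge_self])
qed (use assms in simp)

lemma bump_integrable:
  assumes "0 < \<alpha>" "\<alpha> \<le> 1" "0 < r" "bump \<alpha> q r \<psi>"
  shows "integrable lborel \<psi>"
  using assms bump_measurable bump_outside bump_bound by (intro integrable_bounded_ball) blast+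

text \<open>The support condition and the mean value pass to a larger ball unchanged; only the
  normalisation of the Hoelder seminorm changes, and the factor compensates exactly for it.\<close>

lemma bump_enlarge:
  fixes q :: "'a::euclidean_space"
  assumes "0 < t" "0 < r" "ball y t \<subseteq> ball q r" "bump \<alpha> y t \<psi>"
  shows "bump \<alpha> q r (\<lambda>z. ((t / r) powr (real DIM('a) + \<alpha>)) *\<^sub>R \<psi> z)"
proof -
  have "norm ((t / r) powr (real DIM('a) + \<alpha>) *\<^sub>R \<psi> z - (t / r) powr (real DIM('a) + \<alpha>) *\<^sub>R \<psi> z')
      \<le> norm (z - z') powr \<alpha> / r powr (real DIM('a) + \<alpha>)" for z z'
  proof -
    have "norm ((t / r) powr (real DIM('a) + \<alpha>) *\<^sub>R \<psi> z - (t / r) powr (real DIM('a) + \<alpha>) *\<^sub>R \<psi> z')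
       = (t / r) powr (real DIM('a) + \<alpha>) * norm (\<psi> z - \<psi> z')"
      by (simp add: scaleR_diff_right[symmetric])
    also have "\<dots> \<le> (t / r) powr (real DIM('a) + \<alpha>) * (norm (z - z') powr \<alpha> / t powr (real DIM('a) + \<alpha>))"
      using assms by (intro mult_left_mono bump_hoelder) auto
    also have "\<dots> = norm (z - z') powr \<alpha> / r powr (real DIM('a) + \<alpha>)"
      using assms by (simp add: powr_divide)
    finally show ?thesis .
  qed
  moreover have "\<psi> z = 0" if "z \<notin> ball q r" for z
    using that assms bump_outside by blast
  ultimately show ?thesis
    unfolding bump_def using bump_integral[OF assms(4)] by auto
qed

text \<open>Test functions are required to vanish only outside the closed unit ball. Continuity
  gives the sphere as well, which is why bumps can be defined by open balls.\<close>

lemma test_function_sphere: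
  fixes x :: "'a::euclidean_space"
  assumes "0 < \<alpha>" "\<phi> \<in> test_functions \<alpha>" "1 \<le> norm x"
  shows "\<phi> x = 0"
proof (cases "norm x = 1")
  case True
  have cont: "continuous_on UNIV \<phi>"
    using assms hoelder_continuous[of \<alpha> \<phi> 1] by (auto simp: test_functions_def)
  have "(\<lambda>k. \<phi> ((1 + 1 / real (Suc k)) *\<^sub>R x)) \<longlonglongrightarrow> \<phi> ((1 + 0) *\<^sub>R x)"
    using cont by (intro isCont_tendsto_compose[of _ \<phi>] tendsto_intros LIMSEQ_Suc[OF lim_1_over_n])
       (simp add: continuous_on_eq_continuous_at)
  moreover have "\<phi> ((1 + 1 / real (Suc k)) *\<^sub>R x) = 0" for k
    using assms True by (auto simp: test_functions_def)
  ultimately have "(\<lambda>_. 0) \<longlonglongrightarrow> \<phi> x" by simp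
  then show ?thesis using LIMSEQ_unique tendsto_const by blast
qed (use assms in \<open>auto simp: test_functions_def\<close>)

lemma bump_dilate:
  fixes q :: "'a::euclidean_space"
  assumes "0 < \<alpha>" "0 < r" "\<phi> \<in> test_functions \<alpha>"
  shows "bump \<alpha> q r (\<lambda>z. dilate r \<phi> (q - z))"
  unfolding bump_def
proof (intro conjI allI impI)
  have cont: "continuous_on UNIV \<phi>"
    using assms hoelder_continuous[of \<alpha> \<phi> 1] by (auto simp: test_functions_def)
  then have [measurable]: "\<phi> \<in> borel_measurable borel" by (rule borel_measurable_continuous_onI)
  fix z z' :: 'a
  show "dilate r \<phi> (q - z) = 0" if "z \<notin> ball q r"
  proof -
    have "norm ((q - z) /\<^sub>R r) = norm (q - z) / r"
      using assms by (simp add: divide_inverse mult.commute)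
    then have "1 \<le> norm ((q - z) /\<^sub>R r)"
      using that assms by (simp add: dist_norm)
    then have "\<phi> ((q - z) /\<^sub>R r) = 0"
      by (rule test_function_sphere[OF assms(1,3)])
    then show ?thesis by (simp add: dilate_def)
  qed
  \<comment> \<open>Substitution z = q - r x: the Jacobian r^n cancels the normalising factor of
    \<open>dilate\<close>.\<close>
  have "(\<integral>z. dilate r \<phi> (q - z) \<partial>lborel) =
     (\<integral>z. dilate r \<phi> (q - z) \<partial>density (distr lborel borel (\<lambda>x. q + (- r) *\<^sub>R x)) (\<lambda>_. ennreal (\<bar>- r\<bar> ^ DIM('a))))"
    using assms lborel_affine[of "- r" q] by simp
  also have "\<dots> = (\<integral>x. \<bar>- r\<bar> ^ DIM('a) *\<^sub>R dilate r \<phi> (q - (q + (- r) *\<^sub>R x)) \<partial>lborel)"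
    unfolding dilate_def by (subst integral_density) (auto simp: integral_distr)
  also have "\<dots> = (\<integral>x. \<phi> x \<partial>lborel)"
    using assms by (simp add: dilate_def)
  also have "\<dots> = (\<integral>x. \<phi> x \<partial>lebesgue)"
    by (rule integral_completion[symmetric]) simp
  also have "\<dots> = 0" using assms by (simp add: test_functions_def)
  finally show "(\<integral>z. dilate r \<phi> (q - z) \<partial>lborel) = 0" .
  have "norm (dilate r \<phi> (q - z) - dilate r \<phi> (q - z'))
      = (1 / r ^ DIM('a)) * norm (\<phi> ((q - z) /\<^sub>R r) - \<phi> ((q - z') /\<^sub>R r))"
    using assms by (simp add: dilate_def scaleR_diff_right[symmetric] divide_inverse)
  also have "\<dots> \<le> (1 / r ^ DIM('a)) * norm ((q - z) /\<^sub>R r - (q - z') /\<^sub>R r) powr \<alpha>"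
    using assms by (intro mult_left_mono) (auto simp: test_functions_def)
  also have "norm ((q - z) /\<^sub>R r - (q - z') /\<^sub>R r) = norm (z - z') / r"
    using assms by (simp add: scaleR_diff_right[symmetric] norm_minus_commute divide_inverse_commute)
  also have "(1 / r ^ DIM('a)) * (norm (z - z') / r) powr \<alpha> = norm (z - z') powr \<alpha> / r powr (real DIM('a) + \<alpha>)"
    using assms by (simp add: powr_divide powr_add powr_realpow)
  finally show "norm (dilate r \<phi> (q - z) - dilate r \<phi> (q - z')) \<le> norm (z - z') powr \<alpha> / r powr (real DIM('a) + \<alpha>)" .
qed

lemma intrinsic_sup_lborel:
  assumes "0 < \<alpha>" "0 < r" and [measurable]: "f \<in> borel_measurable borel"
  shows "intrinsic_sup \<alpha> f q r = (SUP \<phi>\<in>test_functions \<alpha>. ennreal (norm (\<integral>z. dilate r \<phi> (q - z) * f z \<partial>lborel)))"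
  unfolding intrinsic_sup_def
proof (intro SUP_cong refl)
  fix \<phi> :: "'a \<Rightarrow> complex" assume "\<phi> \<in> test_functions \<alpha>"
  then have [measurable]: "(\<lambda>z. dilate r \<phi> (q - z)) \<in> borel_measurable borel"
    by (rule bump_measurable[OF assms(1) bump_dilate[OF assms(1,2)]])
  show "ennreal (norm (\<integral>z. dilate r \<phi> (q - z) * f z \<partial>lebesgue)) = ennreal (norm (\<integral>z. dilate r \<phi> (q - z) * f z \<partial>lborel))"
    by (subst integral_completion) auto
qed

text \<open>Each dilate at scale t is, after multiplication by the factor of
  \<open>bump_enlarge\<close>, a competitor for the larger ball. The cost is bounded as long as r
  and t are comparable; this is what makes a lattice of balls sufficient.\<close>

lemma intrinsic_sup_le_bump_sup:
  fixes q :: "'a::euclidean_space"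
  assumes "0 < \<alpha>" "0 < t" "0 < r" "ball y t \<subseteq> ball q r" "f \<in> borel_measurable borel"
  shows "intrinsic_sup \<alpha> f y t \<le> ennreal ((r / t) powr (real DIM('a) + \<alpha>)) * bump_sup \<alpha> f q r"
  unfolding intrinsic_sup_lborel[OF assms(1,2,5)]
proof (rule SUP_least)
  fix \<phi> :: "'a \<Rightarrow> complex" assume \<phi>: "\<phi> \<in> test_functions \<alpha>"
  let ?c = "(t / r) powr (real DIM('a) + \<alpha>)" and ?\<psi> = "\<lambda>z. dilate t \<phi> (y - z)"
  have "bump \<alpha> q r (\<lambda>z. ?c *\<^sub>R ?\<psi> z)"
    by (rule bump_enlarge[OF assms(2,3,4) bump_dilate[OF assms(1,2) \<phi>]])
  then have "ennreal (norm (\<integral>z. (?c *\<^sub>R ?\<psi> z) * f z \<partial>lborel)) \<le> bump_sup \<alpha> f q r"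
    unfolding bump_sup_def by (intro SUP_upper) auto
  then have "ennreal (?c * norm (\<integral>z. ?\<psi> z * f z \<partial>lborel)) \<le> bump_sup \<alpha> f q r"
    by simp
  then have "ennreal ((r / t) powr (real DIM('a) + \<alpha>)) * ennreal (?c * norm (\<integral>z. ?\<psi> z * f z \<partial>lborel))
     \<le> ennreal ((r / t) powr (real DIM('a) + \<alpha>)) * bump_sup \<alpha> f q r"
    by (rule mult_left_mono) simp
  moreover have "(r / t) powr (real DIM('a) + \<alpha>) * ?c = 1"
    using assms by (simp add: powr_mult[symmetric])
  ultimately show "ennreal (norm (\<integral>z. ?\<psi> z * f z \<partial>lborel)) \<le> ennreal ((r / t) powr (real DIM('a) + \<alpha>)) * bump_sup \<alpha> f q r"
    by (simp add: ennreal_mult[symmetric] mult.assoc[symmetric])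
qed

text \<open>Locality: the source of every later replacement of f by its restriction to a
  set.\<close>

lemma bump_sup_cong:
  assumes "\<And>z. z \<in> ball q r \<Longrightarrow> f z = g z"
  shows "bump_sup \<alpha> f q r = bump_sup \<alpha> g q r"
  unfolding bump_sup_def
proof (intro SUP_cong refl)
  fix \<psi> assume "\<psi> \<in> Collect (bump \<alpha> q r)"
  then have eq: "\<psi> z * f z = \<psi> z * g z" for z
    using assms bump_outside[of \<alpha> q r \<psi> z] by (cases "z \<in> ball q r") auto
  then show "ennreal (norm (\<integral>z. \<psi> z * f z \<partial>lborel)) = ennreal (norm (\<integral>z. \<psi> z * g z \<partial>lborel))"
    by (simp only: eq)
qed

lemma norm_integral_le_nn_integral:
  fixes g :: "'a \<Rightarrow> complex"
  shows "ennreal (norm (\<integral>z. g z \<partial>M)) \<le> (\<integral>\<^sup>+z. ennreal (norm (g z)) \<partial>M)"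
proof (cases "integrable M g")
  case True
  then have "ennreal (norm (\<integral>z. g z \<partial>M)) \<le> ennreal (\<integral>z. norm (g z) \<partial>M)"
    by (intro ennreal_leI integral_norm_bound)
  also have "\<dots> = (\<integral>\<^sup>+z. ennreal (norm (g z)) \<partial>M)"
    using True by (intro nn_integral_eq_integral[symmetric]) auto
  finally show ?thesis .
qed (simp add: not_integrable_integral_eq)

text \<open>The pure size estimate, which ignores cancellation. The kernel is written as a separate
  factor to match the shape of \<open>minkowski_l2\<close>.\<close>

lemma bump_sup_le_integral:
  fixes q :: "'a::euclidean_space"
  assumes "0 < \<alpha>" "\<alpha> \<le> 1" "0 < r" and [measurable]: "f \<in> borel_measurable borel"
  shows "bump_sup \<alpha> f q r \<le> (\<integral>\<^sup>+z. ennreal (norm (f z)) * (ennreal (3 / r ^ DIM('a)) * indicator (ball q r) z) \<partial>lborel)"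
  unfolding bump_sup_def
proof (rule SUP_least)
  fix \<psi> assume "\<psi> \<in> Collect (bump \<alpha> q r)"
  then have \<psi>: "bump \<alpha> q r \<psi>" by simp
  have "ennreal (norm (\<integral>z. \<psi> z * f z \<partial>lborel)) \<le> (\<integral>\<^sup>+z. ennreal (norm (\<psi> z * f z)) \<partial>lborel)"
    by (rule norm_integral_le_nn_integral)
  also have "\<dots> \<le> (\<integral>\<^sup>+z. ennreal (norm (f z)) * (ennreal (3 / r ^ DIM('a)) * indicator (ball q r) z) \<partial>lborel)"
  proof (intro nn_integral_mono)
    fix z
    show "ennreal (norm (\<psi> z * f z)) \<le> ennreal (norm (f z)) * (ennreal (3 / r ^ DIM('a)) * indicator (ball q r) z)"
      using mult_right_mono[OF bump_bound[OF assms(1-3) \<psi>, of z], of "norm (f z)"] bump_outside[OF \<psi>, of z] assms(3)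
      by (cases "z \<in> ball q r")
        (auto simp: norm_mult ennreal_mult[symmetric] mult.commute intro!: ennreal_leI)
  qed
  finally show "ennreal (norm (\<integral>z. \<psi> z * f z \<partial>lborel))
    \<le> (\<integral>\<^sup>+z. ennreal (norm (f z)) * (ennreal (3 / r ^ DIM('a)) * indicator (ball q r) z) \<partial>lborel)" .
qed

subsection \<open>Almost orthogonality\<close>

lemma cnj_borel_measurable [measurable]: "cnj \<in> borel_measurable borel"
  by (intro borel_measurable_continuous_onI continuous_intros)

text \<open>As \<psi> has mean zero, the value of \<psi>' at the centre q may be subtracted. On
  \<open>ball q r\<close> the difference is controlled by the Hoelder bound of \<psi>', and \<psi>
  contributes its sup bound 3 / r^n times the volume of its ball. The estimate is a gain when r is
  the smaller radius.\<close>

lemma bump_inner: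
  fixes q q' :: "'a::euclidean_space"
  assumes \<alpha>: "0 < \<alpha>" "\<alpha> \<le> 1" and r: "0 < r" "0 < r'" and \<psi>: "bump \<alpha> q r \<psi>" and \<psi>': "bump \<alpha> q' r' \<psi>'"
  shows "norm (\<integral>z. \<psi> z * cnj (\<psi>' z) \<partial>lborel) \<le> 3 * ball_vol TYPE('a) * r powr \<alpha> / r' powr (real DIM('a) + \<alpha>)"
proof -
  note [measurable] = bump_measurable[OF \<alpha>(1) \<psi>] bump_measurable[OF \<alpha>(1) \<psi>']
  have i1: "integrable lborel \<psi>" by (rule bump_integrable[OF \<alpha> r(1) \<psi>])
  have i2: "integrable lborel (\<lambda>z. \<psi> z * cnj (\<psi>' z))"
  proof (rule integrable_bounded_ball[where q=q and r=r and B="3 / r ^ DIM('a) * (3 / r' ^ DIM('a))"])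
    show "norm (\<psi> z * cnj (\<psi>' z)) \<le> 3 / r ^ DIM('a) * (3 / r' ^ DIM('a))" for z
      unfolding norm_mult complex_mod_cnj
      using r by (intro mult_mono bump_bound[OF \<alpha> r(1) \<psi>] bump_bound[OF \<alpha> r(2) \<psi>']) auto
    show "\<psi> z * cnj (\<psi>' z) = 0" if "z \<notin> ball q r" for z
      using bump_outside[OF \<psi> that] by simp
  qed measurable
  have "(\<integral>z. \<psi> z * cnj (\<psi>' z) \<partial>lborel) = (\<integral>z. \<psi> z * cnj (\<psi>' z) - \<psi> z * cnj (\<psi>' q) \<partial>lborel)"
    using i1 i2 bump_integral[OF \<psi>] by simp
  then have "ennreal (norm (\<integral>z. \<psi> z * cnj (\<psi>' z) \<partial>lborel)) \<le>
     (\<integral>\<^sup>+z. ennreal (norm (\<psi> z * cnj (\<psi>' z) - \<psi> z * cnj (\<psi>' q))) \<partial>lborel)"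
    using norm_integral_le_nn_integral by metis
  also have "\<dots> \<le> (\<integral>\<^sup>+z. ennreal (3 / r ^ DIM('a) * (r powr \<alpha> / r' powr (real DIM('a) + \<alpha>))) * indicator (ball q r) z \<partial>lborel)"
  proof (intro nn_integral_mono)
    fix z
    show "ennreal (norm (\<psi> z * cnj (\<psi>' z) - \<psi> z * cnj (\<psi>' q)))
        \<le> ennreal (3 / r ^ DIM('a) * (r powr \<alpha> / r' powr (real DIM('a) + \<alpha>))) * indicator (ball q r) z"
    proof (cases "z \<in> ball q r")
      case True
      have "norm (\<psi> z * cnj (\<psi>' z) - \<psi> z * cnj (\<psi>' q)) = norm (\<psi> z) * norm (\<psi>' z - \<psi>' q)"
        by (metis complex_cnj_diff complex_mod_cnj norm_mult right_diff_distrib)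
      also have "\<dots> \<le> 3 / r ^ DIM('a) * (norm (z - q) powr \<alpha> / r' powr (real DIM('a) + \<alpha>))"
        using r by (intro mult_mono bump_bound[OF \<alpha> r(1) \<psi>] bump_hoelder[OF \<psi>']) auto
      also have "\<dots> \<le> 3 / r ^ DIM('a) * (r powr \<alpha> / r' powr (real DIM('a) + \<alpha>))"
        using True r \<alpha> by (intro mult_left_mono divide_right_mono powr_mono2)
          (auto simp: dist_norm norm_minus_commute)
      finally show ?thesis using True by (simp add: ennreal_leI)
    qed (use bump_outside[OF \<psi>] in simp)
  qed
  also have "\<dots> = ennreal (3 / r ^ DIM('a) * (r powr \<alpha> / r' powr (real DIM('a) + \<alpha>)) * (ball_vol TYPE('a) * r ^ DIM('a)))"
    using r ball_vol_pos[where 'a='a]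
    by (subst nn_integral_cmult_indicator) (simp, simp only: emeasure_ball' less_imp_le, subst ennreal_mult, auto)
  also have "3 / r ^ DIM('a) * (r powr \<alpha> / r' powr (real DIM('a) + \<alpha>)) * (ball_vol TYPE('a) * r ^ DIM('a))
     = 3 * ball_vol TYPE('a) * r powr \<alpha> / r' powr (real DIM('a) + \<alpha>)"
    using r by simp
  finally show ?thesis
    using ball_vol_pos[where 'a='a] by (subst (asm) ennreal_le_iff) auto
qed

lemma bump_inner_far:
  assumes "bump \<alpha> q r \<psi>" "bump \<alpha> q' r' \<psi>'" "r + r' \<le> dist q q'"
  shows "(\<integral>z. \<psi> z * cnj (\<psi>' z) \<partial>lborel) = 0"
proof -
  have eq: "\<psi> z * cnj (\<psi>' z) = 0" for z
  proof -
    have "z \<notin> ball q r \<or> z \<notin> ball q' r'"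
      using assms(3) dist_triangle[of q q' z] by (auto simp: dist_commute)
    then show ?thesis using bump_outside[OF assms(1), of z] bump_outside[OF assms(2), of z] by auto
  qed
  show ?thesis by (simp only: eq) simp
qed

text \<open>Expand \<open>0 \<le> \<integral>|f - h/K|\<^sup>2\<close> for \<open>h = \<Sum> w\<^sub>i a\<^sub>i \<psi>\<^sub>i\<close>, where \<open>\<integral>|h|\<^sup>2 \<le> K \<Sum> w\<^sub>i|a\<^sub>i|\<^sup>2\<close> by Schur's test.\<close>

lemma bessel_schur:
  fixes \<psi> :: "'i \<Rightarrow> 'a \<Rightarrow> complex" and w :: "'i \<Rightarrow> real"
  assumes J: "finite J" and w: "\<And>i. i \<in> J \<Longrightarrow> 0 \<le> w i" and K: "0 < K"
    and f2: "integrable M (\<lambda>z. (norm (f z))\<^sup>2)"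
    and fi: "\<And>i. i \<in> J \<Longrightarrow> integrable M (\<lambda>z. \<psi> i z * f z)"
    and ij: "\<And>i j. i \<in> J \<Longrightarrow> j \<in> J \<Longrightarrow> integrable M (\<lambda>z. \<psi> i z * cnj (\<psi> j z))"
    and schur: "\<And>i. i \<in> J \<Longrightarrow> (\<Sum>j\<in>J. w j * norm (\<integral>z. \<psi> i z * cnj (\<psi> j z) \<partial>M)) \<le> K"
  shows "(\<Sum>i\<in>J. w i * (norm (\<integral>z. \<psi> i z * f z \<partial>M))\<^sup>2) \<le> K * (\<integral>z. (norm (f z))\<^sup>2 \<partial>M)"
proof -
  define a where "a i = (\<integral>z. \<psi> i z * f z \<partial>M)" for i
  define G where "G i j = (\<integral>z. \<psi> i z * cnj (\<psi> j z) \<partial>M)" for i j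
  define X where "X = (\<Sum>i\<in>J. w i * (norm (a i))\<^sup>2)"
  \<comment> \<open>The pairing of \<psi> with f carries no conjugate, so the coefficients are
    conjugated here; then h f integrates to the nonnegative number \<open>X\<close>, and the vector
    to subtract from f is the conjugate of h / K.\<close>
  define h where "h z = (\<Sum>i\<in>J. (w i * cnj (a i)) * \<psi> i z)" for z
  have fh: "integrable M (\<lambda>z. h z * f z)" and fh': "(\<integral>z. h z * f z \<partial>M) = of_real X"
  proof -
    have eq: "h z * f z = (\<Sum>i\<in>J. (w i * cnj (a i)) * (\<psi> i z * f z))" for z
      by (simp add: h_def sum_distrib_right mult.assoc)
    show "integrable M (\<lambda>z. h z * f z)"
      unfolding eq using fi by (intro Bochner_Integration.integrable_sum integrable_mult_right) auto
    have "(\<integral>z. h z * f z \<partial>M) = (\<Sum>i\<in>J. (w i * cnj (a i)) * a i)"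
      unfolding eq using fi by (subst Bochner_Integration.integral_sum) (auto simp: a_def)
    also have "\<dots> = of_real X"
      unfolding X_def of_real_sum
    proof (intro sum.cong refl)
      fix i
      show "(w i * cnj (a i)) * a i = of_real (w i * (norm (a i))\<^sup>2)"
        using complex_norm_square[of "a i"] by (simp add: mult.commute mult.left_commute)
    qed
    finally show "(\<integral>z. h z * f z \<partial>M) = of_real X" .
  qed
  have hh: "integrable M (\<lambda>z. h z * cnj (h z))" and hh': "Re (\<integral>z. h z * cnj (h z) \<partial>M) \<le> K * X"
  proof -
    have eq: "h z * cnj (h z) = (\<Sum>i\<in>J. \<Sum>j\<in>J. (w i * cnj (a i) * (w j * a j)) * (\<psi> i z * cnj (\<psi> j z)))" for z
      unfolding h_def by (simp add: sum_distrib_left sum_distrib_right mult_ac)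
    show "integrable M (\<lambda>z. h z * cnj (h z))"
      unfolding eq using ij by (intro Bochner_Integration.integrable_sum integrable_mult_right) auto
    have "(\<integral>z. h z * cnj (h z) \<partial>M) = (\<Sum>i\<in>J. \<Sum>j\<in>J. (w i * cnj (a i) * (w j * a j)) * G i j)"
      unfolding eq using ij
      by (subst Bochner_Integration.integral_sum) (auto simp: Bochner_Integration.integral_sum G_def intro!: sum.cong)
    then have "Re (\<integral>z. h z * cnj (h z) \<partial>M) \<le> norm (\<Sum>i\<in>J. \<Sum>j\<in>J. (w i * cnj (a i) * (w j * a j)) * G i j)"
      by (simp only: complex_Re_le_cmod)
    also have "\<dots> \<le> (\<Sum>i\<in>J. \<Sum>j\<in>J. w i * w j * norm (G i j) * (norm (a i) * norm (a j)))"
      using w by (intro sum_norm_le) (auto simp: norm_mult mult_ac intro!: sum_norm_le)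
    \<comment> \<open>The weighted Gram matrix is symmetric in absolute value, so after the
      arithmetic-geometric mean inequality both halves give the same sum, and one row sum bound
      suffices.\<close>
    also have "\<dots> \<le> (\<Sum>i\<in>J. \<Sum>j\<in>J. w i * w j * norm (G i j) * (((norm (a i))\<^sup>2 + (norm (a j))\<^sup>2) / 2))"
    proof (intro sum_mono mult_left_mono)
      fix i j
      show "norm (a i) * norm (a j) \<le> ((norm (a i))\<^sup>2 + (norm (a j))\<^sup>2) / 2"
        using sum_squares_bound[of "norm (a i)" "norm (a j)"] by simp
    qed (use w in auto)
    also have "\<dots> = (\<Sum>i\<in>J. \<Sum>j\<in>J. w i * w j * norm (G i j) * (norm (a i))\<^sup>2)"
    proof -
      have Gsym: "norm (G i j) = norm (G j i)" for i j
      proof -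
        have "cnj (G i j) = (\<integral>z. cnj (\<psi> i z * cnj (\<psi> j z)) \<partial>M)"
          unfolding G_def by (rule Bochner_Integration.integral_cnj[symmetric])
        also have "\<dots> = G j i" by (simp add: G_def mult.commute)
        finally show ?thesis by (metis complex_mod_cnj)
      qed
      let ?S = "\<Sum>i\<in>J. \<Sum>j\<in>J. w i * w j * norm (G i j) * (norm (a i))\<^sup>2"
      have "(\<Sum>i\<in>J. \<Sum>j\<in>J. w i * w j * norm (G i j) * (norm (a j))\<^sup>2) = ?S"
        by (subst sum.swap) (intro sum.cong refl, simp add: Gsym mult_ac)
      moreover have "(\<Sum>i\<in>J. \<Sum>j\<in>J. w i * w j * norm (G i j) * (((norm (a i))\<^sup>2 + (norm (a j))\<^sup>2) / 2))
         = (?S + (\<Sum>i\<in>J. \<Sum>j\<in>J. w i * w j * norm (G i j) * (norm (a j))\<^sup>2)) / 2"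
        by (simp add: sum.distrib[symmetric] sum_divide_distrib algebra_simps add_divide_distrib)
      ultimately show ?thesis by simp
    qed
    also have "\<dots> = (\<Sum>i\<in>J. w i * (norm (a i))\<^sup>2 * (\<Sum>j\<in>J. w j * norm (G i j)))"
      by (simp add: sum_distrib_left mult_ac)
    also have "\<dots> \<le> (\<Sum>i\<in>J. w i * (norm (a i))\<^sup>2 * K)"
      using w schur by (intro sum_mono mult_left_mono) (auto simp: G_def)
    also have "\<dots> = K * X" by (simp add: X_def sum_distrib_left mult_ac)
    finally show "Re (\<integral>z. h z * cnj (h z) \<partial>M) \<le> K * X" .
  qed
  have "0 \<le> (\<integral>z. (norm (f z - cnj (h z) / of_real K))\<^sup>2 \<partial>M)"
    by (intro Bochner_Integration.integral_nonneg) simp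
  also have "\<dots> = (\<integral>z. (norm (f z))\<^sup>2 - (2 / K) * Re (h z * f z) + (1 / K\<^sup>2) * Re (h z * cnj (h z)) \<partial>M)"
  proof (intro Bochner_Integration.integral_cong refl)
    fix z
    show "(norm (f z - cnj (h z) / of_real K))\<^sup>2 = (norm (f z))\<^sup>2 - (2 / K) * Re (h z * f z) + (1 / K\<^sup>2) * Re (h z * cnj (h z))"
    proof -
      have "Re (f z - cnj (h z) / of_real K) = Re (f z) - Re (h z) / K"
        "Im (f z - cnj (h z) / of_real K) = Im (f z) + Im (h z) / K" by simp_all
      then show ?thesis
        unfolding cmod_power2 by (simp add: power2_eq_square field_simps) (use K in \<open>simp add: divide_simps algebra_simps\<close>)
    qed
  qed
  also have "\<dots> = (\<integral>z. (norm (f z))\<^sup>2 \<partial>M) - (2 / K) * X + (1 / K\<^sup>2) * Re (\<integral>z. h z * cnj (h z) \<partial>M)"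
  proof -
    have lin: "(\<integral>z. A z - c * B z + d * E z \<partial>M) = (\<integral>z. A z \<partial>M) - c * (\<integral>z. B z \<partial>M) + d * (\<integral>z. E z \<partial>M)"
      if "integrable M A" "integrable M B" "integrable M E" for A B E :: "'a \<Rightarrow> real" and c d
      using that by simp
    have "(\<integral>z. Re (h z * f z) \<partial>M) = X"
      using integral_Re[OF fh] unfolding fh' by simp
    then show ?thesis
      using lin[OF f2 integrable_Re[OF fh] integrable_Re[OF hh]] integral_Re[OF hh] by (simp only:)
  qed
  also have "\<dots> \<le> (\<integral>z. (norm (f z))\<^sup>2 \<partial>M) - (2 / K) * X + (1 / K\<^sup>2) * (K * X)"
    using hh' K by (intro add_left_mono mult_left_mono) auto
  also have "\<dots> = (\<integral>z. (norm (f z))\<^sup>2 \<partial>M) - X / K"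
    using K by (simp add: power2_eq_square field_simps)
  finally show ?thesis using K by (simp add: X_def a_def field_simps)
qed

subsection \<open>Lattices of dyadic spacing\<close>

definition grid_round :: "real \<Rightarrow> 'a::euclidean_space \<Rightarrow> 'a" where
  "grid_round s y = (\<Sum>b\<in>Basis. (s * of_int \<lfloor>(y \<bullet> b) / s\<rfloor>) *\<^sub>R b)"

definition mesh :: "int \<Rightarrow> real" where "mesh k = 2 powr (of_int k)"

definition grid :: "(int \<times> 'a::euclidean_space) set" where
  "grid = {(k, q). q \<in> range (grid_round (mesh k))}"

text \<open>The radius is large enough for \<open>ball (grid_round (mesh k) y) (rad k)\<close> to contain \<open>ball y (mesh k)\<close>.\<close>

definition rad :: "'a::euclidean_space itself \<Rightarrow> int \<Rightarrow> real" where
  "rad _ k = (real DIM('a) + 1) * mesh k"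

abbreviation gball :: "int \<times> 'a::euclidean_space \<Rightarrow> 'a set" where
  "gball i \<equiv> ball (snd i) (rad TYPE('a) (fst i))"

lemma mesh_pos [simp]: "0 < mesh k"
  by (simp add: mesh_def)

lemma rad_pos [simp]: "0 < rad TYPE('a::euclidean_space) k"
  by (simp add: rad_def add_pos_pos)

lemma grid_round_inner:
  "b \<in> Basis \<Longrightarrow> grid_round s y \<bullet> b = s * of_int \<lfloor>(y \<bullet> b) / s\<rfloor>"
  unfolding grid_round_def by (simp add: inner_sum_left_Basis)

lemma dist_grid_round:
  fixes y :: "'a::euclidean_space"
  assumes "0 < s"
  shows "dist y (grid_round s y) \<le> real DIM('a) * s"
proof -
  have "norm (y - grid_round s y) \<le> (\<Sum>b\<in>Basis. \<bar>(y - grid_round s y) \<bullet> b\<bar>)"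
    by (rule norm_le_l1)
  also have "\<dots> \<le> (\<Sum>b\<in>(Basis :: 'a set). s)"
  proof (rule sum_mono)
    fix b :: 'a assume "b \<in> Basis"
    then have eq: "(y - grid_round s y) \<bullet> b = s * ((y \<bullet> b) / s - of_int \<lfloor>(y \<bullet> b) / s\<rfloor>)"
      using assms by (simp add: inner_diff_left grid_round_inner right_diff_distrib)
    have "0 \<le> (y \<bullet> b) / s - of_int \<lfloor>(y \<bullet> b) / s\<rfloor>" "(y \<bullet> b) / s - of_int \<lfloor>(y \<bullet> b) / s\<rfloor> \<le> 1"
      by linarith+
    then have "\<bar>s * ((y \<bullet> b) / s - of_int \<lfloor>(y \<bullet> b) / s\<rfloor>)\<bar> \<le> s * 1"
      using assms by (simp only: abs_mult abs_of_pos abs_of_nonneg mult_le_cancel_left_pos)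
    then show "\<bar>(y - grid_round s y) \<bullet> b\<bar> \<le> s" by (simp add: eq)
  qed
  finally show ?thesis by (simp add: dist_norm)
qed

lemma grid_separated:
  assumes "p \<in> range (grid_round s)" "q \<in> range (grid_round s)" "p \<noteq> (q :: 'a::euclidean_space)" "0 < s"
  shows "s \<le> dist p q"
proof -
  obtain x y where xy: "p = grid_round s x" "q = grid_round s y" using assms by auto
  obtain b :: 'a where b: "b \<in> Basis" "p \<bullet> b \<noteq> q \<bullet> b"
    using assms(3) euclidean_eqI by blast
  then have "\<lfloor>(x \<bullet> b) / s\<rfloor> \<noteq> \<lfloor>(y \<bullet> b) / s\<rfloor>"
    by (auto simp: xy grid_round_inner)
  then have "1 \<le> \<bar>\<lfloor>(x \<bullet> b) / s\<rfloor> - \<lfloor>(y \<bullet> b) / s\<rfloor>\<bar>" by linarith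
  then have "1 \<le> \<bar>real_of_int \<lfloor>(x \<bullet> b) / s\<rfloor> - real_of_int \<lfloor>(y \<bullet> b) / s\<rfloor>\<bar>" by linarith
  then have "s * 1 \<le> s * \<bar>real_of_int \<lfloor>(x \<bullet> b) / s\<rfloor> - real_of_int \<lfloor>(y \<bullet> b) / s\<rfloor>\<bar>"
    using assms by (intro mult_left_mono) auto
  also have "\<dots> = \<bar>(p - q) \<bullet> b\<bar>"
    using assms(4) b by (simp add: xy inner_diff_left grid_round_inner right_diff_distrib[symmetric] abs_mult)
  also have "\<dots> \<le> norm (p - q)" using b by (intro Basis_le_norm)
  finally show ?thesis by (simp add: dist_norm)
qed

lemma countable_grid: "countable (grid :: (int \<times> 'a::euclidean_space) set)"
proof -
  have "countable (range (grid_round s :: 'a \<Rightarrow> 'a))" for s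
  proof -
    have "grid_round s y \<in> (\<lambda>f. \<Sum>b\<in>Basis. (s * of_int (f b)) *\<^sub>R b) ` (PiE Basis (\<lambda>_. UNIV :: int set))" for y :: 'a
      by (rule image_eqI[where x="restrict (\<lambda>b. \<lfloor>(y \<bullet> b) / s\<rfloor>) Basis"]) (auto simp: grid_round_def intro!: sum.cong)
    then have "range (grid_round s :: 'a \<Rightarrow> 'a) \<subseteq>
      (\<lambda>f. \<Sum>b\<in>Basis. (s * of_int (f b)) *\<^sub>R b) ` (PiE Basis (\<lambda>_. UNIV :: int set))" by blast
    moreover have "countable (PiE (Basis :: 'a set) (\<lambda>_. UNIV :: int set))"
      by (intro countable_PiE) auto
    ultimately show ?thesis using countable_image countable_subset by blast
  qed
  moreover have grid: "grid = (SIGMA k:UNIV. range (grid_round (mesh k) :: 'a \<Rightarrow> 'a))"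
    by (auto simp: grid_def)
  ultimately show ?thesis unfolding grid by (intro countable_SIGMA) auto
qed

text \<open>Packing: the balls of radius s/2 around the points are disjoint and lie in a ball of
  radius \<rho> + s/2; compare volumes.\<close>

lemma card_separated_in_ball:
  fixes P :: "'a::euclidean_space set"
  assumes P: "finite P" "P \<subseteq> ball z \<rho>" "\<And>p q. p \<in> P \<Longrightarrow> q \<in> P \<Longrightarrow> p \<noteq> q \<Longrightarrow> s \<le> dist p q" and s: "0 < s" "0 < \<rho>"
  shows "real (card P) \<le> (2 * \<rho> / s + 1) ^ DIM('a)"
proof -
  let ?o = "ball_vol TYPE('a)"
  have disj: "disjoint_family_on (\<lambda>p. ball p (s/2)) P"
    unfolding disjoint_family_on_def
  proof safe
    fix p q x assume "p \<in> P" "q \<in> P" "p \<noteq> q" "x \<in> ball p (s/2)" "x \<in> ball q (s/2)"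
    then have "dist p q < s" "s \<le> dist p q" using dist_triangle_half_r[of x p s q] P(3) by (auto simp: dist_commute)
    then show "x \<in> {}" by simp
  qed
  have "ennreal (real (card P) * (?o * (s/2) ^ DIM('a))) = (\<Sum>p\<in>P. emeasure lborel (ball p (s/2)))"
    using s ball_vol_pos[where 'a='a] by (simp add: emeasure_ball' ennreal_mult ennreal_of_nat_eq_real_of_nat)
  also have "\<dots> = emeasure lborel (\<Union>p\<in>P. ball p (s/2))"
    using disj P by (intro sum_emeasure) auto
  also have "\<dots> \<le> emeasure lborel (ball z (\<rho> + s/2))"
  proof (rule emeasure_mono)
    show "(\<Union>p\<in>P. ball p (s/2)) \<subseteq> ball z (\<rho> + s/2)"
    proof safe
      fix x p assume "p \<in> P" "x \<in> ball p (s/2)"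
      then have "dist z p < \<rho>" "dist p x < s/2" using P(2) by auto
      then show "x \<in> ball z (\<rho> + s/2)" using dist_triangle[of z x p] by simp
    qed
  qed simp
  also have "\<dots> = ennreal (?o * (\<rho> + s/2) ^ DIM('a))"
    using s by (intro emeasure_ball') auto
  finally have "real (card P) * (?o * (s/2) ^ DIM('a)) \<le> ?o * (\<rho> + s/2) ^ DIM('a)"
    using s ball_vol_pos[where 'a='a] by (subst (asm) ennreal_le_iff) auto
  then have "real (card P) \<le> (\<rho> + s/2) ^ DIM('a) / (s/2) ^ DIM('a)"
    using s ball_vol_pos[where 'a='a] by (simp add: field_simps)
  also have "\<dots> = ((\<rho> + s/2) / (s/2)) ^ DIM('a)"
    by (simp only: power_divide)
  also have "(\<rho> + s/2) / (s/2) = 2 * \<rho> / s + 1"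
    using s by (simp add: field_simps)
  finally show ?thesis .
qed

text \<open>Reduces a sum over lattice balls to a sum over scales alone: at each scale the lattice
  is separated, so packing counts the centres near z. The remaining sums are geometric in the
  applications.\<close>

lemma grid_sum_le:
  fixes J :: "(int \<times> 'a::euclidean_space) set"
  assumes J: "finite J" "J \<subseteq> grid" and u: "\<And>k. 0 \<le> u k" and \<rho>: "\<And>k. 0 < \<rho> k"
  shows "(\<Sum>i\<in>J. if snd i \<in> ball z (\<rho> (fst i)) then u (fst i) else 0)
     \<le> (\<Sum>k\<in>fst ` J. (2 * \<rho> k / mesh k + 1) ^ DIM('a) * u k)"
proof -
  have "(\<Sum>i\<in>J. if snd i \<in> ball z (\<rho> (fst i)) then u (fst i) else 0)
     = (\<Sum>k\<in>fst ` J. \<Sum>i\<in>{i\<in>J. fst i = k}. if snd i \<in> ball z (\<rho> (fst i)) then u (fst i) else 0)"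
    using J by (intro sum.image_gen)
  also have "\<dots> \<le> (\<Sum>k\<in>fst ` J. (2 * \<rho> k / mesh k + 1) ^ DIM('a) * u k)"
  proof (rule sum_mono)
    fix k
    define P where "P = {q. (k, q) \<in> J \<and> q \<in> ball z (\<rho> k)}"
    have P: "{i\<in>J. fst i = k \<and> snd i \<in> ball z (\<rho> k)} = Pair k ` P" by (auto simp: P_def)
    have "finite (Pair k ` P)" unfolding P[symmetric] using J by simp
    then have finP: "finite P" by (rule finite_imageD) (simp add: inj_on_def)
    have "real (card P) \<le> (2 * \<rho> k / mesh k + 1) ^ DIM('a)"
    proof (rule card_separated_in_ball[OF finP])
      show "P \<subseteq> ball z (\<rho> k)" by (auto simp: P_def)
      show "mesh k \<le> dist p q" if "p \<in> P" "q \<in> P" "p \<noteq> q" for p q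
      proof (rule grid_separated)
        show "p \<in> range (grid_round (mesh k))" "q \<in> range (grid_round (mesh k))"
          using that J(2) by (auto simp: P_def grid_def)
      qed (use that in auto)
    qed (use \<rho> in auto)
    moreover have "(\<Sum>i\<in>{i\<in>J. fst i = k}. if snd i \<in> ball z (\<rho> (fst i)) then u (fst i) else 0)
        = (\<Sum>i\<in>{i\<in>J. fst i = k \<and> snd i \<in> ball z (\<rho> k)}. u k)"
      using J by (intro sum.mono_neutral_cong_right) auto
    moreover have "\<dots> = real (card P) * u k"
      unfolding P by (simp add: card_image inj_on_def)
    ultimately show "(\<Sum>i\<in>{i\<in>J. fst i = k}. if snd i \<in> ball z (\<rho> (fst i)) then u (fst i) else 0)
       \<le> (2 * \<rho> k / mesh k + 1) ^ DIM('a) * u k"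
      using mult_right_mono[OF _ u] by metis
  qed
  finally show ?thesis .
qed

lemma geometric_sum_int:
  assumes K: "finite K" and x: "0 < x" "x < 1" and m: "\<And>k. k \<in> K \<Longrightarrow> m \<le> k"
  shows "(\<Sum>k\<in>K. x powr (of_int (k - m))) \<le> 1 / (1 - (x::real))"
proof -
  have "(\<Sum>k\<in>K. x powr (of_int (k - m))) = (\<Sum>k\<in>K. x ^ nat (k - m))"
    using x m by (intro sum.cong refl) (simp add: powr_realpow[symmetric])
  also have "\<dots> = (\<Sum>j\<in>(\<lambda>k. nat (k - m)) ` K. x ^ j)"
    by (subst sum.reindex) (auto simp: inj_on_def dest!: m)
  also have "\<dots> \<le> (\<Sum>j. x ^ j)"
    using x K by (intro sum_le_suminf summable_geometric) auto
  also have "\<dots> = 1 / (1 - x)" using x by (intro suminf_geometric) auto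
  finally show ?thesis .
qed

text \<open>Replacing \<open>a\<close> by the smallest mesh occurring in \<open>K\<close> only
  increases the terms and turns all ratios into exact powers of 2, so the bound depends neither on
  \<open>a\<close> nor on \<open>K\<close>.\<close>

lemma geometric_mesh_above:
  assumes K: "finite K" and \<beta>: "0 < \<beta>" and a: "0 < a" and m: "\<And>k. k \<in> K \<Longrightarrow> a \<le> mesh k"
  shows "(\<Sum>k\<in>K. (a / mesh k) powr \<beta>) \<le> 1 / (1 - 2 powr (- \<beta>))"
proof (cases "K = {}")
  case False
  have "(\<Sum>k\<in>K. (a / mesh k) powr \<beta>) \<le> (\<Sum>k\<in>K. (2 powr (- \<beta>)) powr (of_int (k - Min K)))"
  proof (rule sum_mono)
    fix k assume "k \<in> K"
    have "a \<le> mesh (Min K)" using m K False by simp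
    then have "(a / mesh k) powr \<beta> \<le> (mesh (Min K) / mesh k) powr \<beta>"
      using a \<beta> by (intro powr_mono2 divide_right_mono) (auto intro: less_imp_le)
    also have "\<dots> = (2 powr (- \<beta>)) powr (of_int (k - Min K))"
      by (simp add: mesh_def powr_diff[symmetric] powr_powr algebra_simps)
    finally show "(a / mesh k) powr \<beta> \<le> (2 powr (- \<beta>)) powr (of_int (k - Min K))" .
  qed
  also have "\<dots> \<le> 1 / (1 - 2 powr (- \<beta>))"
    using K \<beta> by (intro geometric_sum_int) (auto simp: powr_less_one)
  finally show ?thesis .
qed (use \<beta> in \<open>simp add: less_imp_le powr_less_one\<close>)

lemma geometric_mesh_below:
  assumes K: "finite K" and \<beta>: "0 < \<beta>" and a: "0 < a" and m: "\<And>k. k \<in> K \<Longrightarrow> mesh k \<le> a"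
  shows "(\<Sum>k\<in>K. (mesh k / a) powr \<beta>) \<le> 1 / (1 - 2 powr (- \<beta>))"
proof -
  have inv: "mesh (- k) = inverse (mesh k)" for k by (simp add: mesh_def powr_minus)
  have "(\<Sum>k\<in>K. (mesh k / a) powr \<beta>) = (\<Sum>k\<in>uminus ` K. (inverse a / mesh k) powr \<beta>)"
    by (subst sum.reindex) (auto simp: inj_on_def inv field_simps)
  also have "\<dots> \<le> 1 / (1 - 2 powr (- \<beta>))"
    using K \<beta> a m by (intro geometric_mesh_above) (auto simp: inv intro!: le_imp_inverse_le)
  finally show ?thesis .
qed

subsection \<open>The \<open>L\<^sup>2\<close> bound\<close>

definition geo :: "real \<Rightarrow> real" where "geo \<beta> = 1 / (1 - 2 powr (- \<beta>))"

lemma geo_pos: "0 < \<beta> \<Longrightarrow> 0 < geo \<beta>"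
  by (simp add: geo_def powr_less_one)

text \<open>The first factor counts neighbouring lattice balls, the second is the constant of
  \<open>bump_inner\<close>, and \<open>2 * geo \<alpha>\<close> sums the decay over larger and over
  smaller scales.\<close>

definition schur_const :: "'a::euclidean_space itself \<Rightarrow> real \<Rightarrow> real" where
  "schur_const _ \<alpha> = (5 * (real DIM('a) + 1)) ^ DIM('a) * (3 * ball_vol TYPE('a)) * (2 * geo \<alpha>)"

lemma schur_const_pos: "0 < \<alpha> \<Longrightarrow> 0 < schur_const TYPE('a::euclidean_space) \<alpha>"
  using geo_pos[of \<alpha>] ball_vol_pos[where 'a='a] by (simp add: schur_const_def add_pos_pos)

text \<open>Write m and M for the smaller and the larger of the two meshes. An inner product is of
  size (m/M)^\<alpha> M^(-n), and about (M / mesh k)^n balls at scale k meet the given one. With the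
  weight r^n all powers of the meshes cancel except (m/M)^\<alpha>, which is summable over scales in
  both directions.\<close>

lemma grid_schur:
  fixes J :: "(int \<times> 'a::euclidean_space) set"
  assumes \<alpha>: "0 < \<alpha>" "\<alpha> \<le> 1" and J: "finite J" "J \<subseteq> grid"
    and \<psi>: "\<And>i. i \<in> J \<Longrightarrow> bump \<alpha> (snd i) (rad TYPE('a) (fst i)) (\<psi> i)" and i: "i \<in> J"
  shows "(\<Sum>j\<in>J. rad TYPE('a) (fst j) ^ DIM('a) * norm (\<integral>z. \<psi> i z * cnj (\<psi> j z) \<partial>lborel)) \<le> schur_const TYPE('a) \<alpha>"
proof -
  let ?n = "DIM('a)" and ?c = "3 * ball_vol TYPE('a)" and ?r = "rad TYPE('a)"
  define M where "M k = max (mesh (fst i)) (mesh k)" for k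
  define m where "m k = min (mesh (fst i)) (mesh k)" for k
  \<comment> \<open>Weighted bound for a single term at scale \<open>k\<close>; balls with centres
    farther apart than \<open>\<rho> k\<close> are disjoint and contribute nothing.\<close>
  define u where "u k = ?r k ^ ?n * (?c * (m k / M k) powr \<alpha> / ((real ?n + 1) * M k) ^ ?n)" for k
  define \<rho> where "\<rho> k = ?r (fst i) + ?r k" for k
  have Mm: "0 < m k" "0 < M k" for k by (auto simp: m_def M_def less_max_iff_disj)
  have u0: "0 \<le> u k" for k
    using ball_vol_pos[where 'a='a] Mm[of k] less_imp_le[OF rad_pos[where 'a='a, of k]]
    by (auto simp: u_def intro!: mult_nonneg_nonneg divide_nonneg_nonneg)
  have inner: "norm (\<integral>z. \<psi> i z * cnj (\<psi> j z) \<partial>lborel) \<le> ?c * (m (fst j) / M (fst j)) powr \<alpha> / ((real ?n + 1) * M (fst j)) ^ ?n"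
    if j: "j \<in> J" for j
  proof -
    have scale: "?c * ?r k powr \<alpha> / ?r k' powr (real ?n + \<alpha>) = ?c * (mesh k / mesh k') powr \<alpha> / ((real ?n + 1) * mesh k') ^ ?n" for k k'
    proof -
      have "?r k powr \<alpha> / ?r k' powr (real ?n + \<alpha>) = (?r k / ?r k') powr \<alpha> / ?r k' ^ ?n"
        using rad_pos[where 'a='a, of k] rad_pos[where 'a='a, of k'] by (simp add: powr_divide powr_add powr_realpow less_imp_le)
      moreover have "?r k / ?r k' = mesh k / mesh k'" by (simp add: rad_def add_eq_0_iff)
      ultimately have "?r k powr \<alpha> / ?r k' powr (real ?n + \<alpha>) = (mesh k / mesh k') powr \<alpha> / ((real ?n + 1) * mesh k') ^ ?n"
        by (simp add: rad_def)
      then show ?thesis by (metis times_divide_eq_right)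
    qed
    show ?thesis
    proof (cases "mesh (fst i) \<le> mesh (fst j)")
      case True
      then have "m (fst j) = mesh (fst i)" "M (fst j) = mesh (fst j)" by (auto simp: m_def M_def)
      then show ?thesis
        using bump_inner[OF \<alpha> rad_pos rad_pos \<psi>[OF i] \<psi>[OF j]] scale by simp
    next
      case False
      then have "m (fst j) = mesh (fst j)" "M (fst j) = mesh (fst i)" by (auto simp: m_def M_def)
      moreover have "norm (\<integral>z. \<psi> i z * cnj (\<psi> j z) \<partial>lborel) = norm (\<integral>z. \<psi> j z * cnj (\<psi> i z) \<partial>lborel)"
      proof -
        have "cnj (\<integral>z. \<psi> i z * cnj (\<psi> j z) \<partial>lborel) = (\<integral>z. cnj (\<psi> i z * cnj (\<psi> j z)) \<partial>lborel)"
          by (rule Bochner_Integration.integral_cnj[symmetric])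
        also have "\<dots> = (\<integral>z. \<psi> j z * cnj (\<psi> i z) \<partial>lborel)" by (simp add: mult.commute)
        finally show ?thesis by (metis complex_mod_cnj)
      qed
      ultimately show ?thesis
        using bump_inner[OF \<alpha> rad_pos rad_pos \<psi>[OF j] \<psi>[OF i]] scale by simp
    qed
  qed
  have "(\<Sum>j\<in>J. ?r (fst j) ^ ?n * norm (\<integral>z. \<psi> i z * cnj (\<psi> j z) \<partial>lborel))
     \<le> (\<Sum>j\<in>J. if snd j \<in> ball (snd i) (\<rho> (fst j)) then u (fst j) else 0)"
  proof (rule sum_mono)
    fix j assume j: "j \<in> J"
    show "?r (fst j) ^ ?n * norm (\<integral>z. \<psi> i z * cnj (\<psi> j z) \<partial>lborel)
        \<le> (if snd j \<in> ball (snd i) (\<rho> (fst j)) then u (fst j) else 0)"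
    proof (cases "snd j \<in> ball (snd i) (\<rho> (fst j))")
      case True
      have "0 \<le> ?r (fst j) ^ ?n" by (simp add: less_imp_le)
      from mult_left_mono[OF inner[OF j] this] show ?thesis
        using True unfolding u_def by simp
    next
      case False
      then have "(\<integral>z. \<psi> i z * cnj (\<psi> j z) \<partial>lborel) = 0"
        by (intro bump_inner_far[OF \<psi>[OF i] \<psi>[OF j]]) (simp add: \<rho>_def)
      then show ?thesis using False by simp
    qed
  qed
  also have "\<dots> \<le> (\<Sum>k\<in>fst ` J. (2 * \<rho> k / mesh k + 1) ^ ?n * u k)"
    by (rule grid_sum_le[OF J u0]) (auto simp: \<rho>_def intro!: add_pos_pos)
  also have "\<dots> \<le> (\<Sum>k\<in>fst ` J. (5 * (real ?n + 1)) ^ ?n * ?c * ((m k / M k) powr \<alpha>))"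
  proof (rule sum_mono)
    fix k
    \<comment> \<open>The factor 5 in \<open>schur_const\<close>: with X = (n+1) M, twice the sum of
      the radii is at most 4 X, and the mesh itself is at most X.\<close>
    have "?r (fst i) + ?r k \<le> 2 * ((real ?n + 1) * M k)"
    proof -
      have "mesh (fst i) \<le> M k" "mesh k \<le> M k" by (auto simp: M_def)
      then have "(real ?n + 1) * mesh (fst i) + (real ?n + 1) * mesh k \<le> (real ?n + 1) * M k + (real ?n + 1) * M k"
        by (intro add_mono mult_left_mono) auto
      then show ?thesis unfolding rad_def by linarith
    qed
    moreover have "mesh k \<le> (real ?n + 1) * M k"
      using mult_mono[of 1 "real ?n + 1" "mesh k" "M k"] by (simp add: M_def less_imp_le)
    ultimately have "2 * \<rho> k + mesh k \<le> 5 * ((real ?n + 1) * M k)"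
    proof -
      have "2 * (a + b) + m \<le> 5 * X" if "a + b \<le> 2 * X" "m \<le> X" for a b m X :: real
        using that by argo
      with \<open>?r (fst i) + ?r k \<le> _\<close> \<open>mesh k \<le> _\<close> show ?thesis unfolding \<rho>_def by blast
    qed
    then have "2 * \<rho> k + mesh k \<le> 5 * (real ?n + 1) * M k" by (simp only: mult.assoc)
    then have "(2 * \<rho> k + mesh k) / mesh k \<le> 5 * (real ?n + 1) * M k / mesh k"
      by (rule divide_right_mono) (simp add: less_imp_le)
    then have "2 * \<rho> k / mesh k + 1 \<le> 5 * (real ?n + 1) * M k / mesh k"
      using mesh_pos[of k] by (simp add: add_divide_distrib)
    then have "(2 * \<rho> k / mesh k + 1) ^ ?n * u k \<le> (5 * (real ?n + 1) * M k / mesh k) ^ ?n * u k"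
    proof (intro mult_right_mono power_mono u0)
      have "0 \<le> \<rho> k" by (simp add: \<rho>_def add_nonneg_nonneg less_imp_le)
      then show "0 \<le> 2 * \<rho> k / mesh k + 1"
        by (intro add_nonneg_nonneg divide_nonneg_nonneg) (auto intro: less_imp_le)
    qed
    also have "\<dots> = (5 * (real ?n + 1)) ^ ?n * ?c * ((m k / M k) powr \<alpha>)"
    proof -
      have "M k ^ ?n \<noteq> 0" "mesh k ^ ?n \<noteq> 0" "(real ?n + 1) ^ ?n \<noteq> 0"
        using Mm[of k] less_imp_neq[OF mesh_pos[of k]] by (auto simp: add_eq_0_iff)
      then show ?thesis
        unfolding u_def rad_def power_mult_distrib power_divide by simp
    qed
    finally show "(2 * \<rho> k / mesh k + 1) ^ ?n * u k \<le> (5 * (real ?n + 1)) ^ ?n * ?c * ((m k / M k) powr \<alpha>)" .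
  qed
  also have "\<dots> = (5 * (real ?n + 1)) ^ ?n * ?c * (\<Sum>k\<in>fst ` J. (m k / M k) powr \<alpha>)"
    by (simp add: sum_distrib_left)
  also have "(\<Sum>k\<in>fst ` J. (m k / M k) powr \<alpha>) \<le> 2 * geo \<alpha>"
  proof -
    let ?a = "mesh (fst i)"
    let ?A = "{k\<in>fst ` J. ?a \<le> mesh k}" and ?B = "{k\<in>fst ` J. \<not> ?a \<le> mesh k}"
    have "(\<Sum>k\<in>fst ` J. (m k / M k) powr \<alpha>) = (\<Sum>k\<in>?A. (m k / M k) powr \<alpha>) + (\<Sum>k\<in>?B. (m k / M k) powr \<alpha>)"
      using J by (subst sum.union_disjoint[symmetric]) (auto intro!: sum.cong)
    also have "(\<Sum>k\<in>?A. (m k / M k) powr \<alpha>) = (\<Sum>k\<in>?A. (?a / mesh k) powr \<alpha>)"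
      by (intro sum.cong refl) (auto simp: m_def M_def)
    also have "(\<Sum>k\<in>?B. (m k / M k) powr \<alpha>) = (\<Sum>k\<in>?B. (mesh k / ?a) powr \<alpha>)"
      by (intro sum.cong refl) (auto simp: m_def M_def)
    also have "(\<Sum>k\<in>?A. (?a / mesh k) powr \<alpha>) + (\<Sum>k\<in>?B. (mesh k / ?a) powr \<alpha>) \<le> geo \<alpha> + geo \<alpha>"
      unfolding geo_def using J \<alpha>
      by (intro add_mono geometric_mesh_above geometric_mesh_below) auto
    finally show ?thesis by simp
  qed
  finally show ?thesis
    using ball_vol_pos[where 'a='a] by (simp add: schur_const_def mult_left_mono)
qed

text \<open>The choices made for different indices are independent, so no measurable selection is needed.\<close>

lemma sum_SUP_le:
  fixes g :: "'i \<Rightarrow> 'b \<Rightarrow> ennreal"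
  assumes "finite J" "\<And>i. i \<in> J \<Longrightarrow> T i \<noteq> {}"
    and "\<And>\<phi>. (\<And>i. i \<in> J \<Longrightarrow> \<phi> i \<in> T i) \<Longrightarrow> (\<Sum>i\<in>J. g i (\<phi> i)) + R \<le> B"
  shows "(\<Sum>i\<in>J. SUP x\<in>T i. g i x) + R \<le> B"
  using assms
proof (induction J arbitrary: R rule: finite_induct)
  case (insert j J)
  \<comment> \<open>The remainder \<open>R\<close> takes up the term of index \<open>j\<close> with
    its choice \<open>x\<close> held fixed, so that the induction hypothesis applies to the other
    indices.\<close>
  have "(\<Sum>i\<in>J. SUP x\<in>T i. g i x) + (g j x + R) \<le> B" if x: "x \<in> T j" for x
  proof (rule insert.IH)
    fix \<phi> assume "\<And>i. i \<in> J \<Longrightarrow> \<phi> i \<in> T i"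
    then have "(\<Sum>i\<in>insert j J. g i ((\<phi>(j := x)) i)) + R \<le> B"
      using x by (intro insert.prems) auto
    moreover have "(\<Sum>i\<in>J. g i ((\<phi>(j := x)) i)) = (\<Sum>i\<in>J. g i (\<phi> i))"
      using insert.hyps by (intro sum.cong) auto
    ultimately show "(\<Sum>i\<in>J. g i (\<phi> i)) + (g j x + R) \<le> B"
      using insert.hyps by (simp add: ac_simps)
  qed (use insert.prems in auto)
  then have "(SUP x\<in>T j. g j x + ((\<Sum>i\<in>J. SUP x\<in>T i. g i x) + R)) \<le> B"
    by (intro SUP_least) (simp add: ac_simps)
  moreover have "(SUP x\<in>T j. g j x + ((\<Sum>i\<in>J. SUP x\<in>T i. g i x) + R)) = (SUP x\<in>T j. g j x) + ((\<Sum>i\<in>J. SUP x\<in>T i. g i x) + R)"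
    using insert.prems by (intro ennreal_SUP_add_left) auto
  ultimately show ?case using insert.hyps by (simp add: ac_simps)
qed (use assms in auto)

lemma bump_zero: "0 < r \<Longrightarrow> bump \<alpha> q r (\<lambda>_. 0)"
  by (simp add: bump_def)

lemma ennreal_SUP_power2_mult:
  fixes g :: "'b \<Rightarrow> ennreal"
  assumes "I \<noteq> {}"
  shows "c * (SUP i\<in>I. g i)\<^sup>2 = (SUP i\<in>I. c * (g i)\<^sup>2)"
proof -
  have "(SUP i\<in>I. g i)\<^sup>2 = (SUP i\<in>I. (g i)\<^sup>2)"
    using ennreal_powr_SUP[OF _ assms, of 2 g] by simp
  then show ?thesis using assms by (simp add: SUP_mult_left_ennreal)
qed

text \<open>For any choice of one bump per ball this is \<open>bessel_schur\<close> with the row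
  sums of \<open>grid_schur\<close>. The constant does not depend on the choice, so suprema may be
  taken inside the sum.\<close>

lemma bump_sup_L2:
  fixes J :: "(int \<times> 'a::euclidean_space) set"
  assumes \<alpha>: "0 < \<alpha>" "\<alpha> \<le> 1" and J: "finite J" "J \<subseteq> grid" and f[measurable]: "f \<in> borel_measurable borel"
  shows "(\<Sum>i\<in>J. ennreal (rad TYPE('a) (fst i) ^ DIM('a)) * (bump_sup \<alpha> f (snd i) (rad TYPE('a) (fst i)))\<^sup>2)
     \<le> ennreal (schur_const TYPE('a) \<alpha>) * (\<integral>\<^sup>+z. (ennreal (norm (f z)))\<^sup>2 \<partial>lborel)"
proof (cases "(\<integral>\<^sup>+z. (ennreal (norm (f z)))\<^sup>2 \<partial>lborel) = top")
  case True
  then show ?thesis using schur_const_pos[OF \<alpha>(1), where 'a='a] by (simp add: ennreal_mult_top)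
next
  case False
  let ?r = "\<lambda>i::int \<times> 'a. rad TYPE('a) (fst i)"
  have f2: "integrable lborel (\<lambda>z. (norm (f z))\<^sup>2)"
    using False by (intro integrableI_bounded) (auto simp: ennreal_power less_top)
  have "(\<Sum>i\<in>J. ennreal (?r i ^ DIM('a)) * (norm (\<integral>z. \<phi> i z * f z \<partial>lborel))\<^sup>2) + 0
     \<le> ennreal (schur_const TYPE('a) \<alpha>) * (\<integral>\<^sup>+z. (ennreal (norm (f z)))\<^sup>2 \<partial>lborel)"
    if \<phi>: "\<And>i. i \<in> J \<Longrightarrow> \<phi> i \<in> Collect (bump \<alpha> (snd i) (?r i))" for \<phi>
  proof -
    have bp: "bump \<alpha> (snd i) (?r i) (\<phi> i)" if "i \<in> J" for i using \<phi>[OF that] by simp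
    have m: "\<phi> i \<in> borel_measurable borel" if "i \<in> J" for i
      using bump_measurable[OF \<alpha>(1) bp[OF that]] .
    have prod: "integrable lborel (\<lambda>z. \<phi> i z * cnj (\<phi> j z))" if ij: "i \<in> J" "j \<in> J" for i j
    proof (rule integrable_bounded_ball[where q="snd i" and r="?r i" and B="3 / ?r i ^ DIM('a) * (3 / ?r j ^ DIM('a))"])
      show "(\<lambda>z. \<phi> i z * cnj (\<phi> j z)) \<in> borel_measurable borel"
        using m[OF ij(1)] m[OF ij(2)] by measurable
      show "norm (\<phi> i z * cnj (\<phi> j z)) \<le> 3 / ?r i ^ DIM('a) * (3 / ?r j ^ DIM('a))" for z
        unfolding norm_mult complex_mod_cnj
        by (intro mult_mono bump_bound[OF \<alpha> rad_pos bp[OF ij(1)]] bump_bound[OF \<alpha> rad_pos bp[OF ij(2)]] divide_nonneg_nonneg)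
          (auto intro: less_imp_le)
      show "\<phi> i z * cnj (\<phi> j z) = 0" if "z \<notin> ball (snd i) (?r i)" for z
        using bump_outside[OF bp[OF ij(1)] that] by simp
    qed
    have "(\<Sum>i\<in>J. ?r i ^ DIM('a) * (norm (\<integral>z. \<phi> i z * f z \<partial>lborel))\<^sup>2)
       \<le> schur_const TYPE('a) \<alpha> * (\<integral>z. (norm (f z))\<^sup>2 \<partial>lborel)"
    proof (rule bessel_schur[OF J(1) _ schur_const_pos[OF \<alpha>(1)] f2])
      fix i assume i: "i \<in> J"
      have [measurable]: "\<phi> i \<in> borel_measurable borel" by (rule m[OF i])
      show "integrable lborel (\<lambda>z. \<phi> i z * f z)"
      proof (rule Bochner_Integration.integrable_bound)
        have "integrable lborel (\<lambda>z. (norm (\<phi> i z))\<^sup>2)"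
        proof -
          have "\<phi> i z * cnj (\<phi> i z) = of_real ((norm (\<phi> i z))\<^sup>2)" for z
            by (simp only: complex_norm_square)
          with prod[OF i i] have "integrable lborel (\<lambda>z. complex_of_real ((norm (\<phi> i z))\<^sup>2))" by simp
          from integrable_Re[OF this] show ?thesis by (simp only: Re_complex_of_real)
        qed
        then show "integrable lborel (\<lambda>z. (norm (\<phi> i z))\<^sup>2 + (norm (f z))\<^sup>2)"
          using f2 by (rule Bochner_Integration.integrable_add)
        show "AE z in lborel. norm (\<phi> i z * f z) \<le> norm ((norm (\<phi> i z))\<^sup>2 + (norm (f z))\<^sup>2)"
        proof (intro always_eventually allI)
          fix z
          have "2 * (norm (\<phi> i z) * norm (f z)) \<le> (norm (\<phi> i z))\<^sup>2 + (norm (f z))\<^sup>2"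
            using sum_squares_bound[of "norm (\<phi> i z)" "norm (f z)"] by (simp add: mult.assoc)
          moreover have "0 \<le> norm (\<phi> i z) * norm (f z)" by simp
          ultimately have "norm (\<phi> i z) * norm (f z) \<le> (norm (\<phi> i z))\<^sup>2 + (norm (f z))\<^sup>2"
            by linarith
          then show "norm (\<phi> i z * f z) \<le> norm ((norm (\<phi> i z))\<^sup>2 + (norm (f z))\<^sup>2)"
            by (simp add: norm_mult)
        qed
      qed measurable
      show "(\<Sum>j\<in>J. ?r j ^ DIM('a) * norm (\<integral>z. \<phi> i z * cnj (\<phi> j z) \<partial>lborel)) \<le> schur_const TYPE('a) \<alpha>"
        by (rule grid_schur[OF \<alpha> J bp i])
    qed (auto simp: prod less_imp_le)
    then have "ennreal (\<Sum>i\<in>J. ?r i ^ DIM('a) * (norm (\<integral>z. \<phi> i z * f z \<partial>lborel))\<^sup>2)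
       \<le> ennreal (schur_const TYPE('a) \<alpha> * (\<integral>z. (norm (f z))\<^sup>2 \<partial>lborel))"
      by (rule ennreal_leI)
    also have "\<dots> = ennreal (schur_const TYPE('a) \<alpha>) * (\<integral>\<^sup>+z. (ennreal (norm (f z)))\<^sup>2 \<partial>lborel)"
      using schur_const_pos[OF \<alpha>(1), where 'a='a] f2
      by (simp add: ennreal_mult' ennreal_power nn_integral_eq_integral less_imp_le)
    also have "ennreal (\<Sum>i\<in>J. ?r i ^ DIM('a) * (norm (\<integral>z. \<phi> i z * f z \<partial>lborel))\<^sup>2)
        = (\<Sum>i\<in>J. ennreal (?r i ^ DIM('a)) * (norm (\<integral>z. \<phi> i z * f z \<partial>lborel))\<^sup>2)"
      by (subst sum_ennreal[symmetric]) (auto simp: ennreal_mult ennreal_power less_imp_le)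
    finally show ?thesis by simp
  qed
  then have "(\<Sum>i\<in>J. SUP \<psi>\<in>Collect (bump \<alpha> (snd i) (?r i)). ennreal (?r i ^ DIM('a)) * (ennreal (norm (\<integral>z. \<psi> z * f z \<partial>lborel)))\<^sup>2) + 0
     \<le> ennreal (schur_const TYPE('a) \<alpha>) * (\<integral>\<^sup>+z. (ennreal (norm (f z)))\<^sup>2 \<partial>lborel)"
  proof (intro sum_SUP_le)
    show "Collect (bump \<alpha> (snd i) (?r i)) \<noteq> {}" for i
      using bump_zero[OF rad_pos[where 'a='a], of \<alpha> "snd i" "fst i"] by blast
  qed (use J in \<open>auto simp: ennreal_power\<close>)
  moreover have "ennreal (?r i ^ DIM('a)) * (bump_sup \<alpha> f (snd i) (?r i))\<^sup>2
     = (SUP \<psi>\<in>Collect (bump \<alpha> (snd i) (?r i)). ennreal (?r i ^ DIM('a)) * (ennreal (norm (\<integral>z. \<psi> z * f z \<partial>lborel)))\<^sup>2)" for i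
    unfolding bump_sup_def using bump_zero[OF rad_pos[where 'a='a]] by (intro ennreal_SUP_power2_mult) blast
  ultimately show ?thesis by simp
qed

subsection \<open>Sequences of functions and the weighted bound\<close>

definition sq_sum :: "(nat \<Rightarrow> 'a \<Rightarrow> complex) \<Rightarrow> 'a \<Rightarrow> ennreal" where
  "sq_sum f x = (\<Sum>j. (ennreal (norm (f j x)))\<^sup>2)"

text \<open>From here on, the estimates on finite families of balls see the square functions of the
  sequence only through these numbers. They are not normalised by volume; the weight r^n is supplied
  where they are integrated.\<close>

definition bump_coeff :: "real \<Rightarrow> (nat \<Rightarrow> 'a::euclidean_space \<Rightarrow> complex) \<Rightarrow> int \<times> 'a \<Rightarrow> ennreal" where
  "bump_coeff \<alpha> f i = (\<Sum>j. (bump_sup \<alpha> (f j) (snd i) (rad TYPE('a) (fst i)))\<^sup>2)"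

text \<open>Up to constants, the supremum of these over finite \<open>J \<subseteq> grid\<close> dominates \<open>\<Sum>\<^sub>j S\<^sub>\<alpha>(f\<^sub>j)\<^sup>2\<close>.\<close>

definition disc_square :: "real \<Rightarrow> (int \<times> 'a) set \<Rightarrow> (nat \<Rightarrow> 'a::euclidean_space \<Rightarrow> complex) \<Rightarrow> 'a \<Rightarrow> ennreal" where
  "disc_square \<alpha> J f x = (\<Sum>i\<in>J. bump_coeff \<alpha> f i * indicator (gball i) x)"

lemma sq_sum_measurable [measurable]:
  assumes [measurable]: "\<And>j. f j \<in> borel_measurable borel"
  shows "sq_sum f \<in> borel_measurable borel"
  unfolding sq_sum_def by measurable

lemma disc_square_measurable [measurable]: "disc_square \<alpha> J f \<in> borel_measurable borel"
  unfolding disc_square_def by measurable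

lemma bump_coeff_cong:
  assumes "\<And>j z. z \<in> gball i \<Longrightarrow> f j z = g j z"
  shows "bump_coeff \<alpha> f i = bump_coeff \<alpha> g i"
  unfolding bump_coeff_def by (intro suminf_cong arg_cong[where f="\<lambda>x. x\<^sup>2"] bump_sup_cong assms)

lemma bump_coeff_L2:
  fixes J :: "(int \<times> 'a::euclidean_space) set"
  assumes \<alpha>: "0 < \<alpha>" "\<alpha> \<le> 1" and J: "finite J" "J \<subseteq> grid" and f[measurable]: "\<And>j. f j \<in> borel_measurable borel"
  shows "(\<Sum>i\<in>J. ennreal (rad TYPE('a) (fst i) ^ DIM('a)) * bump_coeff \<alpha> f i)
     \<le> ennreal (schur_const TYPE('a) \<alpha>) * (\<integral>\<^sup>+z. sq_sum f z \<partial>lborel)"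
proof -
  have "(\<Sum>i\<in>J. ennreal (rad TYPE('a) (fst i) ^ DIM('a)) * bump_coeff \<alpha> f i)
     = (\<Sum>j. \<Sum>i\<in>J. ennreal (rad TYPE('a) (fst i) ^ DIM('a)) * (bump_sup \<alpha> (f j) (snd i) (rad TYPE('a) (fst i)))\<^sup>2)"
    unfolding bump_coeff_def by (subst suminf_sum) (auto simp: ennreal_suminf_cmult)
  also have "\<dots> \<le> (\<Sum>j. ennreal (schur_const TYPE('a) \<alpha>) * (\<integral>\<^sup>+z. (ennreal (norm (f j z)))\<^sup>2 \<partial>lborel))"
    by (intro suminf_le bump_sup_L2 \<alpha> J f summableI)
  also have "\<dots> = ennreal (schur_const TYPE('a) \<alpha>) * (\<integral>\<^sup>+z. sq_sum f z \<partial>lborel)"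
    unfolding sq_sum_def by (subst nn_integral_suminf) (auto simp: ennreal_suminf_cmult)
  finally show ?thesis .
qed

lemma sq_sum_indicator: "sq_sum (\<lambda>j x. f j x * indicator E x) x = sq_sum f x * indicator E x"
  by (simp add: sq_sum_def indicator_def)

text \<open>By locality f may be multiplied by the indicator of \<open>E\<close> without changing
  the coefficients involved. \<open>E\<close> will be a level set or a single ball.\<close>

lemma bump_coeff_L2_on:
  fixes J :: "(int \<times> 'a::euclidean_space) set"
  assumes \<alpha>: "0 < \<alpha>" "\<alpha> \<le> 1" and J: "finite J" "J \<subseteq> grid" and f[measurable]: "\<And>j. f j \<in> borel_measurable borel"
    and E[measurable]: "E \<in> sets borel" and sub: "\<And>i. i \<in> J \<Longrightarrow> gball i \<subseteq> E"
  shows "(\<Sum>i\<in>J. ennreal (rad TYPE('a) (fst i) ^ DIM('a)) * bump_coeff \<alpha> f i)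
     \<le> ennreal (schur_const TYPE('a) \<alpha>) * (\<integral>\<^sup>+z\<in>E. sq_sum f z \<partial>lborel)"
proof -
  let ?g = "\<lambda>j x. f j x * indicator E x :: complex"
  have "bump_coeff \<alpha> f i = bump_coeff \<alpha> ?g i" if "i \<in> J" for i
    using sub[OF that] by (intro bump_coeff_cong) (auto simp: indicator_def)
  then have "(\<Sum>i\<in>J. ennreal (rad TYPE('a) (fst i) ^ DIM('a)) * bump_coeff \<alpha> f i)
     = (\<Sum>i\<in>J. ennreal (rad TYPE('a) (fst i) ^ DIM('a)) * bump_coeff \<alpha> ?g i)"
    by (intro sum.cong) auto
  also have "\<dots> \<le> ennreal (schur_const TYPE('a) \<alpha>) * (\<integral>\<^sup>+z. sq_sum ?g z \<partial>lborel)"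
    by (rule bump_coeff_L2[OF \<alpha> J]) measurable
  finally show ?thesis by (simp only: sq_sum_indicator)
qed

lemma nn_integral_disc_square:
  fixes J :: "(int \<times> 'a::euclidean_space) set"
  assumes [measurable]: "w \<in> borel_measurable borel"
  shows "(\<integral>\<^sup>+x. disc_square \<alpha> J f x * w x \<partial>lborel) = (\<Sum>i\<in>J. bump_coeff \<alpha> f i * (\<integral>\<^sup>+x\<in>gball i. w x \<partial>lborel))"
proof -
  have "(\<integral>\<^sup>+x. disc_square \<alpha> J f x * w x \<partial>lborel) = (\<integral>\<^sup>+x. (\<Sum>i\<in>J. bump_coeff \<alpha> f i * (w x * indicator (gball i) x)) \<partial>lborel)"
    by (simp add: disc_square_def sum_distrib_right mult.assoc mult.commute[of "w _"])
  also have "\<dots> = (\<Sum>i\<in>J. \<integral>\<^sup>+x. bump_coeff \<alpha> f i * (w x * indicator (gball i) x) \<partial>lborel)"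
    by (rule nn_integral_sum) measurable
  also have "\<dots> = (\<Sum>i\<in>J. bump_coeff \<alpha> f i * (\<integral>\<^sup>+x\<in>gball i. w x \<partial>lborel))"
    by (intro sum.cong refl nn_integral_cmult) measurable
  finally show ?thesis .
qed

lemma ennreal_mult_divide_self:
  assumes "0 < c"
  shows "ennreal c * (a / ennreal c) = a"
  using assms by (cases a) (auto simp: divide_ennreal ennreal_mult[symmetric] ennreal_top_divide ennreal_mult_top)

lemma disc_square_weighted:
  fixes J :: "(int \<times> 'a::euclidean_space) set"
  assumes \<alpha>: "0 < \<alpha>" "\<alpha> \<le> 1" and J: "finite J" "J \<subseteq> grid" and f[measurable]: "\<And>j. f j \<in> borel_measurable borel"
    and w[measurable]: "w \<in> borel_measurable borel"
  shows "(\<integral>\<^sup>+x. disc_square \<alpha> J f x * w x \<partial>lborel)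
     \<le> ennreal (ball_vol TYPE('a) * schur_const TYPE('a) \<alpha>) * (\<integral>\<^sup>+z. sq_sum f z * hlmax w z \<partial>lborel)"
proof -
  let ?o = "ball_vol TYPE('a)" and ?K = "schur_const TYPE('a) \<alpha>"
  define rn where "rn i = rad TYPE('a) (fst i) ^ DIM('a)" for i :: "int \<times> 'a"
  define av where "av i = (\<integral>\<^sup>+x\<in>gball i. w x \<partial>lborel) / ennreal (?o * rn i)" for i
  have o: "0 < ?o" by (rule ball_vol_pos)
  have rn: "0 < rn i" for i by (simp add: rn_def)
  have int: "(\<integral>\<^sup>+x\<in>gball i. w x \<partial>lborel) = ennreal (?o * rn i) * av i" for i
  proof -
    have "0 < ?o * rn i" using o rn by simp
    then show ?thesis
      unfolding av_def by (rule ennreal_mult_divide_self[symmetric])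
  qed
  \<comment> \<open>Each average is written as the length of the set of levels below it, so that the
    sum over balls becomes an integral over levels, with only the balls above the level remaining in
    the sum.\<close>
  have avl: "av i = (\<integral>\<^sup>+l. indicator {l. 0 < l \<and> ennreal l < av i} l \<partial>lborel)" for i
  proof -
    have "(\<integral>\<^sup>+l. indicator {l. 0 < l \<and> ennreal l < av i} l \<partial>lborel)
       = (\<integral>\<^sup>+l. ennreal (l powr 0) * indicator {l. 0 < l \<and> ennreal l < av i} l \<partial>lborel)"
      by (intro nn_integral_cong) (auto simp: indicator_def)
    also have "\<dots> = av i" by (subst nn_integral_powr_below) auto
    finally show ?thesis by simp
  qed
  have "(\<integral>\<^sup>+x. disc_square \<alpha> J f x * w x \<partial>lborel) = (\<Sum>i\<in>J. bump_coeff \<alpha> f i * (ennreal (?o * rn i) * av i))"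
    by (simp add: nn_integral_disc_square int)
  also have "\<dots> = (\<Sum>i\<in>J. ennreal ?o * (ennreal (rn i) * bump_coeff \<alpha> f i) * (\<integral>\<^sup>+l. indicator {l. 0 < l \<and> ennreal l < av i} l \<partial>lborel))"
    using o rn by (simp add: avl[symmetric] ennreal_mult less_imp_le mult_ac)
  also have "\<dots> = (\<integral>\<^sup>+l. (\<Sum>i\<in>J. ennreal ?o * (ennreal (rn i) * bump_coeff \<alpha> f i) * indicator {l. 0 < l \<and> ennreal l < av i} l) \<partial>lborel)"
  proof (subst nn_integral_sum)
    show "(\<lambda>l. ennreal ?o * (ennreal (rn i) * bump_coeff \<alpha> f i) * indicator {l. 0 < l \<and> ennreal l < av i} l) \<in> borel_measurable lborel" for i
      by measurable
  qed (intro sum.cong refl nn_integral_cmult[symmetric], measurable)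
  also have "\<dots> \<le> (\<integral>\<^sup>+l. ennreal (?o * ?K) * (ennreal (l powr 0) * indicator {0<..} l * (\<integral>\<^sup>+x. sq_sum f x * indicator {x. ennreal l < hlmax w x} x \<partial>lborel)) \<partial>lborel)"
  proof (rule nn_integral_mono)
    fix l :: real
    show "(\<Sum>i\<in>J. ennreal ?o * (ennreal (rn i) * bump_coeff \<alpha> f i) * indicator {l. 0 < l \<and> ennreal l < av i} l)
      \<le> ennreal (?o * ?K) * (ennreal (l powr 0) * indicator {0<..} l * (\<integral>\<^sup>+x. sq_sum f x * indicator {x. ennreal l < hlmax w x} x \<partial>lborel))"
    proof (cases "0 < l")
      case True
      let ?J = "{i\<in>J. ennreal l < av i}"
      have "(\<Sum>i\<in>J. ennreal ?o * (ennreal (rn i) * bump_coeff \<alpha> f i) * indicator {l. 0 < l \<and> ennreal l < av i} l)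
         = (\<Sum>i\<in>?J. ennreal ?o * (ennreal (rn i) * bump_coeff \<alpha> f i))"
        using J True by (intro sum.mono_neutral_cong_right) (auto simp: indicator_def)
      also have "\<dots> = ennreal ?o * (\<Sum>i\<in>?J. ennreal (rn i) * bump_coeff \<alpha> f i)"
        by (simp add: sum_distrib_left)
      also have "\<dots> \<le> ennreal ?o * (ennreal ?K * (\<integral>\<^sup>+x\<in>{x. ennreal l < hlmax w x}. sq_sum f x \<partial>lborel))"
        unfolding rn_def
      proof (intro mult_left_mono bump_coeff_L2_on[OF \<alpha>])
        fix i assume "i \<in> ?J"
        then have "ennreal l < av i" by simp
        then show "gball i \<subseteq> {x. ennreal l < hlmax w x}"
          unfolding av_def rn_def using less_le_trans[OF _ hlmax_ge] by blast
      qed (use J in auto)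
      finally show ?thesis
        using True o schur_const_pos[OF \<alpha>(1), where 'a='a] by (simp add: ennreal_mult less_imp_le mult.assoc)
    qed simp
  qed
  also have "\<dots> = ennreal (?o * ?K) * (\<integral>\<^sup>+x. sq_sum f x * ennreal_powr (hlmax w x) (0 + 1) \<partial>lborel)"
    by (subst layer_cake) (auto simp: nn_integral_cmult indicator_def)
  finally show ?thesis by simp
qed

section \<open>Exponents p \<ge> 2: Young's inequality and absorption\<close>

lemma ennreal_young:
  assumes s: "1 < s" and e: "0 < \<epsilon>"
  shows "x * y \<le> ennreal (\<epsilon> powr (1 - s)) * ennreal_powr x s + ennreal \<epsilon> * ennreal_powr y (s / (s - 1))"
proof -
  have q: "0 < s / (s - 1)" using s by simp
  show ?thesis
  proof (cases "x = top \<or> y = top")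
    case True
    then show ?thesis using s e by (auto simp: ennreal_mult_top)
  next
    case False
    then obtain a b where ab: "x = ennreal a" "y = ennreal b" "0 \<le> a" "0 \<le> b"
      by (cases x; cases y) auto
    have "a * b \<le> \<epsilon> powr (1 - s) * a powr s + \<epsilon> * b powr (s / (s - 1))"
    \<comment> \<open>The threshold is where a b equals
      \<open>\<epsilon> * b powr (s / (s - 1))\<close>; below it the second term alone dominates,
      above it the first. The small factor sits on the term that is later absorbed.\<close>
    proof (cases "a \<le> \<epsilon> * b powr (1 / (s - 1))")
      case True
      have "a * b \<le> \<epsilon> * b powr (1 / (s - 1)) * b"
        using True ab by (intro mult_right_mono)
      also have "\<dots> = \<epsilon> * b powr (s / (s - 1))"
      proof (cases "b = 0")
        case False
        then have "b powr (1 / (s - 1)) * b = b powr (1 / (s - 1)) * b powr 1" using ab by simp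
        also have "\<dots> = b powr (s / (s - 1))"
          using s unfolding powr_add[symmetric] by (intro arg_cong2[where f="(powr)"]) (auto simp: field_simps)
        finally show ?thesis by simp
      qed simp
      finally show ?thesis by (simp add: add_increasing)
    next
      case False
      then have "\<epsilon> * b powr (1 / (s - 1)) \<le> a" by simp
      then have "b powr (1 / (s - 1)) \<le> a / \<epsilon>" using e by (simp add: field_simps)
      then have "(b powr (1 / (s - 1))) powr (s - 1) \<le> (a / \<epsilon>) powr (s - 1)"
        using s by (intro powr_mono2) auto
      then have b: "b \<le> (a / \<epsilon>) powr (s - 1)" using s ab by (simp add: powr_powr)
      have "a * b \<le> a * (a / \<epsilon>) powr (s - 1)" using b ab by (intro mult_left_mono)
      also have "\<dots> = \<epsilon> powr (1 - s) * a powr s"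
      proof (cases "a = 0")
        case False
        then have "0 < a" using ab by simp
        then have "a * a powr (s - 1) = a powr s"
          using powr_add[of a 1 "s - 1"] by simp
        moreover have "\<epsilon> powr (1 - s) = 1 / \<epsilon> powr (s - 1)"
          using e powr_minus_divide[of \<epsilon> "s - 1"] by simp
        ultimately show ?thesis using \<open>0 < a\<close> e by (simp add: powr_divide)
      qed simp
      finally show ?thesis using e by (simp add: add_increasing2)
    qed
    then have "ennreal (a * b) \<le> ennreal (\<epsilon> powr (1 - s) * a powr s + \<epsilon> * b powr (s / (s - 1)))"
      by (rule ennreal_leI)
    then show ?thesis using ab e by (simp add: ennreal_mult)
  qed
qed

text \<open>Purely qualitative: \<open>disc_square\<close> is bounded and vanishes outside a finite
  union of balls. It licenses the subtraction in the absorption argument, so its dependence on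
  \<open>J\<close> does no harm.\<close>

lemma disc_square_finite:
  fixes J :: "(int \<times> 'a::euclidean_space) set"
  assumes \<alpha>: "0 < \<alpha>" "\<alpha> \<le> 1" and J: "finite J" "J \<subseteq> grid" and f[measurable]: "\<And>j. f j \<in> borel_measurable borel"
    and s: "1 \<le> s" and fin: "(\<integral>\<^sup>+x. ennreal_powr (sq_sum f x) s \<partial>lborel) < top"
  shows "(\<integral>\<^sup>+x. ennreal_powr (disc_square \<alpha> J f x) s \<partial>lborel) < top"
proof -
  have c: "bump_coeff \<alpha> f i < top" if i: "i \<in> J" for i
  proof -
    have "(\<integral>\<^sup>+z\<in>gball i. sq_sum f z \<partial>lborel) \<le> (\<integral>\<^sup>+z. indicator (gball i) z + ennreal_powr (sq_sum f z) s \<partial>lborel)"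
      using ennreal_le_one_plus_powr[OF s] by (intro nn_integral_mono) (auto simp: indicator_def)
    also have "\<dots> = emeasure lborel (gball i) + (\<integral>\<^sup>+z. ennreal_powr (sq_sum f z) s \<partial>lborel)"
      by (subst nn_integral_add) auto
    also have "\<dots> < top" using fin emeasure_lborel_ball_finite[of "snd i"] by simp
    finally have "ennreal (schur_const TYPE('a) \<alpha>) * (\<integral>\<^sup>+z\<in>gball i. sq_sum f z \<partial>lborel) < top"
      by (simp add: ennreal_mult_less_top)
    \<comment> \<open>The summed L^2 bound, applied to one ball, shows that its coefficient is
      finite.\<close>
    moreover have "(\<Sum>i\<in>{i}. ennreal (rad TYPE('a) (fst i) ^ DIM('a)) * bump_coeff \<alpha> f i)
       \<le> ennreal (schur_const TYPE('a) \<alpha>) * (\<integral>\<^sup>+z\<in>gball i. sq_sum f z \<partial>lborel)"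
      using i J by (intro bump_coeff_L2_on \<alpha> f) auto
    ultimately have "ennreal (rad TYPE('a) (fst i) ^ DIM('a)) * bump_coeff \<alpha> f i < top" by (simp add: le_less_trans)
    moreover have "ennreal (rad TYPE('a) (fst i) ^ DIM('a)) \<noteq> 0"
      by (simp add: ennreal_eq_0_iff not_le)
    ultimately show ?thesis by (auto simp: ennreal_mult_less_top)
  qed
  define U where "U = (\<Union>i\<in>J. gball i)"
  have [measurable]: "U \<in> sets borel" unfolding U_def by (intro borel_open open_UN) auto
  have "emeasure lborel U \<le> (\<Sum>i\<in>J. emeasure lborel (gball i))"
    unfolding U_def using J by (intro emeasure_subadditive_finite) auto
  also have "\<dots> < top" using J emeasure_lborel_ball_finite[where 'a='a] by (simp add: ennreal_sum_less_top)
  finally have U: "emeasure lborel U < top" .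
  define M where "M = (\<Sum>i\<in>J. bump_coeff \<alpha> f i)"
  have M: "M < top" unfolding M_def using J c by (simp add: ennreal_sum_less_top)
  have "(\<integral>\<^sup>+x. ennreal_powr (disc_square \<alpha> J f x) s \<partial>lborel) \<le> (\<integral>\<^sup>+x. ennreal_powr M s * indicator U x \<partial>lborel)"
  proof (rule nn_integral_mono)
    fix x
    show "ennreal_powr (disc_square \<alpha> J f x) s \<le> ennreal_powr M s * indicator U x"
    proof (cases "x \<in> U")
      case True
      have "disc_square \<alpha> J f x \<le> M"
        unfolding disc_square_def M_def by (intro sum_mono) (auto simp: indicator_def)
      then show ?thesis using True s by (simp add: ennreal_powr_mono)
    next
      case False
      then have "disc_square \<alpha> J f x = 0"
        unfolding disc_square_def U_def by (intro sum.neutral) (auto simp: indicator_def)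
      then show ?thesis by simp
    qed
  qed
  also have "\<dots> = ennreal_powr M s * emeasure lborel U"
    by (simp add: nn_integral_cmult_indicator)
  also have "\<dots> < top"
    using M U by (cases M) (auto simp: ennreal_mult_less_top)
  finally show ?thesis .
qed

text \<open>The exponent \<open>s\<close> is p/2, since \<open>disc_square\<close> and
  \<open>sq_sum\<close> are already squares. For s = 1 the conjugate exponent would be infinite, and
  the L^2 bound is used directly.\<close>

lemma disc_square_Lp_ge_2:
  assumes \<alpha>: "0 < \<alpha>" "\<alpha> \<le> 1" and s: "1 \<le> s"
  shows "\<exists>C>0. \<forall>(J :: (int \<times> 'a::euclidean_space) set) f. finite J \<longrightarrow> J \<subseteq> grid \<longrightarrow> (\<forall>j. f j \<in> borel_measurable borel) \<longrightarrow>
    (\<integral>\<^sup>+x. ennreal_powr (disc_square \<alpha> J f x) s \<partial>lborel) \<le> ennreal C * (\<integral>\<^sup>+x. ennreal_powr (sq_sum f x) s \<partial>lborel)"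
proof -
  let ?K = "ball_vol TYPE('a) * schur_const TYPE('a) \<alpha>"
  have K: "0 < ?K" using ball_vol_pos[where 'a='a] schur_const_pos[OF \<alpha>(1), where 'a='a] by simp
  show ?thesis
  proof (cases "s = 1")
    case True
    show ?thesis
    proof (intro exI[of _ ?K] conjI allI impI K)
      fix J :: "(int \<times> 'a) set" and f :: "nat \<Rightarrow> 'a \<Rightarrow> complex"
      assume J: "finite J" "J \<subseteq> grid" and f: "\<forall>j. f j \<in> borel_measurable borel"
      have "(\<integral>\<^sup>+x. disc_square \<alpha> J f x * 1 \<partial>lborel) = (\<Sum>i\<in>J. bump_coeff \<alpha> f i * (\<integral>\<^sup>+x\<in>gball i. 1 \<partial>lborel))"
        by (rule nn_integral_disc_square) measurable
      also have "\<dots> = ennreal (ball_vol TYPE('a)) * (\<Sum>i\<in>J. ennreal (rad TYPE('a) (fst i) ^ DIM('a)) * bump_coeff \<alpha> f i)"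
        using ball_vol_pos[where 'a='a]
        by (simp add: sum_distrib_left emeasure_ball' less_imp_le[OF rad_pos] ennreal_mult mult_ac less_imp_le)
      also have "\<dots> \<le> ennreal (ball_vol TYPE('a)) * (ennreal (schur_const TYPE('a) \<alpha>) * (\<integral>\<^sup>+x. sq_sum f x \<partial>lborel))"
        using J f by (intro mult_left_mono bump_coeff_L2 \<alpha>) auto
      finally show "(\<integral>\<^sup>+x. ennreal_powr (disc_square \<alpha> J f x) s \<partial>lborel) \<le> ennreal ?K * (\<integral>\<^sup>+x. ennreal_powr (sq_sum f x) s \<partial>lborel)"
        using True ball_vol_pos[where 'a='a] schur_const_pos[OF \<alpha>(1), where 'a='a]
        by (simp add: ennreal_mult less_imp_le mult.assoc)
    qed
  next
    case False
    then have s: "1 < s" using s by simp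
    \<comment> \<open>The conjugate exponent, for which the weight \<open>w\<close> below satisfies
      w^q = \<open>disc_square\<close>^s; the maximal theorem then returns a multiple of the
      left-hand side.\<close>
    define q where "q = s / (s - 1)"
    have q: "1 < q" using s by (simp add: q_def field_simps)
    define Q where "Q = q * (2 * 5 ^ DIM('a)) * 2 powr (q - 1) / (q - 1)"
    have Q: "0 < Q" using q by (simp add: Q_def)
    \<comment> \<open>Makes ?K * \<epsilon> * Q equal to 1/2, so that half of the left-hand side is
      absorbed; the factor 2 in \<open>C\<close> pays for it.\<close>
    define \<epsilon> where "\<epsilon> = 1 / (2 * ?K * Q)"
    have \<epsilon>: "0 < \<epsilon>" using K Q by (simp add: \<epsilon>_def)
    define C where "C = 2 * (?K * \<epsilon> powr (1 - s))"
    have C: "0 < C" using K \<epsilon> by (simp add: C_def)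
    show ?thesis
    proof (intro exI[of _ C] conjI allI impI C)
      fix J :: "(int \<times> 'a) set" and f :: "nat \<Rightarrow> 'a \<Rightarrow> complex"
      assume J: "finite J" "J \<subseteq> grid" and f: "\<forall>j. f j \<in> borel_measurable borel"
      have [measurable]: "f j \<in> borel_measurable borel" for j using f by blast
      define I where "I = (\<integral>\<^sup>+x. ennreal_powr (disc_square \<alpha> J f x) s \<partial>lborel)"
      define R where "R = (\<integral>\<^sup>+x. ennreal_powr (sq_sum f x) s \<partial>lborel)"
      define w where "w x = ennreal_powr (disc_square \<alpha> J f x) (s - 1)" for x
      have [measurable]: "w \<in> borel_measurable borel" unfolding w_def by measurable
      show "I \<le> ennreal C * R"
      proof (cases "R = top")
        case True
        then show ?thesis using C by (simp add: ennreal_mult_top)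
      next
        case False
        then have "I < top"
          unfolding I_def R_def using s by (intro disc_square_finite \<alpha> J) (auto simp: less_top)
        have "I = (\<integral>\<^sup>+x. disc_square \<alpha> J f x * w x \<partial>lborel)"
          unfolding I_def w_def
        proof (intro nn_integral_cong)
          fix x
          show "ennreal_powr (disc_square \<alpha> J f x) s = disc_square \<alpha> J f x * ennreal_powr (disc_square \<alpha> J f x) (s - 1)"
            using ennreal_powr_add[of 1 "s - 1" "disc_square \<alpha> J f x"] s by simp
        qed
        also have "\<dots> \<le> ennreal ?K * (\<integral>\<^sup>+z. sq_sum f z * hlmax w z \<partial>lborel)"
          by (rule disc_square_weighted[OF \<alpha> J]) measurable
        also have "(\<integral>\<^sup>+z. sq_sum f z * hlmax w z \<partial>lborel)
           \<le> (\<integral>\<^sup>+z. ennreal (\<epsilon> powr (1 - s)) * ennreal_powr (sq_sum f z) s + ennreal \<epsilon> * ennreal_powr (hlmax w z) q \<partial>lborel)"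
          unfolding q_def by (intro nn_integral_mono ennreal_young s \<epsilon>)
        also have "\<dots> = ennreal (\<epsilon> powr (1 - s)) * R + ennreal \<epsilon> * (\<integral>\<^sup>+z. ennreal_powr (hlmax w z) q \<partial>lborel)"
          unfolding R_def by (subst nn_integral_add) (auto simp: nn_integral_cmult)
        also have "(\<integral>\<^sup>+z. ennreal_powr (hlmax w z) q \<partial>lborel) \<le> ennreal Q * (\<integral>\<^sup>+z. ennreal_powr (w z) q \<partial>lborel)"
          unfolding Q_def by (intro hlmax_strong_type q) measurable
        also have "(\<integral>\<^sup>+z. ennreal_powr (w z) q \<partial>lborel) = I"
          unfolding w_def I_def using s by (simp add: ennreal_powr_powr q_def)
        finally have *: "I \<le> ennreal ?K * (ennreal (\<epsilon> powr (1 - s)) * R + ennreal \<epsilon> * (ennreal Q * I))"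
          by (simp add: mult_left_mono add_left_mono)
        obtain r where r: "R = ennreal r" "0 \<le> r" using False by (cases R) auto
        obtain i where i: "I = ennreal i" "0 \<le> i" using \<open>I < top\<close> by (cases I) auto
        have "i \<le> ?K * (\<epsilon> powr (1 - s) * r + \<epsilon> * (Q * i))"
          using * unfolding r i using r i K \<epsilon> Q
          by (simp add: ennreal_mult[symmetric] ennreal_plus[symmetric] less_imp_le del: ennreal_plus)
        also have "\<dots> = ?K * \<epsilon> powr (1 - s) * r + i / 2"
        proof -
          have "k * (x + 1 / (2 * k * Q) * (Q * i)) = k * x + i / 2" if "0 < k" for k x
            using that Q by (simp add: field_simps)
          from this[OF K] show ?thesis by (simp only: \<epsilon>_def mult.assoc)
        qed
        finally have "i \<le> C * r" by (simp add: C_def)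
        then show ?thesis using r i C by (simp add: ennreal_mult[symmetric] less_imp_le)
      qed
    qed
  qed
qed

subsection \<open>Minkowski's inequality in \<open>\<ell>\<^sup>2\<close>\<close>

lemma ennreal_cauchy_schwarz_sum:
  fixes a b :: "'i \<Rightarrow> ennreal"
  assumes "finite A"
  shows "(\<Sum>j\<in>A. a j * b j) \<le> ennreal_powr (\<Sum>j\<in>A. (a j)\<^sup>2) (1/2) * ennreal_powr (\<Sum>j\<in>A. (b j)\<^sup>2) (1/2)"
proof -
  \<comment> \<open>With an infinite entry the right-hand side is infinite, unless one family
    vanishes identically, and then the left-hand side is 0.\<close>
  have triv: ?thesis if "j \<in> A" "a j = top \<or> b j = top" for j
  proof (cases "(\<Sum>j\<in>A. (a j)\<^sup>2) = 0 \<or> (\<Sum>j\<in>A. (b j)\<^sup>2) = 0")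
    case True
    then have "\<forall>j\<in>A. a j = 0 \<or> b j = 0" using assms by (auto simp: sum_eq_0_iff)
    then have "(\<Sum>j\<in>A. a j * b j) = 0" by (intro sum.neutral) auto
    then show ?thesis by simp
  next
    case False
    have "(a j)\<^sup>2 = top \<or> (b j)\<^sup>2 = top" using that by (auto simp: power2_eq_square)
    then have "(\<Sum>j\<in>A. (a j)\<^sup>2) = top \<or> (\<Sum>j\<in>A. (b j)\<^sup>2) = top"
      using that(1) assms by auto
    moreover have "ennreal_powr x (1/2) \<noteq> 0" if "x \<noteq> 0" for x
    proof
      assume "ennreal_powr x (1/2) = 0"
      then have "(ennreal_powr x (1/2))\<^sup>2 = 0" by simp
      then show False using that by (simp only: ennreal_powr_half_power2)
    qed
    ultimately have "ennreal_powr (\<Sum>j\<in>A. (a j)\<^sup>2) (1/2) * ennreal_powr (\<Sum>j\<in>A. (b j)\<^sup>2) (1/2) = top"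
      using False by (elim disjE) (simp_all only: ennreal_powr_top ennreal_mult_top ennreal_top_mult if_False de_Morgan_disj not_False_eq_True)
    then show ?thesis by simp
  qed
  show ?thesis
  proof (cases "\<exists>j\<in>A. a j = top \<or> b j = top")
    case True
    then show ?thesis using triv by blast
  next
    case False
    then have a: "a j = ennreal (enn2real (a j))" "b j = ennreal (enn2real (b j))" if "j \<in> A" for j
      using that by (auto simp: less_top)
    have sq: "ennreal_powr (\<Sum>j\<in>A. (c j)\<^sup>2) (1/2) = ennreal (L2_set (\<lambda>j. enn2real (c j)) A)"
      if c: "\<And>j. j \<in> A \<Longrightarrow> c j = ennreal (enn2real (c j))" for c :: "'i \<Rightarrow> ennreal"
    proof -
      have "(\<Sum>j\<in>A. (c j)\<^sup>2) = (\<Sum>j\<in>A. ennreal ((enn2real (c j))\<^sup>2))"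
        using c by (intro sum.cong refl) (metis ennreal_power enn2real_nonneg)
      then show ?thesis
        by (simp add: sum_ennreal L2_set_def powr_half_sqrt sum_nonneg)
    qed
    have "(\<Sum>j\<in>A. a j * b j) = (\<Sum>j\<in>A. ennreal (enn2real (a j) * enn2real (b j)))"
      using a by (intro sum.cong refl) (metis ennreal_mult enn2real_nonneg)
    also have "\<dots> = ennreal (\<Sum>j\<in>A. \<bar>enn2real (a j)\<bar> * \<bar>enn2real (b j)\<bar>)"
      by (simp add: sum_ennreal)
    also have "\<dots> \<le> ennreal (L2_set (\<lambda>j. enn2real (a j)) A * L2_set (\<lambda>j. enn2real (b j)) A)"
      by (intro ennreal_leI L2_set_mult_ineq)
    finally show ?thesis using sq[OF a(1)] sq[OF a(2)] by (simp add: ennreal_mult)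
  qed
qed

text \<open>The l^2 norm moves inside the integral. Writing a for the vector of integrals, its
  partial sum of squares X is the integral of the pairing of a with g, at most X^(1/2) times the
  right-hand integral by Cauchy-Schwarz. X is finite because each entry is bounded by that integral,
  so X^(1/2) can be cancelled.\<close>

lemma minkowski_l2:
  fixes g :: "nat \<Rightarrow> 'a \<Rightarrow> ennreal"
  assumes g[measurable]: "\<And>j. g j \<in> borel_measurable M" and k[measurable]: "k \<in> borel_measurable M"
  shows "(\<Sum>j. (\<integral>\<^sup>+x. g j x * k x \<partial>M)\<^sup>2) \<le> (\<integral>\<^sup>+x. ennreal_powr (\<Sum>j. (g j x)\<^sup>2) (1/2) * k x \<partial>M)\<^sup>2"
proof -
  define a where "a j = (\<integral>\<^sup>+x. g j x * k x \<partial>M)" for j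
  define G where "G x = ennreal_powr (\<Sum>j. (g j x)\<^sup>2) (1/2)" for x
  define Y where "Y = (\<integral>\<^sup>+x. G x * k x \<partial>M)"
  have part: "(\<Sum>j<N. (g j x)\<^sup>2) \<le> (\<Sum>j. (g j x)\<^sup>2)" for N x
    by (rule sum_le_suminf) auto
  have aY: "a j \<le> Y" for j
    unfolding a_def Y_def
  proof (intro nn_integral_mono mult_right_mono)
    fix x
    have "(g j x)\<^sup>2 \<le> (\<Sum>j. (g j x)\<^sup>2)"
      using part[of x "Suc j"] by (rule order_trans[rotated]) (simp add: add_increasing)
    then have "ennreal_powr ((g j x)\<^sup>2) (1/2) \<le> G x"
      unfolding G_def by (intro ennreal_powr_mono) auto
    then show "g j x \<le> G x" by (simp add: ennreal_powr_power2)
  qed simp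
  have "(\<Sum>j<N. (a j)\<^sup>2) \<le> Y\<^sup>2" for N
  proof (cases "Y = top")
    case True
    then show ?thesis by (simp add: power_top_ennreal)
  next
    case False
    define X where "X = (\<Sum>j<N. (a j)\<^sup>2)"
    have "a j < top" for j using le_less_trans[OF aY] False by (simp add: less_top)
    then have Xtop: "X < top" unfolding X_def by (simp add: power2_eq_square ennreal_mult_less_top)
    have "X = (\<Sum>j<N. a j * (\<integral>\<^sup>+x. g j x * k x \<partial>M))"
      unfolding X_def a_def by (simp add: power2_eq_square)
    also have "\<dots> = (\<integral>\<^sup>+x. (\<Sum>j<N. a j * (g j x * k x)) \<partial>M)"
      by (subst nn_integral_sum) (auto simp: nn_integral_cmult)
    also have "\<dots> \<le> (\<integral>\<^sup>+x. ennreal_powr X (1/2) * (G x * k x) \<partial>M)"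
    proof (rule nn_integral_mono)
      fix x
      have "(\<Sum>j<N. a j * (g j x * k x)) = (\<Sum>j<N. a j * g j x) * k x"
        by (simp add: sum_distrib_right mult.assoc)
      also have "\<dots> \<le> (ennreal_powr X (1/2) * ennreal_powr (\<Sum>j<N. (g j x)\<^sup>2) (1/2)) * k x"
        unfolding X_def by (intro mult_right_mono ennreal_cauchy_schwarz_sum) auto
      also have "\<dots> \<le> (ennreal_powr X (1/2) * G x) * k x"
        unfolding G_def by (intro mult_right_mono mult_left_mono ennreal_powr_mono part) auto
      finally show "(\<Sum>j<N. a j * (g j x * k x)) \<le> ennreal_powr X (1/2) * (G x * k x)" by (simp add: mult.assoc)
    qed
    also have "\<dots> = ennreal_powr X (1/2) * Y"
      unfolding Y_def G_def by (rule nn_integral_cmult) measurable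
    finally have XY: "X \<le> ennreal_powr X (1/2) * Y" .
    obtain x where x: "X = ennreal x" "0 \<le> x" using Xtop by (cases X) auto
    obtain y where y: "Y = ennreal y" "0 \<le> y" using False by (cases Y) auto
    have "x \<le> sqrt x * y"
      using XY x y by (simp add: ennreal_mult[symmetric] powr_half_sqrt)
    then have *: "sqrt x * sqrt x \<le> sqrt x * y" using x by simp
    have "sqrt x \<le> y"
    proof (cases "x = 0")
      case False
      then have "0 < sqrt x" using x by simp
      then show ?thesis using * by (simp only: mult_le_cancel_left_pos)
    qed (use y in simp)
    then have "(sqrt x)\<^sup>2 \<le> y\<^sup>2" using x by (intro power_mono) auto
    then show ?thesis using x y by (simp add: X_def[symmetric] ennreal_power)
  qed
  then have "(\<Sum>j. (a j)\<^sup>2) \<le> Y\<^sup>2"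
    by (subst suminf_eq_SUP) (intro SUP_least)
  then show ?thesis unfolding a_def Y_def G_def .
qed

subsection \<open>Smoothing on the scale of the distance to the complement\<close>

text \<open>
  \<open>smooth_kernel \<Omega> z\<close> spreads the mass at \<open>z \<in> \<Omega>\<close> uniformly over the ball around \<open>z\<close> whose radius is a quarter
  of the distance to the complement. It is only used for \<open>\<Omega> \<noteq> UNIV\<close>, since \<open>infdist z {} = 0\<close>.
\<close>

definition smooth_kernel :: "'a::euclidean_space set \<Rightarrow> 'a \<Rightarrow> 'a \<Rightarrow> real" where
  "smooth_kernel \<Omega> z w = (if z \<in> \<Omega> \<and> dist z w < infdist z (- \<Omega>) / 4
      then 1 / (ball_vol TYPE('a) * (infdist z (- \<Omega>) / 4) ^ DIM('a)) else 0)"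

text \<open>The kernel has mass 1 in the target variable \<open>w\<close> for each source
  \<open>z\<close> in \<Omega>, with a radius depending on \<open>z\<close>. Transposed onto a bump
  it becomes an average of the bump around \<open>z\<close>, which Hoelder continuity compares with
  the value at \<open>z\<close>. This takes the place of Whitney cubes with mean-zero
  pieces.\<close>

definition smoothed :: "'a::euclidean_space set \<Rightarrow> ('a \<Rightarrow> complex) \<Rightarrow> 'a \<Rightarrow> complex" where
  "smoothed \<Omega> f w = f w * indicator (- \<Omega>) w + (\<integral>z. f z * of_real (smooth_kernel \<Omega> z w) \<partial>lborel)"

lemma infdist_measurable [measurable]: "(\<lambda>z::'a::euclidean_space. infdist z A) \<in> borel_measurable borel"
  by (intro borel_measurable_continuous_onI continuous_on_infdist continuous_on_id)

lemma smooth_kernel_nonneg: "0 \<le> smooth_kernel \<Omega> z (w::'a::euclidean_space)"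
  using ball_vol_pos[where 'a='a] by (simp add: smooth_kernel_def infdist_nonneg less_imp_le)

lemma smooth_kernel_measurable [measurable]:
  assumes [measurable]: "\<Omega> \<in> sets borel"
  shows "(\<lambda>(z, w). smooth_kernel \<Omega> z w) \<in> borel_measurable (borel \<Otimes>\<^sub>M borel :: ('a::euclidean_space \<times> 'a) measure)"
  unfolding smooth_kernel_def by measurable

lemma infdist_pos:
  assumes "open \<Omega>" "- \<Omega> \<noteq> {}" "z \<in> \<Omega>"
  shows "0 < infdist z (- \<Omega>)"
proof -
  have "closed (- \<Omega>)" using assms(1) by (simp add: closed_def)
  then have "infdist z (- \<Omega>) \<noteq> 0"
    using in_closed_iff_infdist_zero[of "- \<Omega>" z] assms by auto
  then show ?thesis using infdist_nonneg[of z "- \<Omega>"] by simp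
qed

text \<open>The distance to the complement is 1-Lipschitz and dist z w is less than a quarter of its
  value at z, so the values at z and w are comparable. The generous factor 2 in the last claim is
  used because the ball around w of twice the distance reaches the complement.\<close>

lemma smooth_kernel_support:
  assumes "open \<Omega>" "- \<Omega> \<noteq> {}" "smooth_kernel \<Omega> z w \<noteq> 0"
  shows "z \<in> \<Omega>" "w \<in> \<Omega>" "infdist w (- \<Omega>) \<le> 5/4 * infdist z (- \<Omega>)" "dist z w < infdist z (- \<Omega>) / 4"
    "dist w z < 2 * infdist w (- \<Omega>)"
proof -
  let ?d = "\<lambda>x. infdist x (- \<Omega>)"
  show z: "z \<in> \<Omega>" and zw: "dist z w < ?d z / 4" using assms(3) by (auto simp: smooth_kernel_def split: if_splits)
  have 1: "?d z \<le> ?d w + dist z w" by (rule infdist_triangle)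
  have 2: "?d w \<le> ?d z + dist w z" by (rule infdist_triangle)
  show "?d w \<le> 5/4 * ?d z" using 2 zw by (simp add: dist_commute)
  have pos: "0 < ?d z" by (rule infdist_pos[OF assms(1,2) z])
  show "dist w z < 2 * ?d w" using 1 zw pos dist_commute[of w z] by linarith
  have "0 < ?d w" using 1 zw pos by linarith
  then show "w \<in> \<Omega>" using infdist_zero[of w "- \<Omega>"] by fastforce
qed

lemma smooth_kernel_mass:
  fixes z :: "'a::euclidean_space"
  assumes \<Omega>: "open \<Omega>" "- \<Omega> \<noteq> {}"
  shows "(\<integral>\<^sup>+w. ennreal (smooth_kernel \<Omega> z w) \<partial>lborel) = indicator \<Omega> z"
proof (cases "z \<in> \<Omega>")
  case True
  let ?r = "infdist z (- \<Omega>) / 4"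
  have r: "0 < ?r" using infdist_pos[OF \<Omega> True] by simp
  have v: "0 < ball_vol TYPE('a) * ?r ^ DIM('a)" using r ball_vol_pos[where 'a='a] by simp
  have "(\<integral>\<^sup>+w. ennreal (smooth_kernel \<Omega> z w) \<partial>lborel)
      = (\<integral>\<^sup>+w. ennreal (1 / (ball_vol TYPE('a) * ?r ^ DIM('a))) * indicator (ball z ?r) w \<partial>lborel)"
    using True by (intro nn_integral_cong) (auto simp: smooth_kernel_def)
  also have "\<dots> = ennreal (1 / (ball_vol TYPE('a) * ?r ^ DIM('a))) * ennreal (ball_vol TYPE('a) * ?r ^ DIM('a))"
    using r by (subst nn_integral_cmult_indicator) (simp_all only: emeasure_ball' less_imp_le ball_borel_measurable sets_lborel)
  also have "\<dots> = 1"
  proof -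
    have "ennreal (1 / V) * ennreal V = 1" if "0 < V" for V
      using that by (simp add: ennreal_mult[symmetric])
    from this[OF v] show ?thesis .
  qed
  finally show ?thesis using True by simp
qed (simp add: smooth_kernel_def)

text \<open>With d the distance from w to the complement, the kernel is at most (5/d)^n divided by
  the unit volume, and it lives in the ball of radius 2d around w. That ball contains a nearest
  point of the complement, where the maximal function is at most \<open>l\<close>. The product of
  5/d and 2d is the 10 in the bound.\<close>

lemma smooth_kernel_average:
  fixes w :: "'a::euclidean_space"
  assumes [measurable]: "G \<in> borel_measurable borel" and \<Omega>_def: "\<Omega> = {x. ennreal l < hlmax G x}" and ne: "- \<Omega> \<noteq> {}"
    and l: "0 \<le> l"
  shows "(\<integral>\<^sup>+z. G z * ennreal (smooth_kernel \<Omega> z w) \<partial>lborel) \<le> ennreal (10 ^ DIM('a) * l)"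
proof (cases "w \<in> \<Omega>")
  case True
  have \<Omega>: "open \<Omega>" unfolding \<Omega>_def by (rule open_hlmax)
  let ?o = "ball_vol TYPE('a)" and ?n = "DIM('a)"
  define d where "d = infdist w (- \<Omega>)"
  have d: "0 < d" unfolding d_def by (rule infdist_pos[OF \<Omega> ne True])
  have o: "0 < ?o" by (rule ball_vol_pos)
  obtain x where x: "x \<in> - \<Omega>" "d = dist w x"
    using infdist_attains_inf[of "- \<Omega>" w] \<Omega> ne unfolding d_def closed_def by auto
  have "(\<integral>\<^sup>+z. G z * ennreal (smooth_kernel \<Omega> z w) \<partial>lborel)
     \<le> (\<integral>\<^sup>+z. ennreal ((5 / d) ^ ?n / ?o) * (G z * indicator (ball w (2 * d)) z) \<partial>lborel)"
  proof (rule nn_integral_mono)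
    fix z
    show "G z * ennreal (smooth_kernel \<Omega> z w) \<le> ennreal ((5 / d) ^ ?n / ?o) * (G z * indicator (ball w (2 * d)) z)"
    proof (cases "smooth_kernel \<Omega> z w = 0")
      case False
      note sup = smooth_kernel_support[OF \<Omega> ne False]
      have dz: "0 < infdist z (- \<Omega>)" by (rule infdist_pos[OF \<Omega> ne sup(1)])
      have "smooth_kernel \<Omega> z w = (4 / infdist z (- \<Omega>)) ^ ?n / ?o"
        using sup by (simp add: smooth_kernel_def power_divide)
      also have "\<dots> \<le> (5 / d) ^ ?n / ?o"
        using sup(3) d dz o unfolding d_def
        by (intro divide_right_mono power_mono) (auto simp: field_simps)
      finally have "ennreal (smooth_kernel \<Omega> z w) \<le> ennreal ((5 / d) ^ ?n / ?o)" by (rule ennreal_leI)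
      then show ?thesis using sup(5) by (simp add: d_def mult.commute mult_left_mono)
    qed simp
  qed
  also have "\<dots> = ennreal ((5 / d) ^ ?n / ?o) * (\<integral>\<^sup>+z\<in>ball w (2 * d). G z \<partial>lborel)"
    by (rule nn_integral_cmult) measurable
  also have "(\<integral>\<^sup>+z\<in>ball w (2 * d). G z \<partial>lborel) \<le> ennreal (?o * (2 * d) ^ ?n) * hlmax G x"
    using x d by (intro ball_integral_le_hlmax) auto
  also have "hlmax G x \<le> ennreal l" using x(1) by (simp add: \<Omega>_def)
  finally have "(\<integral>\<^sup>+z. G z * ennreal (smooth_kernel \<Omega> z w) \<partial>lborel)
     \<le> ennreal ((5 / d) ^ ?n / ?o) * (ennreal (?o * (2 * d) ^ ?n) * ennreal l)"
    by (simp add: mult_left_mono)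
  also have "\<dots> = ennreal ((5 / d) ^ ?n / ?o * (?o * (2 * d) ^ ?n * l))"
  proof -
    have "ennreal a * (ennreal b * ennreal c) = ennreal (a * (b * c))" if "0 \<le> a" "0 \<le> b" "0 \<le> c" for a b c
      using that by (simp add: ennreal_mult)
    then show ?thesis using d o l by (simp only: divide_nonneg_nonneg mult_nonneg_nonneg zero_le_power less_imp_le zero_le_numeral)
  qed
  also have "(5 / d) ^ ?n / ?o * (?o * (2 * d) ^ ?n * l) = (5 / d) ^ ?n * (2 * d) ^ ?n * l"
    using less_imp_neq[OF o] by simp
  also have "(5 / d) ^ ?n * (2 * d) ^ ?n = ((5 / d) * (2 * d)) ^ ?n"
    by (rule power_mult_distrib[symmetric])
  also have "(5 / d) * (2 * d) = 10" using d by simp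
  finally show ?thesis .
next
  case False
  have \<Omega>: "open \<Omega>" unfolding \<Omega>_def by (rule open_hlmax)
  have "smooth_kernel \<Omega> z w = 0" for z using smooth_kernel_support(2)[OF \<Omega> ne] False by blast
  then show ?thesis by simp
qed

text \<open>The kernel has mass 1, so the difference is an average of \<psi> z - \<psi> w over
  points w closer to z than the distance to the complement. The support grows only to radius 2r:
  since the ball leaves \<Omega>, a point z whose kernel reaches it satisfies dist z w < r
  there.\<close>

lemma bump_smoothed_error:
  fixes q :: "'a::euclidean_space"
  assumes \<alpha>: "0 < \<alpha>" "\<alpha> \<le> 1" and r: "0 < r" and \<Omega>: "open \<Omega>" and meets: "\<not> ball q r \<subseteq> \<Omega>" and \<psi>: "bump \<alpha> q r \<psi>"
    and z: "z \<in> \<Omega>"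
  shows "norm (\<psi> z - (\<integral>w. \<psi> w * of_real (smooth_kernel \<Omega> z w) \<partial>lborel))
     \<le> infdist z (- \<Omega>) powr \<alpha> / r powr (real DIM('a) + \<alpha>) * indicator (ball q (2 * r)) z"
proof (cases "z \<in> ball q (2 * r)")
  case True
  have ne: "- \<Omega> \<noteq> {}" using meets by auto
  note [measurable] = bump_measurable[OF \<alpha>(1) \<psi>] borel_open[OF \<Omega>]
  have kint: "(\<integral>\<^sup>+w. ennreal (smooth_kernel \<Omega> z w) \<partial>lborel) = 1"
    using smooth_kernel_mass[OF \<Omega> ne, of z] z by simp
  have ki: "integrable lborel (\<lambda>w. smooth_kernel \<Omega> z w)"
    using kint by (intro integrableI_bounded) (auto simp: abs_of_nonneg[OF smooth_kernel_nonneg])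
  have k1: "(\<integral>w. smooth_kernel \<Omega> z w \<partial>lborel) = 1"
    using kint smooth_kernel_nonneg by (subst integral_eq_nn_integral) auto
  have pi: "integrable lborel (\<lambda>w. \<psi> w * of_real (smooth_kernel \<Omega> z w))"
  proof (rule Bochner_Integration.integrable_bound)
    show "integrable lborel (\<lambda>w. 3 / r ^ DIM('a) * smooth_kernel \<Omega> z w)" using ki by simp
    show "AE w in lborel. norm (\<psi> w * of_real (smooth_kernel \<Omega> z w)) \<le> norm (3 / r ^ DIM('a) * smooth_kernel \<Omega> z w)"
    proof (intro always_eventually allI)
      fix w
      show "norm (\<psi> w * of_real (smooth_kernel \<Omega> z w)) \<le> norm (3 / r ^ DIM('a) * smooth_kernel \<Omega> z w)"
        using mult_right_mono[OF bump_bound[OF \<alpha> r \<psi>] smooth_kernel_nonneg[of \<Omega> z w], of w] smooth_kernel_nonneg[of \<Omega> z w] r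
        by (simp add: norm_mult abs_mult)
    qed
  qed measurable
  have "(\<integral>w. (\<psi> z - \<psi> w) * of_real (smooth_kernel \<Omega> z w) \<partial>lborel)
     = (\<integral>w. \<psi> z * of_real (smooth_kernel \<Omega> z w) - \<psi> w * of_real (smooth_kernel \<Omega> z w) \<partial>lborel)"
    by (simp add: left_diff_distrib)
  also have "\<dots> = \<psi> z * of_real (\<integral>w. smooth_kernel \<Omega> z w \<partial>lborel) - (\<integral>w. \<psi> w * of_real (smooth_kernel \<Omega> z w) \<partial>lborel)"
    using ki pi by (subst Bochner_Integration.integral_diff) auto
  finally have "\<psi> z - (\<integral>w. \<psi> w * of_real (smooth_kernel \<Omega> z w) \<partial>lborel) = (\<integral>w. (\<psi> z - \<psi> w) * of_real (smooth_kernel \<Omega> z w) \<partial>lborel)"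
    using k1 by simp
  then have "ennreal (norm (\<psi> z - (\<integral>w. \<psi> w * of_real (smooth_kernel \<Omega> z w) \<partial>lborel)))
      \<le> (\<integral>\<^sup>+w. ennreal (norm ((\<psi> z - \<psi> w) * of_real (smooth_kernel \<Omega> z w))) \<partial>lborel)"
    using norm_integral_le_nn_integral by metis
  also have "\<dots> \<le> (\<integral>\<^sup>+w. ennreal (infdist z (- \<Omega>) powr \<alpha> / r powr (real DIM('a) + \<alpha>)) * ennreal (smooth_kernel \<Omega> z w) \<partial>lborel)"
  proof (rule nn_integral_mono)
    fix w
    show "ennreal (norm ((\<psi> z - \<psi> w) * of_real (smooth_kernel \<Omega> z w)))
       \<le> ennreal (infdist z (- \<Omega>) powr \<alpha> / r powr (real DIM('a) + \<alpha>)) * ennreal (smooth_kernel \<Omega> z w)"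
    proof (cases "smooth_kernel \<Omega> z w = 0")
      case False
      have "norm (z - w) \<le> infdist z (- \<Omega>)"
        using smooth_kernel_support(4)[OF \<Omega> ne False] infdist_nonneg[of z "- \<Omega>"] by (simp add: dist_norm)
      then have "norm (\<psi> z - \<psi> w) \<le> infdist z (- \<Omega>) powr \<alpha> / r powr (real DIM('a) + \<alpha>)"
        using bump_hoelder[OF \<psi>, of z w] \<alpha>
        by (elim order_trans) (intro divide_right_mono powr_mono2, auto)
      then have "norm (\<psi> z - \<psi> w) * smooth_kernel \<Omega> z w \<le> infdist z (- \<Omega>) powr \<alpha> / r powr (real DIM('a) + \<alpha>) * smooth_kernel \<Omega> z w"
        by (rule mult_right_mono) (rule smooth_kernel_nonneg)
      then show ?thesis
        by (simp add: norm_mult abs_of_nonneg[OF smooth_kernel_nonneg] ennreal_mult'[symmetric] smooth_kernel_nonneg ennreal_leI)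
    qed simp
  qed
  also have "\<dots> = ennreal (infdist z (- \<Omega>) powr \<alpha> / r powr (real DIM('a) + \<alpha>))"
    by (subst nn_integral_cmult) (auto simp: kint)
  finally show ?thesis using True r by (subst (asm) ennreal_le_iff) auto
next
  case False
  have ne: "- \<Omega> \<noteq> {}" using meets by auto
  obtain x where x: "x \<in> ball q r" "x \<in> - \<Omega>" using meets by blast
  have eq: "\<psi> w * of_real (smooth_kernel \<Omega> z w) = 0" for w
  proof (rule ccontr)
    assume "\<psi> w * of_real (smooth_kernel \<Omega> z w) \<noteq> 0"
    then have w: "\<psi> w \<noteq> 0" "smooth_kernel \<Omega> z w \<noteq> 0" by auto
    then have qw: "dist q w < r" using bump_outside[OF \<psi>, of w] by auto
    have zw: "dist z w < infdist z (- \<Omega>) / 4" by (rule smooth_kernel_support(4)[OF \<Omega> ne w(2)])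
    have "infdist z (- \<Omega>) \<le> dist z x" using x(2) by (rule infdist_le)
    also have "\<dots> \<le> dist z w + dist q w + dist q x"
      using dist_triangle[of z x w] dist_triangle[of w x q] by (simp add: dist_commute)
    finally have "infdist z (- \<Omega>) < infdist z (- \<Omega>) / 4 + 2 * r" using zw qw x(1) by simp
    then have "dist z w < r" using zw r by simp
    then have "dist q z < 2 * r" using qw dist_triangle[of q z w] by (simp add: dist_commute)
    then show False using False by simp
  qed
  have "\<psi> z = 0"
    using False r by (intro bump_outside[OF \<psi>]) auto
  then show ?thesis using False by (simp only: eq) simp
qed

lemma diff_add_cancel_middle: "(a + b) - (b + c) = a - (c :: 'a::ab_group_add)"
  by simp

text \<open>Fubini moves the smoothing from f to the bump. Outside \<Omega> nothing has changed, and
  inside \<Omega> the bump is replaced by its difference from its average, which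
  \<open>bump_smoothed_error\<close> bounds.\<close>

lemma bump_sup_smoothed:
  fixes q :: "'a::euclidean_space"
  assumes \<alpha>: "0 < \<alpha>" "\<alpha> \<le> 1" and r: "0 < r" and \<Omega>: "open \<Omega>" and meets: "\<not> ball q r \<subseteq> \<Omega>"
    and f[measurable]: "f \<in> borel_measurable borel"
    and fin: "integrable lborel (\<lambda>z. f z * indicator \<Omega> z)" "integrable lborel (\<lambda>z. f z * indicator (ball q r - \<Omega>) z)"
  shows "bump_sup \<alpha> f q r \<le> bump_sup \<alpha> (smoothed \<Omega> f) q r +
     (\<integral>\<^sup>+z. ennreal (norm (f z)) * (ennreal (infdist z (- \<Omega>) powr \<alpha> / r powr (real DIM('a) + \<alpha>)) * indicator (\<Omega> \<inter> ball q (2 * r)) z) \<partial>lborel)"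
    (is "_ \<le> _ + ?E")
  unfolding bump_sup_def[of \<alpha> f]
proof (rule SUP_least)
  fix \<psi> assume "\<psi> \<in> Collect (bump \<alpha> q r)"
  then have \<psi>: "bump \<alpha> q r \<psi>" by simp
  have ne: "- \<Omega> \<noteq> {}" using meets by auto
  note [measurable] = bump_measurable[OF \<alpha>(1) \<psi>] borel_open[OF \<Omega>]
  let ?k = "\<lambda>z w. complex_of_real (smooth_kernel \<Omega> z w)"
  let ?v = "\<lambda>w. \<integral>z. f z * ?k z w \<partial>lborel"
  let ?a = "\<lambda>z. \<integral>w. \<psi> w * ?k z w \<partial>lborel"
  have bd: "norm (\<psi> z) \<le> 3 / r ^ DIM('a)" for z by (rule bump_bound[OF \<alpha> r \<psi>])
  have nc: "norm (complex_of_real (3 / r ^ DIM('a))) = 3 / r ^ DIM('a)" using r by (simp add: norm_divide norm_power)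
  have i1: "integrable lborel (\<lambda>z. \<psi> z * (f z * indicator \<Omega> z))"
  proof (rule Bochner_Integration.integrable_bound[OF integrable_mult_right[OF fin(1), of "of_real (3 / r ^ DIM('a))"]])
    show "AE z in lborel. norm (\<psi> z * (f z * indicator \<Omega> z)) \<le> norm (of_real (3 / r ^ DIM('a)) * (f z * indicator \<Omega> z))"
      unfolding norm_mult[of "of_real _"] norm_mult[of "\<psi> _"] nc by (intro always_eventually allI mult_right_mono bd) simp
  qed measurable
  have i2: "integrable lborel (\<lambda>z. \<psi> z * (f z * indicator (- \<Omega>) z))"
  proof (rule Bochner_Integration.integrable_bound[OF integrable_mult_right[OF fin(2), of "of_real (3 / r ^ DIM('a))"]])
    show "AE z in lborel. norm (\<psi> z * (f z * indicator (- \<Omega>) z)) \<le> norm (of_real (3 / r ^ DIM('a)) * (f z * indicator (ball q r - \<Omega>) z))"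
    proof (intro always_eventually allI)
      fix z
      show "norm (\<psi> z * (f z * indicator (- \<Omega>) z)) \<le> norm (of_real (3 / r ^ DIM('a)) * (f z * indicator (ball q r - \<Omega>) z))"
      proof (cases "z \<in> ball q r")
        case True
        then have "indicator (ball q r - \<Omega>) z = (indicator (- \<Omega>) z :: complex)" by (auto simp: indicator_def)
        then show ?thesis unfolding norm_mult[of "of_real _"] norm_mult[of "\<psi> _"] nc
            by (simp only:) (intro mult_right_mono bd norm_ge_zero)
      next
        case False
        then show ?thesis using bump_outside[OF \<psi> False] by simp
      qed
    qed
  qed measurable
  \<comment> \<open>Absolute convergence: \<psi> is bounded, the kernel has unit mass in
    \<open>w\<close>, and f is integrable on \<Omega>.\<close>
  have pair: "integrable (lborel \<Otimes>\<^sub>M lborel) (\<lambda>(z, w). \<psi> w * (f z * ?k z w))"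
  proof (rule integrableI_bounded)
    have "(\<integral>\<^sup>+x. ennreal (norm (case x of (z, w) \<Rightarrow> \<psi> w * (f z * ?k z w))) \<partial>(lborel \<Otimes>\<^sub>M lborel))
       = (\<integral>\<^sup>+z. \<integral>\<^sup>+w. ennreal (norm (\<psi> w * (f z * ?k z w))) \<partial>lborel \<partial>lborel)"
      by (subst lborel.nn_integral_fst[symmetric]) auto
    also have "\<dots> \<le> (\<integral>\<^sup>+z. \<integral>\<^sup>+w. ennreal (3 / r ^ DIM('a)) * ennreal (norm (f z)) * ennreal (smooth_kernel \<Omega> z w) \<partial>lborel \<partial>lborel)"
    proof (intro nn_integral_mono)
      fix z w
      have "norm (\<psi> w * (f z * ?k z w)) = norm (\<psi> w) * (norm (f z) * smooth_kernel \<Omega> z w)"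
        by (simp add: norm_mult abs_of_nonneg[OF smooth_kernel_nonneg])
      also have "\<dots> \<le> 3 / r ^ DIM('a) * (norm (f z) * smooth_kernel \<Omega> z w)"
        by (intro mult_right_mono bd mult_nonneg_nonneg smooth_kernel_nonneg) simp
      finally have "ennreal (norm (\<psi> w * (f z * ?k z w))) \<le> ennreal (3 / r ^ DIM('a) * (norm (f z) * smooth_kernel \<Omega> z w))"
        by (rule ennreal_leI)
      also have "\<dots> = ennreal (3 / r ^ DIM('a)) * ennreal (norm (f z)) * ennreal (smooth_kernel \<Omega> z w)"
        using r smooth_kernel_nonneg[of \<Omega> z w] by (subst ennreal_mult) (auto simp: ennreal_mult mult.assoc)
      finally show "ennreal (norm (\<psi> w * (f z * ?k z w))) \<le> ennreal (3 / r ^ DIM('a)) * ennreal (norm (f z)) * ennreal (smooth_kernel \<Omega> z w)" .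
    qed
    also have "\<dots> = (\<integral>\<^sup>+z. ennreal (3 / r ^ DIM('a)) * (ennreal (norm (f z)) * indicator \<Omega> z) \<partial>lborel)"
      by (subst nn_integral_cmult) (auto simp: smooth_kernel_mass[OF \<Omega> ne] mult.assoc)
    also have "\<dots> = ennreal (3 / r ^ DIM('a)) * (\<integral>\<^sup>+z. ennreal (norm (f z * indicator \<Omega> z)) \<partial>lborel)"
      by (subst nn_integral_cmult) (auto simp: norm_mult indicator_def intro!: arg_cong2[where f="(*)"] nn_integral_cong)
    also have "\<dots> < \<infinity>"
      using fin(1) by (auto simp: integrable_iff_bounded ennreal_mult_less_top)
    finally show "(\<integral>\<^sup>+x. ennreal (norm (case x of (z, w) \<Rightarrow> \<psi> w * (f z * ?k z w))) \<partial>(lborel \<Otimes>\<^sub>M lborel)) < \<infinity>" .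
  qed measurable
  have fub: "(\<integral>w. \<psi> w * ?v w \<partial>lborel) = (\<integral>z. f z * ?a z \<partial>lborel)"
  proof -
    have "(\<integral>w. (\<integral>z. \<psi> w * (f z * ?k z w) \<partial>lborel) \<partial>lborel) = (\<integral>z. (\<integral>w. \<psi> w * (f z * ?k z w) \<partial>lborel) \<partial>lborel)"
      by (rule lborel_pair.Fubini_integral[OF pair])
    moreover have "(\<integral>w. \<psi> w * (f z * ?k z w) \<partial>lborel) = f z * ?a z" for z
      by (simp add: mult.left_commute[of _ "f z"])
    ultimately show ?thesis by simp
  qed
  have iv: "integrable lborel (\<lambda>w. \<psi> w * ?v w)"
    using lborel_pair.integrable_snd[OF pair] by simp
  have ia: "integrable lborel (\<lambda>z. f z * ?a z)"
  proof -
    have "(\<integral>w. \<psi> w * (f z * ?k z w) \<partial>lborel) = f z * ?a z" for z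
      by (simp add: mult.left_commute[of _ "f z"])
    then show ?thesis using lborel_pair.integrable_fst[OF pair] by simp
  qed
  have a0: "?a z = 0" if "z \<notin> \<Omega>" for z using that by (simp add: smooth_kernel_def)
  have "(\<integral>z. \<psi> z * f z \<partial>lborel) = (\<integral>z. \<psi> z * (f z * indicator \<Omega> z) + \<psi> z * (f z * indicator (- \<Omega>) z) \<partial>lborel)"
    by (intro Bochner_Integration.integral_cong) (auto simp: indicator_def)
  also have "\<dots> = (\<integral>z. \<psi> z * (f z * indicator \<Omega> z) \<partial>lborel) + (\<integral>z. \<psi> z * (f z * indicator (- \<Omega>) z) \<partial>lborel)"
    using i1 i2 by simp
  finally have A: "(\<integral>z. \<psi> z * f z \<partial>lborel) = (\<integral>z. \<psi> z * (f z * indicator \<Omega> z) \<partial>lborel) + (\<integral>z. \<psi> z * (f z * indicator (- \<Omega>) z) \<partial>lborel)" .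
  have "(\<integral>z. \<psi> z * smoothed \<Omega> f z \<partial>lborel) = (\<integral>z. \<psi> z * (f z * indicator (- \<Omega>) z) + \<psi> z * ?v z \<partial>lborel)"
    by (simp add: smoothed_def distrib_left)
  also have "\<dots> = (\<integral>z. \<psi> z * (f z * indicator (- \<Omega>) z) \<partial>lborel) + (\<integral>z. f z * ?a z \<partial>lborel)"
    unfolding fub[symmetric] by (rule Bochner_Integration.integral_add[OF i2 iv])
  finally have B: "(\<integral>z. \<psi> z * smoothed \<Omega> f z \<partial>lborel) = (\<integral>z. \<psi> z * (f z * indicator (- \<Omega>) z) \<partial>lborel) + (\<integral>z. f z * ?a z \<partial>lborel)" .
  have D: "(\<integral>z. \<psi> z * f z \<partial>lborel) - (\<integral>z. \<psi> z * smoothed \<Omega> f z \<partial>lborel)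
      = (\<integral>z. \<psi> z * (f z * indicator \<Omega> z) - f z * ?a z \<partial>lborel)"
    unfolding A B Bochner_Integration.integral_diff[OF i1 ia] by (rule diff_add_cancel_middle)
  have "ennreal (norm ((\<integral>z. \<psi> z * f z \<partial>lborel) - (\<integral>z. \<psi> z * smoothed \<Omega> f z \<partial>lborel)))
     \<le> (\<integral>\<^sup>+z. ennreal (norm (\<psi> z * (f z * indicator \<Omega> z) - f z * ?a z)) \<partial>lborel)"
    unfolding D by (rule norm_integral_le_nn_integral)
  also have "\<dots> \<le> ?E"
  proof (rule nn_integral_mono)
    fix z
    show "ennreal (norm (\<psi> z * (f z * indicator \<Omega> z) - f z * ?a z))
      \<le> ennreal (norm (f z)) * (ennreal (infdist z (- \<Omega>) powr \<alpha> / r powr (real DIM('a) + \<alpha>)) * indicator (\<Omega> \<inter> ball q (2 * r)) z)"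
    proof (cases "z \<in> \<Omega>")
      case True
      have "norm (\<psi> z * (f z * indicator \<Omega> z) - f z * ?a z) = norm (f z) * norm (\<psi> z - ?a z)"
        using True by (simp add: norm_mult[symmetric] right_diff_distrib mult.commute)
      also have "\<dots> \<le> norm (f z) * (infdist z (- \<Omega>) powr \<alpha> / r powr (real DIM('a) + \<alpha>) * indicator (ball q (2 * r)) z)"
        by (intro mult_left_mono bump_smoothed_error[OF \<alpha> r \<Omega> meets \<psi> True]) auto
      finally have "ennreal (norm (\<psi> z * (f z * indicator \<Omega> z) - f z * ?a z)) \<le>
         ennreal (norm (f z) * (infdist z (- \<Omega>) powr \<alpha> / r powr (real DIM('a) + \<alpha>) * indicator (ball q (2 * r)) z))"
        by (rule ennreal_leI)
      also have "\<dots> = ennreal (norm (f z)) * (ennreal (infdist z (- \<Omega>) powr \<alpha> / r powr (real DIM('a) + \<alpha>)) * indicator (\<Omega> \<inter> ball q (2 * r)) z)"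
        using True by (cases "z \<in> ball q (2 * r)") (auto simp: ennreal_mult[symmetric])
      finally show ?thesis .
    next
      case False
      then show ?thesis using a0[OF False] by simp
    qed
  qed
  finally have err: "ennreal (norm ((\<integral>z. \<psi> z * f z \<partial>lborel) - (\<integral>z. \<psi> z * smoothed \<Omega> f z \<partial>lborel))) \<le> ?E" .
  have "norm (\<integral>z. \<psi> z * f z \<partial>lborel) \<le> norm (\<integral>z. \<psi> z * smoothed \<Omega> f z \<partial>lborel)
      + norm ((\<integral>z. \<psi> z * f z \<partial>lborel) - (\<integral>z. \<psi> z * smoothed \<Omega> f z \<partial>lborel))"
    by (rule norm_triangle_sub)
  then have "ennreal (norm (\<integral>z. \<psi> z * f z \<partial>lborel)) \<le> ennreal (norm (\<integral>z. \<psi> z * smoothed \<Omega> f z \<partial>lborel))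
      + ennreal (norm ((\<integral>z. \<psi> z * f z \<partial>lborel) - (\<integral>z. \<psi> z * smoothed \<Omega> f z \<partial>lborel)))"
    by (simp add: ennreal_plus[symmetric] del: ennreal_plus)
  also have "ennreal (norm (\<integral>z. \<psi> z * smoothed \<Omega> f z \<partial>lborel)) \<le> bump_sup \<alpha> (smoothed \<Omega> f) q r"
    unfolding bump_sup_def using \<psi> by (intro SUP_upper) auto
  finally show "ennreal (norm (\<integral>z. \<psi> z * f z \<partial>lborel)) \<le> bump_sup \<alpha> (smoothed \<Omega> f) q r + ?E"
    using err by (meson add_mono order_refl order_trans)
qed

subsection \<open>The case \<open>1 < p < 2\<close>\<close>

lemma ennreal_norm_le_sq_sum: "ennreal (norm (f j x)) \<le> ennreal_powr (sq_sum f x) (1/2)"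
proof -
  have "(ennreal (norm (f j x)))\<^sup>2 \<le> (\<Sum>i<Suc j. (ennreal (norm (f i x)))\<^sup>2)"
    by (simp add: add_increasing)
  also have "\<dots> \<le> sq_sum f x"
    unfolding sq_sum_def by (rule sum_le_suminf) auto
  finally have "ennreal_powr ((ennreal (norm (f j x)))\<^sup>2) (1/2) \<le> ennreal_powr (sq_sum f x) (1/2)"
    by (intro ennreal_powr_mono) auto
  then show ?thesis by (subst (asm) ennreal_powr_power2) auto
qed

text \<open>At each scale boundedly many of these balls reach z, and the terms decay geometrically
  as the scale grows; the condition relating d to the radius cuts off the small scales. It serves
  for the smoothing error, with d the distance to the complement, and again for the tail in the
  Morrey estimate, with d the radius of the given ball.\<close>

lemma grid_distance_sum:
  fixes J :: "(int \<times> 'a::euclidean_space) set"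
  assumes \<beta>: "0 < \<beta>" and J: "finite J" "J \<subseteq> grid" and d: "0 < d"
  shows "(\<Sum>i\<in>J. if z \<in> ball (snd i) (2 * rad TYPE('a) (fst i)) \<and> d \<le> 3 * rad TYPE('a) (fst i)
      then (d / rad TYPE('a) (fst i)) powr \<beta> else 0) \<le> (4 * (real DIM('a) + 1) + 1) ^ DIM('a) * (3 powr \<beta> * geo \<beta>)"
proof -
  let ?r = "rad TYPE('a)" and ?n = "real DIM('a) + 1"
  define u where "u k = (if d \<le> 3 * ?r k then (d / ?r k) powr \<beta> else 0)" for k
  \<comment> \<open>Translates the condition \<open>d \<le> 3 * ?r k\<close> into
    \<open>a \<le> mesh k\<close>.\<close>
  define a where "a = d / (3 * ?n)"
  have n: "0 < ?n" by (simp add: add_nonneg_pos)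
  have a: "0 < a" using d n by (simp add: a_def)
  have cond: "d \<le> 3 * ?r k \<longleftrightarrow> a \<le> mesh k" for k
    using n by (simp add: a_def rad_def pos_divide_le_eq mult_ac)
  have "(\<Sum>i\<in>J. if z \<in> ball (snd i) (2 * ?r (fst i)) \<and> d \<le> 3 * ?r (fst i) then (d / ?r (fst i)) powr \<beta> else 0)
     = (\<Sum>i\<in>J. if snd i \<in> ball z (2 * ?r (fst i)) then u (fst i) else 0)"
    by (intro sum.cong refl) (auto simp: u_def dist_commute)
  also have "\<dots> \<le> (\<Sum>k\<in>fst ` J. (2 * (2 * ?r k) / mesh k + 1) ^ DIM('a) * u k)"
    by (rule grid_sum_le[OF J]) (auto simp: u_def)
  also have "\<dots> = (4 * ?n + 1) ^ DIM('a) * (\<Sum>k\<in>fst ` J. u k)"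
  proof -
    have "2 * (2 * ?r k) / mesh k = 4 * ?n" for k
      using less_imp_neq[OF mesh_pos[of k]] by (simp add: rad_def)
    then show ?thesis by (simp only: sum_distrib_left)
  qed
  also have "(\<Sum>k\<in>fst ` J. u k) = (\<Sum>k\<in>{k\<in>fst ` J. a \<le> mesh k}. (d / ?r k) powr \<beta>)"
    using J by (intro sum.mono_neutral_cong_right) (auto simp: u_def cond)
  also have "\<dots> \<le> (\<Sum>k\<in>{k\<in>fst ` J. a \<le> mesh k}. 3 powr \<beta> * (a / mesh k) powr \<beta>)"
  proof (rule sum_mono)
    fix k
    have "d / ?r k = 3 * (a / mesh k)"
    proof -
      have "d / (N * m) = 3 * (d / (3 * N) / m)" if "0 < N" for N m :: real
        using that by simp
      from this[OF n] show ?thesis by (simp only: a_def rad_def)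
    qed
    then show "(d / ?r k) powr \<beta> \<le> 3 powr \<beta> * (a / mesh k) powr \<beta>"
      using powr_mult[of 3 "a / mesh k" \<beta>] a by (simp add: less_imp_le)
  qed
  also have "\<dots> = 3 powr \<beta> * (\<Sum>k\<in>{k\<in>fst ` J. a \<le> mesh k}. (a / mesh k) powr \<beta>)"
    by (simp add: sum_distrib_left)
  also have "\<dots> \<le> 3 powr \<beta> * geo \<beta>"
    unfolding geo_def using J \<beta> a by (intro mult_left_mono geometric_mesh_above) auto
  finally show ?thesis by (simp add: mult_left_mono)
qed

lemma ennreal_sum_power2_le: "(a + b)\<^sup>2 \<le> 2 * a\<^sup>2 + 2 * (b\<^sup>2 :: ennreal)"
proof (cases "a = top \<or> b = top")
  case True
  then show ?thesis by (auto simp: power2_eq_square ennreal_mult_top)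
next
  case False
  then obtain x y where xy: "a = ennreal x" "b = ennreal y" "0 \<le> x" "0 \<le> y" by (cases a; cases b) auto
  have "(x + y)\<^sup>2 \<le> 2 * x\<^sup>2 + 2 * y\<^sup>2"
    using sum_squares_bound[of x y] by (simp add: power2_sum)
  then have "ennreal ((x + y)\<^sup>2) \<le> ennreal (2 * x\<^sup>2 + 2 * y\<^sup>2)" by (rule ennreal_leI)
  then show ?thesis using xy by (simp add: ennreal_power[symmetric] ennreal_mult)
qed

text \<open>Both factors 2 come from squaring a sum. The first summand is the L^2 constant times the
  bound 10^n for the smoothed function; the second is the pointwise bound for the error, 3 times the
  volume of the doubled unit ball, times the constant of \<open>grid_distance_sum\<close>.\<close>

definition sawtooth_const :: "'a::euclidean_space itself \<Rightarrow> real \<Rightarrow> real" where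
  "sawtooth_const _ \<alpha> = 2 * schur_const TYPE('a) \<alpha> * 10 ^ DIM('a)
     + 2 * (3 * (ball_vol TYPE('a) * 2 ^ DIM('a)) * ((4 * (real DIM('a) + 1) + 1) ^ DIM('a) * (3 powr \<alpha> * geo \<alpha>)))"

lemma sawtooth_const_pos: "0 < \<alpha> \<Longrightarrow> 0 < sawtooth_const TYPE('a::euclidean_space) \<alpha>"
  using schur_const_pos[where 'a='a, of \<alpha>] ball_vol_pos[where 'a='a] geo_pos[of \<alpha>]
  by (simp add: sawtooth_const_def add_pos_pos)

text \<open>A Calderon--Zygmund decomposition at height \<open>l\<close> in which the good part is \<open>smoothed \<Omega> f\<close>.\<close>

lemma bump_coeff_sawtooth:
  fixes J :: "(int \<times> 'a::euclidean_space) set"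
  assumes \<alpha>: "0 < \<alpha>" "\<alpha> \<le> 1" and J: "finite J" "J \<subseteq> grid" and f[measurable]: "\<And>j. f j \<in> borel_measurable borel"
    and l: "0 < l" and G_def: "G = (\<lambda>x. ennreal_powr (sq_sum f x) (1/2))"
    and \<Omega>_def: "\<Omega> = {x. ennreal l < hlmax G x}" and meets: "\<And>i. i \<in> J \<Longrightarrow> \<not> gball i \<subseteq> \<Omega>"
  shows "(\<Sum>i\<in>J. ennreal (rad TYPE('a) (fst i) ^ DIM('a)) * bump_coeff \<alpha> f i)
    \<le> ennreal (sawtooth_const TYPE('a) \<alpha>) *
       ((\<integral>\<^sup>+x\<in>- \<Omega>. sq_sum f x \<partial>lborel) + ennreal l * (\<integral>\<^sup>+x\<in>\<Omega>. G x \<partial>lborel))" (is "?L \<le> _ * (?A + ennreal l * ?B)")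
\<comment> \<open>A nonempty \<open>J\<close> provides a ball leaving \<Omega>, so the complement is
  nonempty; finiteness of both integrals gives the integrability behind the Fubini step.\<close>
proof (cases "J = {} \<or> ?A = top \<or> ?B = top")
  case True
  then show ?thesis
    using sawtooth_const_pos[OF \<alpha>(1), where 'a='a] l by (auto simp: ennreal_mult_top)
next
  case False
  let ?n = "DIM('a)" and ?r = "rad TYPE('a)" and ?o = "ball_vol TYPE('a)" and ?K = "schur_const TYPE('a) \<alpha>"
  have \<Omega>: "open \<Omega>" unfolding \<Omega>_def by (rule open_hlmax)
  have ne: "- \<Omega> \<noteq> {}" using False meets by fastforce
  have [measurable]: "\<Omega> \<in> sets borel" using \<Omega> by (rule borel_open)
  have [measurable]: "G \<in> borel_measurable borel" unfolding G_def by measurable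
  have o: "0 < ?o" by (rule ball_vol_pos)
  have K: "0 < ?K" by (rule schur_const_pos[OF \<alpha>(1)])
  have G2: "(G x)\<^sup>2 = sq_sum f x" for x by (simp add: G_def)
  have fG: "ennreal (norm (f j x)) \<le> G x" for j x unfolding G_def by (rule ennreal_norm_le_sq_sum)
  let ?s = "\<lambda>j. smoothed \<Omega> (f j)"
  have s[measurable]: "?s j \<in> borel_measurable borel" for j
    unfolding smoothed_def by measurable
  define \<kappa> where "\<kappa> i z = ennreal (infdist z (- \<Omega>) powr \<alpha> / ?r (fst i) powr (real ?n + \<alpha>)) * indicator (\<Omega> \<inter> ball (snd i) (2 * ?r (fst i))) z"
    for i :: "int \<times> 'a" and z
  have [measurable]: "\<kappa> i \<in> borel_measurable borel" for i unfolding \<kappa>_def by measurable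
  define E where "E i j = (\<integral>\<^sup>+z. ennreal (norm (f j z)) * \<kappa> i z \<partial>lborel)" for i j
  \<comment> \<open>By Minkowski's inequality its square dominates the sum over j of the squared
    errors \<open>E i j\<close>.\<close>
  define V where "V i = (\<integral>\<^sup>+z. G z * \<kappa> i z \<partial>lborel)" for i
  have fin1: "integrable lborel (\<lambda>z. f j z * indicator \<Omega> z)" for j
  proof (rule integrableI_bounded)
    have "(\<integral>\<^sup>+x. ennreal (norm (f j x * indicator \<Omega> x)) \<partial>lborel) \<le> ?B"
      using fG by (intro nn_integral_mono) (auto simp: indicator_def)
    also have "\<dots> < \<infinity>" using False by (simp add: less_top)
    finally show "(\<integral>\<^sup>+x. ennreal (norm (f j x * indicator \<Omega> x)) \<partial>lborel) < \<infinity>" .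
  qed measurable
  have fin2: "integrable lborel (\<lambda>z. f j z * indicator (ball q r - \<Omega>) z)" for j q r
  proof (rule integrableI_bounded)
    have "(\<integral>\<^sup>+x. ennreal (norm (f j x * indicator (ball q r - \<Omega>) x)) \<partial>lborel)
       \<le> (\<integral>\<^sup>+x. indicator (ball q r) x + sq_sum f x * indicator (- \<Omega>) x \<partial>lborel)"
    proof (rule nn_integral_mono)
      fix x
      have "ennreal (norm (f j x)) \<le> 1 + ennreal_powr (G x) 2"
        using fG ennreal_le_one_plus_powr[of 2 "G x"] by (meson order_trans one_le_numeral)
      then show "ennreal (norm (f j x * indicator (ball q r - \<Omega>) x)) \<le> indicator (ball q r) x + sq_sum f x * indicator (- \<Omega>) x"
        by (auto simp: indicator_def G2)
    qed
    also have "\<dots> = emeasure lborel (ball q r) + ?A"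
      by (subst nn_integral_add) auto
    also have "\<dots> < \<infinity>" using False emeasure_lborel_ball_finite[of q r] by (simp add: less_top)
    finally show "(\<integral>\<^sup>+x. ennreal (norm (f j x * indicator (ball q r - \<Omega>) x)) \<partial>lborel) < \<infinity>" .
  qed measurable
  have step: "bump_coeff \<alpha> f i \<le> 2 * bump_coeff \<alpha> ?s i + 2 * (V i)\<^sup>2" if i: "i \<in> J" for i
  proof -
    have "bump_coeff \<alpha> f i \<le> (\<Sum>j. 2 * (bump_sup \<alpha> (?s j) (snd i) (?r (fst i)))\<^sup>2 + 2 * (E i j)\<^sup>2)"
      unfolding bump_coeff_def
    proof (intro suminf_le summableI)
      fix j
      have "bump_sup \<alpha> (f j) (snd i) (?r (fst i)) \<le> bump_sup \<alpha> (?s j) (snd i) (?r (fst i)) + E i j"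
        unfolding E_def \<kappa>_def by (intro bump_sup_smoothed \<alpha> rad_pos \<Omega> meets i f fin1 fin2)
      then have "(bump_sup \<alpha> (f j) (snd i) (?r (fst i)))\<^sup>2 \<le> (bump_sup \<alpha> (?s j) (snd i) (?r (fst i)) + E i j)\<^sup>2"
        by (intro power_mono) auto
      also have "\<dots> \<le> 2 * (bump_sup \<alpha> (?s j) (snd i) (?r (fst i)))\<^sup>2 + 2 * (E i j)\<^sup>2"
        by (rule ennreal_sum_power2_le)
      finally show "(bump_sup \<alpha> (f j) (snd i) (?r (fst i)))\<^sup>2 \<le> 2 * (bump_sup \<alpha> (?s j) (snd i) (?r (fst i)))\<^sup>2 + 2 * (E i j)\<^sup>2" .
    qed
    also have "\<dots> = 2 * bump_coeff \<alpha> ?s i + 2 * (\<Sum>j. (E i j)\<^sup>2)"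
      unfolding bump_coeff_def by (simp add: suminf_add[symmetric] ennreal_suminf_cmult)
    also have "(\<Sum>j. (E i j)\<^sup>2) \<le> (V i)\<^sup>2"
      unfolding E_def V_def G_def sq_sum_def by (rule minkowski_l2) measurable
    finally show ?thesis by (simp add: add_left_mono mult_left_mono)
  qed
  \<comment> \<open>Inside \<Omega> the squared l^2 norm is at most N^2; one factor is bounded by
    10^n l, while the other has the integral of \<open>G\<close> over \<Omega> as its total
    mass.\<close>
  have good: "(\<integral>\<^sup>+w. sq_sum ?s w \<partial>lborel) \<le> ?A + ennreal (10 ^ ?n * l) * ?B"
  proof -
    define N where "N w = (\<integral>\<^sup>+z. G z * ennreal (smooth_kernel \<Omega> z w) \<partial>lborel)" for w
    have [measurable]: "N \<in> borel_measurable borel" unfolding N_def by measurable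
    have Nle: "N w \<le> ennreal (10 ^ ?n * l)" for w
      unfolding N_def using l ne by (intro smooth_kernel_average \<Omega>_def) auto
    have "sq_sum ?s w \<le> sq_sum f w * indicator (- \<Omega>) w + ennreal (10 ^ ?n * l) * N w" for w
    proof (cases "w \<in> \<Omega>")
      case True
      have "sq_sum ?s w = (\<Sum>j. (ennreal (norm (\<integral>z. f j z * of_real (smooth_kernel \<Omega> z w) \<partial>lborel)))\<^sup>2)"
        using True by (simp add: sq_sum_def smoothed_def)
      also have "\<dots> \<le> (\<Sum>j. (\<integral>\<^sup>+z. ennreal (norm (f j z)) * ennreal (smooth_kernel \<Omega> z w) \<partial>lborel)\<^sup>2)"
      proof (intro suminf_le summableI power_mono)
        fix j
        have "ennreal (norm (\<integral>z. f j z * of_real (smooth_kernel \<Omega> z w) \<partial>lborel))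
            \<le> (\<integral>\<^sup>+z. ennreal (norm (f j z * of_real (smooth_kernel \<Omega> z w))) \<partial>lborel)"
          by (rule norm_integral_le_nn_integral)
        also have "\<dots> = (\<integral>\<^sup>+z. ennreal (norm (f j z)) * ennreal (smooth_kernel \<Omega> z w) \<partial>lborel)"
          by (simp add: norm_mult abs_of_nonneg[OF smooth_kernel_nonneg] ennreal_mult smooth_kernel_nonneg)
        finally show "ennreal (norm (\<integral>z. f j z * of_real (smooth_kernel \<Omega> z w) \<partial>lborel))
            \<le> (\<integral>\<^sup>+z. ennreal (norm (f j z)) * ennreal (smooth_kernel \<Omega> z w) \<partial>lborel)" .
      qed simp
      also have "\<dots> \<le> (N w)\<^sup>2"
        unfolding N_def G_def sq_sum_def by (rule minkowski_l2) measurable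
      also have "\<dots> \<le> ennreal (10 ^ ?n * l) * N w"
        unfolding power2_eq_square by (intro mult_right_mono Nle) simp
      finally show ?thesis by (simp add: add_increasing)
    next
      case False
      have "smooth_kernel \<Omega> z w = 0" for z using smooth_kernel_support(2)[OF \<Omega> ne] False by blast
      then have "sq_sum ?s w = sq_sum f w * indicator (- \<Omega>) w"
        using False by (simp add: sq_sum_def smoothed_def)
      then show ?thesis by simp
    qed
    then have "(\<integral>\<^sup>+w. sq_sum ?s w \<partial>lborel) \<le> (\<integral>\<^sup>+w. sq_sum f w * indicator (- \<Omega>) w + ennreal (10 ^ ?n * l) * N w \<partial>lborel)"
      by (intro nn_integral_mono)
    also have "\<dots> = ?A + ennreal (10 ^ ?n * l) * (\<integral>\<^sup>+w. N w \<partial>lborel)"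
      by (subst nn_integral_add) (auto simp: nn_integral_cmult)
    also have "(\<integral>\<^sup>+w. N w \<partial>lborel) = (\<integral>\<^sup>+z. (\<integral>\<^sup>+w. G z * ennreal (smooth_kernel \<Omega> z w) \<partial>lborel) \<partial>lborel)"
      unfolding N_def by (rule lborel_pair.Fubini') measurable
    also have "\<dots> = ?B"
      by (subst nn_integral_cmult) (auto simp: smooth_kernel_mass[OF \<Omega> ne])
    finally show ?thesis .
  qed
  have dle: "infdist z (- \<Omega>) \<le> 3 * ?r (fst i)" if i: "i \<in> J" and z: "z \<in> ball (snd i) (2 * ?r (fst i))" for i z
  proof -
    obtain x where x: "x \<in> gball i" "x \<in> - \<Omega>" using meets[OF i] by blast
    have "infdist z (- \<Omega>) \<le> dist z x" using x(2) by (rule infdist_le)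
    also have "\<dots> \<le> dist (snd i) z + dist (snd i) x" by (rule dist_triangle3)
    finally show ?thesis using x z by simp
  qed
  \<comment> \<open>The doubled ball contains a point outside \<Omega>, where averages of
    \<open>G\<close> are at most \<open>l\<close>, and the distance to the complement is at most 3
    radii on it. This bounds one factor of (V i)^2; the other factor is summed in
    \<open>Vsum\<close>.\<close>
  have Vle: "V i \<le> ennreal (3 * (?o * 2 ^ ?n) * l)" if i: "i \<in> J" for i
  proof -
    let ?ri = "?r (fst i)"
    have ri: "0 < ?ri" by simp
    obtain x where x: "x \<in> gball i" "x \<in> - \<Omega>" using meets[OF i] by blast
    have x': "x \<in> ball (snd i) (2 * ?ri)" using x(1) ri unfolding mem_ball by linarith
    have "V i \<le> (\<integral>\<^sup>+z. ennreal (3 / ?ri ^ ?n) * (G z * indicator (ball (snd i) (2 * ?ri)) z) \<partial>lborel)"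
      unfolding V_def
    proof (rule nn_integral_mono)
      fix z
      have "\<kappa> i z \<le> ennreal (3 / ?ri ^ ?n) * indicator (ball (snd i) (2 * ?ri)) z"
      proof (cases "z \<in> ball (snd i) (2 * ?ri)")
        case True
        have "infdist z (- \<Omega>) powr \<alpha> \<le> (3 * ?ri) powr \<alpha>"
          using dle[OF i True] \<alpha> by (intro powr_mono2) (auto simp: infdist_nonneg)
        also have "\<dots> = 3 powr \<alpha> * ?ri powr \<alpha>" using ri by (simp add: powr_mult)
        also have "\<dots> \<le> 3 * ?ri powr \<alpha>"
          using powr_mono[of \<alpha> 1 3] \<alpha> by (intro mult_right_mono) auto
        finally have "infdist z (- \<Omega>) powr \<alpha> / ?ri powr (real ?n + \<alpha>) \<le> 3 * ?ri powr \<alpha> / ?ri powr (real ?n + \<alpha>)"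
          by (rule divide_right_mono) simp
        also have "\<dots> = 3 / ?ri ^ ?n"
          using ri by (simp add: powr_add powr_realpow)
        finally have "ennreal (infdist z (- \<Omega>) powr \<alpha> / ?ri powr (real ?n + \<alpha>)) \<le> ennreal (3 / ?ri ^ ?n)"
          by (rule ennreal_leI)
        then show ?thesis using True by (auto simp: \<kappa>_def indicator_def)
      qed (simp add: \<kappa>_def)
      then show "G z * \<kappa> i z \<le> ennreal (3 / ?ri ^ ?n) * (G z * indicator (ball (snd i) (2 * ?ri)) z)"
        by (simp add: mult.left_commute mult_left_mono)
    qed
    also have "\<dots> = ennreal (3 / ?ri ^ ?n) * (\<integral>\<^sup>+z\<in>ball (snd i) (2 * ?ri). G z \<partial>lborel)"
      by (rule nn_integral_cmult) measurable
    also have "(\<integral>\<^sup>+z\<in>ball (snd i) (2 * ?ri). G z \<partial>lborel) \<le> ennreal (?o * (2 * ?ri) ^ ?n) * hlmax G x"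
      by (rule ball_integral_le_hlmax[OF x'])
    also have "hlmax G x \<le> ennreal l" using x(2) by (simp add: \<Omega>_def)
    finally have "V i \<le> ennreal (3 / ?ri ^ ?n) * (ennreal (?o * (2 * ?ri) ^ ?n) * ennreal l)"
      by (simp add: mult_left_mono)
    also have "\<dots> = ennreal (3 / ?ri ^ ?n * (?o * (2 * ?ri) ^ ?n * l))"
    proof -
      have "ennreal a * (ennreal b * ennreal c) = ennreal (a * (b * c))" if "0 \<le> a" "0 \<le> b" "0 \<le> c" for a b c
        using that by (simp add: ennreal_mult)
      then show ?thesis using o l ri by (simp only: divide_nonneg_nonneg mult_nonneg_nonneg zero_le_power less_imp_le zero_le_numeral)
    qed
    also have "3 / ?ri ^ ?n * (?o * (2 * ?ri) ^ ?n * l) = 3 * (?o * 2 ^ ?n) * l"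
      using ri by (simp add: power_mult_distrib less_imp_neq[OF ri, symmetric])
    finally show ?thesis .
  qed
  define H where "H = (4 * (real ?n + 1) + 1) ^ ?n * (3 powr \<alpha> * geo \<alpha>)"
  have H: "0 < H" using geo_pos[OF \<alpha>(1)] by (simp add: H_def add_nonneg_pos)
  \<comment> \<open>For fixed z in \<Omega> the weight r^n turns the error kernel into (distance /
    radius)^\<alpha>, which is summable over the balls that reach z and leave \<Omega>.\<close>
  have Vsum: "(\<Sum>i\<in>J. ennreal (?r (fst i) ^ ?n) * V i) \<le> ennreal H * ?B"
  proof -
    have "(\<Sum>i\<in>J. ennreal (?r (fst i) ^ ?n) * V i) = (\<integral>\<^sup>+z. (\<Sum>i\<in>J. ennreal (?r (fst i) ^ ?n) * (G z * \<kappa> i z)) \<partial>lborel)"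
      unfolding V_def by (subst nn_integral_sum) (auto simp: nn_integral_cmult)
    also have "\<dots> \<le> (\<integral>\<^sup>+z. ennreal H * (G z * indicator \<Omega> z) \<partial>lborel)"
    proof (rule nn_integral_mono)
      fix z
      show "(\<Sum>i\<in>J. ennreal (?r (fst i) ^ ?n) * (G z * \<kappa> i z)) \<le> ennreal H * (G z * indicator \<Omega> z)"
      proof (cases "z \<in> \<Omega>")
        case True
        let ?d = "infdist z (- \<Omega>)"
        have d: "0 < ?d" by (rule infdist_pos[OF \<Omega> ne True])
        define t where "t i = (if z \<in> ball (snd i) (2 * ?r (fst i)) \<and> ?d \<le> 3 * ?r (fst i) then (?d / ?r (fst i)) powr \<alpha> else 0)"
          for i :: "int \<times> 'a"
        have "ennreal (?r (fst i) ^ ?n) * \<kappa> i z = ennreal (t i)" if i: "i \<in> J" for i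
        proof (cases "z \<in> ball (snd i) (2 * ?r (fst i))")
          case zb: True
          have ri: "0 < ?r (fst i)" by simp
          have "?r (fst i) ^ ?n * (?d powr \<alpha> / ?r (fst i) powr (real ?n + \<alpha>)) = (?d / ?r (fst i)) powr \<alpha>"
            using ri d by (simp add: powr_add powr_realpow powr_divide)
          then have "ennreal (?r (fst i) ^ ?n) * ennreal (?d powr \<alpha> / ?r (fst i) powr (real ?n + \<alpha>)) = ennreal ((?d / ?r (fst i)) powr \<alpha>)"
            using ri by (subst ennreal_mult[symmetric]) (auto simp: less_imp_le)
          then show ?thesis using zb True dle[OF i zb] by (simp add: \<kappa>_def t_def)
        qed (simp add: \<kappa>_def t_def)
        then have "(\<Sum>i\<in>J. ennreal (?r (fst i) ^ ?n) * (G z * \<kappa> i z)) = (\<Sum>i\<in>J. G z * ennreal (t i))"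
          by (intro sum.cong refl) (simp add: mult.left_commute)
        also have "\<dots> = G z * ennreal (\<Sum>i\<in>J. t i)"
        proof -
          have "0 \<le> t i" for i by (simp add: t_def)
          then show ?thesis by (simp add: sum_distrib_left[symmetric] sum_ennreal)
        qed
        also have "\<dots> \<le> G z * ennreal H"
          unfolding H_def t_def by (intro mult_left_mono ennreal_leI grid_distance_sum \<alpha>(1) J d) simp
        finally show ?thesis using True by (simp add: mult.commute)
      qed (simp add: \<kappa>_def)
    qed
    also have "\<dots> = ennreal H * ?B" by (rule nn_integral_cmult) measurable
    finally show ?thesis .
  qed
  define c where "c = 3 * (?o * 2 ^ ?n) * l"
  have c: "0 < c" using o l by (simp add: c_def)
  have "?L \<le> (\<Sum>i\<in>J. ennreal (?r (fst i) ^ ?n) * (2 * bump_coeff \<alpha> ?s i + 2 * (V i)\<^sup>2))"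
    by (intro sum_mono mult_left_mono step) auto
  also have "\<dots> = 2 * (\<Sum>i\<in>J. ennreal (?r (fst i) ^ ?n) * bump_coeff \<alpha> ?s i) + 2 * (\<Sum>i\<in>J. ennreal (?r (fst i) ^ ?n) * (V i)\<^sup>2)"
    by (simp add: sum_distrib_left distrib_left sum.distrib mult.left_commute)
  also have "(\<Sum>i\<in>J. ennreal (?r (fst i) ^ ?n) * bump_coeff \<alpha> ?s i) \<le> ennreal ?K * (?A + ennreal (10 ^ ?n * l) * ?B)"
    using bump_coeff_L2[OF \<alpha> J s] good by (meson mult_left_mono order_trans zero_le)
  also have "(\<Sum>i\<in>J. ennreal (?r (fst i) ^ ?n) * (V i)\<^sup>2) \<le> ennreal c * (ennreal H * ?B)"
  proof -
    have "(\<Sum>i\<in>J. ennreal (?r (fst i) ^ ?n) * (V i)\<^sup>2) \<le> (\<Sum>i\<in>J. ennreal c * (ennreal (?r (fst i) ^ ?n) * V i))"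
    proof (rule sum_mono)
      fix i assume i: "i \<in> J"
      have "(V i)\<^sup>2 \<le> ennreal c * V i"
        unfolding power2_eq_square c_def by (intro mult_right_mono Vle i) simp
      then have "ennreal (?r (fst i) ^ ?n) * (V i)\<^sup>2 \<le> ennreal (?r (fst i) ^ ?n) * (ennreal c * V i)"
        by (rule mult_left_mono) simp
      also have "\<dots> = ennreal c * (ennreal (?r (fst i) ^ ?n) * V i)" by (rule mult.left_commute)
      finally show "ennreal (?r (fst i) ^ ?n) * (V i)\<^sup>2 \<le> ennreal c * (ennreal (?r (fst i) ^ ?n) * V i)" .
    qed
    also have "\<dots> \<le> ennreal c * (ennreal H * ?B)"
      using Vsum by (simp add: sum_distrib_left[symmetric] mult_left_mono)
    finally show ?thesis .
  qed
  finally have L: "?L \<le> 2 * (ennreal ?K * (?A + ennreal (10 ^ ?n * l) * ?B)) + 2 * (ennreal c * (ennreal H * ?B))"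
    by (simp add: add_mono mult_left_mono)
  obtain a where a: "?A = ennreal a" "0 \<le> a" using False by (cases ?A) auto
  obtain b where b: "?B = ennreal b" "0 \<le> b" using False by (cases ?B) auto
  have "2 * (ennreal ?K * (?A + ennreal (10 ^ ?n * l) * ?B)) + 2 * (ennreal c * (ennreal H * ?B))
      = ennreal (2 * (?K * (a + 10 ^ ?n * l * b)) + 2 * (c * (H * b)))"
  proof -
    have "2 * (ennreal k * (ennreal a + ennreal x * ennreal b)) + 2 * (ennreal c * (ennreal H * ennreal b))
      = ennreal (2 * (k * (a + x * b)) + 2 * (c * (H * b)))" if "0 \<le> k" "0 \<le> x" for k x
      using that a(2) b(2) c H by (simp add: ennreal_mult)
    then show ?thesis unfolding a(1) b(1) using K l by simp
  qed
  also have "\<dots> \<le> ennreal (sawtooth_const TYPE('a) \<alpha> * (a + l * b))"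
  proof (rule ennreal_leI)
    have S: "sawtooth_const TYPE('a) \<alpha> = 2 * ?K * 10 ^ ?n + 2 * (3 * (?o * 2 ^ ?n) * H)"
      by (simp add: sawtooth_const_def H_def)
    have "?K * a \<le> ?K * 10 ^ ?n * a"
      using K a(2) mult_mono[of 1 "10 ^ ?n" "?K * a" "?K * a"] by (simp add: mult_ac)
    moreover have "0 \<le> (3 * (?o * 2 ^ ?n) * H) * a" using o H a(2) by (intro mult_nonneg_nonneg) auto
    moreover have "sawtooth_const TYPE('a) \<alpha> * (a + l * b)
       = 2 * (?K * 10 ^ ?n * a) + 2 * (?K * (10 ^ ?n * l * b)) + 2 * ((3 * (?o * 2 ^ ?n) * H) * a) + 2 * (c * (H * b))"
      unfolding S c_def by (simp add: algebra_simps)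
    ultimately show "2 * (?K * (a + 10 ^ ?n * l * b)) + 2 * (c * (H * b)) \<le> sawtooth_const TYPE('a) \<alpha> * (a + l * b)"
      by (simp only: distrib_left)
  qed
  also have "\<dots> = ennreal (sawtooth_const TYPE('a) \<alpha>) * (?A + ennreal l * ?B)"
    unfolding a(1) b(1) using sawtooth_const_pos[OF \<alpha>(1), where 'a='a] a(2) b(2) l by (simp add: ennreal_mult less_imp_le)
  finally show ?thesis using L by simp
qed

text \<open>The part of the level set inside \<Omega> is charged to the measure of \<Omega>; on the
  rest Chebyshev's inequality with l^2 is applied to \<open>disc_square\<close>, and
  \<open>bump_coeff_sawtooth\<close> bounds its integral.\<close>

lemma disc_square_distribution:
  fixes J :: "(int \<times> 'a::euclidean_space) set"
  assumes \<alpha>: "0 < \<alpha>" "\<alpha> \<le> 1" and J: "finite J" "J \<subseteq> grid" and f[measurable]: "\<And>j. f j \<in> borel_measurable borel"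
    and l: "0 < l" and G_def: "G = (\<lambda>x. ennreal_powr (sq_sum f x) (1/2))"
  shows "emeasure lborel {x. ennreal l < ennreal_powr (disc_square \<alpha> J f x) (1/2)} \<le>
     emeasure lborel {x. ennreal l < hlmax G x} + ennreal (ball_vol TYPE('a) * sawtooth_const TYPE('a) \<alpha> / l\<^sup>2) *
       ((\<integral>\<^sup>+x. sq_sum f x * indicator {x. hlmax G x \<le> ennreal l} x \<partial>lborel)
        + ennreal l * (\<integral>\<^sup>+x. G x * indicator {x. ennreal l < hlmax G x} x \<partial>lborel))"
proof -
  let ?o = "ball_vol TYPE('a)" and ?S = "sawtooth_const TYPE('a) \<alpha>" and ?T = "disc_square \<alpha> J f"
  define \<Omega> where "\<Omega> = {x. ennreal l < hlmax G x}"
  have [measurable]: "\<Omega> \<in> sets borel" unfolding \<Omega>_def by (rule borel_open[OF open_hlmax])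
  have comp: "- \<Omega> = {x. hlmax G x \<le> ennreal l}" by (auto simp: \<Omega>_def)
  have o: "0 < ?o" by (rule ball_vol_pos)
  have S: "0 < ?S" by (rule sawtooth_const_pos[OF \<alpha>(1)])
  let ?J = "{i\<in>J. \<not> gball i \<subseteq> \<Omega>}"
  let ?R = "(\<integral>\<^sup>+x\<in>- \<Omega>. sq_sum f x \<partial>lborel) + ennreal l * (\<integral>\<^sup>+x\<in>\<Omega>. G x \<partial>lborel)"
  define U where "U = {x. ennreal (l\<^sup>2) < ?T x} - \<Omega>"
  have [measurable]: "U \<in> sets borel" unfolding U_def by measurable
  have "{x. ennreal l < ennreal_powr (?T x) (1/2)} \<subseteq> \<Omega> \<union> U"
  proof
    fix x assume "x \<in> {x. ennreal l < ennreal_powr (?T x) (1/2)}"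
    then have "ennreal_powr (ennreal (l\<^sup>2)) (1/2) < ennreal_powr (?T x) (1/2)"
      using l by (simp add: powr_half_sqrt)
    then have "ennreal (l\<^sup>2) < ?T x" by (subst (asm) ennreal_powr_less_iff) auto
    then show "x \<in> \<Omega> \<union> U" by (auto simp: U_def)
  qed
  then have "emeasure lborel {x. ennreal l < ennreal_powr (?T x) (1/2)} \<le> emeasure lborel (\<Omega> \<union> U)"
    by (rule emeasure_mono) measurable
  also have "\<dots> \<le> emeasure lborel \<Omega> + emeasure lborel U"
    by (rule emeasure_subadditive) measurable
  also have "emeasure lborel U \<le> ennreal (?o * ?S / l\<^sup>2) * ?R"
  proof -
    have "ennreal (l\<^sup>2) * emeasure lborel U = (\<integral>\<^sup>+x. ennreal (l\<^sup>2) * indicator U x \<partial>lborel)"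
      by (simp add: nn_integral_cmult_indicator)
    also have "\<dots> \<le> (\<integral>\<^sup>+x. ?T x * indicator (- \<Omega>) x \<partial>lborel)"
      by (intro nn_integral_mono) (auto simp: indicator_def U_def)
    also have "\<dots> = (\<Sum>i\<in>J. bump_coeff \<alpha> f i * (\<integral>\<^sup>+x\<in>gball i. indicator (- \<Omega>) x \<partial>lborel))"
      by (rule nn_integral_disc_square) measurable
    \<comment> \<open>Balls contained in \<Omega> contribute nothing to an integral over the
      complement, so exactly the balls that leave \<Omega> are kept.\<close>
    also have "\<dots> = (\<Sum>i\<in>?J. bump_coeff \<alpha> f i * (\<integral>\<^sup>+x\<in>gball i. indicator (- \<Omega>) x \<partial>lborel))"
    proof (intro sum.mono_neutral_right ballI)
      fix i assume "i \<in> J - ?J"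
      then have eq: "indicator (- \<Omega>) x * indicator (gball i) x = (0 :: ennreal)" for x by (auto simp: indicator_def)
      show "bump_coeff \<alpha> f i * (\<integral>\<^sup>+x\<in>gball i. indicator (- \<Omega>) x \<partial>lborel) = 0" unfolding eq by simp
    qed (use J in auto)
    also have "\<dots> \<le> (\<Sum>i\<in>?J. bump_coeff \<alpha> f i * (ennreal ?o * ennreal (rad TYPE('a) (fst i) ^ DIM('a))))"
    proof (intro sum_mono mult_left_mono)
      fix i :: "int \<times> 'a"
      have "(\<integral>\<^sup>+x\<in>gball i. indicator (- \<Omega>) x \<partial>lborel) \<le> (\<integral>\<^sup>+x. indicator (gball i) x \<partial>lborel)"
        by (intro nn_integral_mono) (auto simp: indicator_def)
      also have "\<dots> = ennreal ?o * ennreal (rad TYPE('a) (fst i) ^ DIM('a))"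
        using o by (simp add: emeasure_ball' less_imp_le[OF rad_pos] ennreal_mult less_imp_le)
      finally show "(\<integral>\<^sup>+x\<in>gball i. indicator (- \<Omega>) x \<partial>lborel) \<le> ennreal ?o * ennreal (rad TYPE('a) (fst i) ^ DIM('a))" .
    qed simp
    also have "\<dots> = ennreal ?o * (\<Sum>i\<in>?J. ennreal (rad TYPE('a) (fst i) ^ DIM('a)) * bump_coeff \<alpha> f i)"
      by (simp add: sum_distrib_left mult_ac)
    also have "\<dots> \<le> ennreal ?o * (ennreal ?S * ?R)"
      using J by (intro mult_left_mono bump_coeff_sawtooth[OF \<alpha> _ _ f l G_def \<Omega>_def]) auto
    finally have *: "ennreal (l\<^sup>2) * emeasure lborel U \<le> ennreal ?o * (ennreal ?S * ?R)" .
    have "emeasure lborel U = ennreal (1 / l\<^sup>2) * (ennreal (l\<^sup>2) * emeasure lborel U)"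
      using l by (simp add: mult.assoc[symmetric] ennreal_mult[symmetric])
    also have "\<dots> \<le> ennreal (1 / l\<^sup>2) * (ennreal ?o * (ennreal ?S * ?R))"
      by (intro mult_left_mono *) simp
    also have "\<dots> = ennreal (1 / l\<^sup>2 * (?o * ?S)) * ?R"
    proof -
      have "ennreal a * (ennreal b * (ennreal c * X)) = ennreal (a * (b * c)) * X" if "0 \<le> a" "0 \<le> b" "0 \<le> c" for a b c X
        using that by (simp add: ennreal_mult mult.assoc)
      then show ?thesis using o S by (simp add: less_imp_le)
    qed
    finally show ?thesis by simp
  qed
  finally show ?thesis unfolding \<Omega>_def[symmetric] comp[symmetric] by (simp add: add_left_mono)
qed

section \<open>Integration of the distributional estimate over all levels\<close>

lemma nn_integral_lambda_above:
  assumes [measurable]: "g \<in> borel_measurable (lborel :: 'a::euclidean_space measure)"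
    and [measurable]: "w \<in> borel_measurable (lborel :: 'a measure)"
  shows "(\<integral>\<^sup>+l. ennreal (l powr e) * indicator {0<..} l * (\<integral>\<^sup>+x. w x * indicator {x. g x \<le> ennreal l} x \<partial>lborel) \<partial>lborel)
    = (\<integral>\<^sup>+x. w x * (\<integral>\<^sup>+l. ennreal (l powr e) * indicator {l. 0 < l \<and> g x \<le> ennreal l} l \<partial>lborel) \<partial>lborel)"
proof -
  have "(\<integral>\<^sup>+l. ennreal (l powr e) * indicator {0<..} l * (\<integral>\<^sup>+x. w x * indicator {x. g x \<le> ennreal l} x \<partial>lborel) \<partial>lborel)
     = (\<integral>\<^sup>+l. (\<integral>\<^sup>+x. ennreal (l powr e) * indicator {0<..} l * (w x * indicator {x. g x \<le> ennreal l} x) \<partial>lborel) \<partial>lborel)"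
    by (intro nn_integral_cong nn_integral_cmult[symmetric]) measurable
  also have "\<dots> = (\<integral>\<^sup>+x. (\<integral>\<^sup>+l. ennreal (l powr e) * indicator {0<..} l * (w x * indicator {x. g x \<le> ennreal l} x) \<partial>lborel) \<partial>lborel)"
    unfolding indicator_def by (rule lborel_pair.Fubini') measurable
  also have "\<dots> = (\<integral>\<^sup>+x. w x * (\<integral>\<^sup>+l. ennreal (l powr e) * indicator {l. 0 < l \<and> g x \<le> ennreal l} l \<partial>lborel) \<partial>lborel)"
    by (subst nn_integral_cmult[symmetric]) (auto intro!: nn_integral_cong simp: indicator_def mult.commute)
  finally show ?thesis .
qed

text \<open>Here p < 2 enters: the integral of l^(p-3) from v to infinity converges to v^(p-2) /
  (2-p), and u \<le> v turns its product with u^2 into a multiple of v^p. For infinite v no level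
  qualifies and the integral vanishes.\<close>

lemma power2_mult_lambda_above_le:
  assumes p: "p < 2" and v: "u \<le> v"
  shows "u\<^sup>2 * (\<integral>\<^sup>+l. ennreal (l powr (p - 3)) * indicator {l. 0 < l \<and> v \<le> ennreal l} l \<partial>lborel)
     \<le> ennreal (1 / (2 - p)) * ennreal_powr v p"
proof (cases v)
  case (real r)
  show ?thesis
  proof (cases "r = 0")
    case True
    then have "u = 0" using v real by simp
    then show ?thesis by simp
  next
    case False
    then have r: "0 < r" using real by simp
    have "u\<^sup>2 \<le> ennreal (r\<^sup>2)"
      using power_mono[OF v, of 2] real by (simp add: ennreal_power)
    then have "u\<^sup>2 * (\<integral>\<^sup>+l. ennreal (l powr (p - 3)) * indicator {l. 0 < l \<and> v \<le> ennreal l} l \<partial>lborel)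
      \<le> ennreal (r\<^sup>2) * ennreal (r powr (p - 3 + 1) / (- (p - 3) - 1))"
      unfolding real(2) using p r by (subst nn_integral_powr_above) (auto intro: mult_right_mono)
    also have "\<dots> = ennreal (1 / (2 - p) * r powr p)"
    proof -
      have "r\<^sup>2 * (r powr (p - 3 + 1) / (- (p - 3) - 1)) = 1 / (2 - p) * (r powr 2 * r powr (p - 2))"
        using r by (simp add: algebra_simps)
      also have "r powr 2 * r powr (p - 2) = r powr p"
        by (simp add: powr_add[symmetric])
      finally show ?thesis by (subst ennreal_mult[symmetric]) (use p in auto)
    qed
    also have "\<dots> = ennreal (1 / (2 - p)) * ennreal_powr v p"
      using real p by (simp add: ennreal_mult[symmetric])
    finally show ?thesis .
  qed
next
  case top
  then have "(\<integral>\<^sup>+l. ennreal (l powr (p - 3)) * indicator {l. 0 < l \<and> v \<le> ennreal l} l \<partial>lborel) = 0"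
    by (simp add: top_unique)
  then show ?thesis by simp
qed

text \<open>Multiplying the distributional bound by l^(p-1) leaves the weights l^(p-3) for the
  integral off \<Omega> and l^(p-2) for the integral on it. The first is integrable at infinity
  because p < 2, the second at zero because p > 1. Every term becomes a multiple of the integral of
  the p-th power of the maximal function.\<close>

lemma disc_square_Lp_less_2:
  assumes \<alpha>: "0 < \<alpha>" "\<alpha> \<le> 1" and p: "1 < p" "p < 2"
  shows "\<exists>C>0. \<forall>(J :: (int \<times> 'a::euclidean_space) set) f. finite J \<longrightarrow> J \<subseteq> grid \<longrightarrow> (\<forall>j. f j \<in> borel_measurable borel) \<longrightarrow>
    (\<integral>\<^sup>+x. ennreal_powr (disc_square \<alpha> J f x) (p/2) \<partial>lborel) \<le> ennreal C * (\<integral>\<^sup>+x. ennreal_powr (sq_sum f x) (p/2) \<partial>lborel)"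
proof -
  define c where "c = ball_vol TYPE('a) * sawtooth_const TYPE('a) \<alpha>"
  have c: "0 < c"
    using ball_vol_pos[where 'a='a] sawtooth_const_pos[OF \<alpha>(1), where 'a='a] by (simp add: c_def)
  define Q where "Q = p * (2 * 5 ^ DIM('a)) * 2 powr (p - 1) / (p - 1)"
  have Q: "0 < Q" using p by (simp add: Q_def)
  \<comment> \<open>The 1 belongs to the measure of \<Omega>, the other two summands to the
    integrals off \<Omega> and on \<Omega>.\<close>
  define D where "D = 1 + (p * c / (2 - p) + p * c / (p - 1))"
  have D: "0 < D" using p c by (simp add: D_def add_pos_pos)
  show ?thesis
  proof (intro exI[of _ "D * Q"] conjI allI impI)
    show "0 < D * Q" using D Q by simp
  next
    fix J :: "(int \<times> 'a) set" and f :: "nat \<Rightarrow> 'a \<Rightarrow> complex"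
    assume J: "finite J" "J \<subseteq> grid" and f: "\<forall>j. f j \<in> borel_measurable borel"
    have fm[measurable]: "f j \<in> borel_measurable borel" for j using f by blast
    define G where "G = (\<lambda>x. ennreal_powr (sq_sum f x) (1/2))"
    have [measurable]: "G \<in> borel_measurable borel" unfolding G_def by measurable
    have G2: "sq_sum f x = (G x)\<^sup>2" for x by (simp add: G_def)
    let ?T = "disc_square \<alpha> J f"
    define I where "I = (\<integral>\<^sup>+x. ennreal_powr (hlmax G x) p \<partial>lborel)"
    define m where "m l = emeasure lborel {x. ennreal l < hlmax G x}" for l
    define A where "A l = (\<integral>\<^sup>+x. sq_sum f x * indicator {x. hlmax G x \<le> ennreal l} x \<partial>lborel)" for l
    define B where "B l = (\<integral>\<^sup>+x. G x * indicator {x. ennreal l < hlmax G x} x \<partial>lborel)" for l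
    have mm: "m l = (\<integral>\<^sup>+x. 1 * indicator {x. ennreal l < hlmax G x} x \<partial>(lborel::'a measure))" for l
      by (simp add: m_def)
    have [measurable]: "m \<in> borel_measurable borel" unfolding mm indicator_def by measurable
    have [measurable]: "A \<in> borel_measurable borel" unfolding A_def indicator_def by measurable
    have [measurable]: "B \<in> borel_measurable borel" unfolding B_def indicator_def by measurable
    have 1: "ennreal p * (\<integral>\<^sup>+l. ennreal (l powr (p - 1)) * indicator {0<..} l * m l \<partial>lborel) = I"
    proof -
      have "(\<integral>\<^sup>+x. 1 * ennreal_powr (hlmax G x) (p - 1 + 1) \<partial>lborel)
        = ennreal (p - 1 + 1) * (\<integral>\<^sup>+l. ennreal (l powr (p - 1)) * indicator {0<..} l * m l \<partial>lborel)"
        unfolding mm using p by (intro layer_cake) auto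
      then show ?thesis by (simp add: I_def)
    qed
    have ae: "AE x in lborel. G x \<le> hlmax G x" by (rule AE_le_hlmax) measurable
    have 2: "(\<integral>\<^sup>+l. ennreal (l powr (p - 3)) * indicator {0<..} l * A l \<partial>lborel) \<le> ennreal (1 / (2 - p)) * I"
    proof -
      have "(\<integral>\<^sup>+l. ennreal (l powr (p - 3)) * indicator {0<..} l * A l \<partial>lborel)
        = (\<integral>\<^sup>+x. (G x)\<^sup>2 * (\<integral>\<^sup>+l. ennreal (l powr (p - 3)) * indicator {l. 0 < l \<and> hlmax G x \<le> ennreal l} l \<partial>lborel) \<partial>lborel)"
        unfolding A_def G2 by (rule nn_integral_lambda_above) measurable
      also have "\<dots> \<le> (\<integral>\<^sup>+x. ennreal (1 / (2 - p)) * ennreal_powr (hlmax G x) p \<partial>lborel)"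
        using ae by (intro nn_integral_mono_AE) (auto elim!: eventually_mono intro!: power2_mult_lambda_above_le p)
      also have "\<dots> = ennreal (1 / (2 - p)) * I"
        unfolding I_def by (rule nn_integral_cmult) measurable
      finally show ?thesis .
    qed
    have 3: "(\<integral>\<^sup>+l. ennreal (l powr (p - 2)) * indicator {0<..} l * B l \<partial>lborel) \<le> ennreal (1 / (p - 1)) * I"
    proof -
      have "(\<integral>\<^sup>+x. G x * ennreal_powr (hlmax G x) (p - 2 + 1) \<partial>lborel)
        = ennreal (p - 2 + 1) * (\<integral>\<^sup>+l. ennreal (l powr (p - 2)) * indicator {0<..} l * B l \<partial>lborel)"
        unfolding B_def using p by (intro layer_cake) auto
      then have "(\<integral>\<^sup>+l. ennreal (l powr (p - 2)) * indicator {0<..} l * B l \<partial>lborel)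
        = ennreal (1 / (p - 1)) * (\<integral>\<^sup>+x. G x * ennreal_powr (hlmax G x) (p - 1) \<partial>lborel)"
        using p by (simp add: mult.assoc[symmetric] ennreal_mult[symmetric])
      also have "(\<integral>\<^sup>+x. G x * ennreal_powr (hlmax G x) (p - 1) \<partial>lborel) \<le> I"
        unfolding I_def
      proof (intro nn_integral_mono_AE, use ae in eventually_elim)
        case (elim x)
        have "G x * ennreal_powr (hlmax G x) (p - 1) \<le> ennreal_powr (hlmax G x) 1 * ennreal_powr (hlmax G x) (p - 1)"
          using elim by (intro mult_right_mono) auto
        also have "\<dots> = ennreal_powr (hlmax G x) p" using p by (subst ennreal_powr_add) auto
        finally show ?case .
      qed
      finally show ?thesis by (simp add: mult_left_mono)
    qed
    have "(\<integral>\<^sup>+x. ennreal_powr (?T x) (p/2) \<partial>lborel) = (\<integral>\<^sup>+x. 1 * ennreal_powr (ennreal_powr (?T x) (1/2)) (p - 1 + 1) \<partial>lborel)"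
      using p by (simp add: ennreal_powr_powr)
    also have "\<dots> = ennreal (p - 1 + 1) * (\<integral>\<^sup>+l. ennreal (l powr (p - 1)) * indicator {0<..} l *
         (\<integral>\<^sup>+x. 1 * indicator {x. ennreal l < ennreal_powr (?T x) (1/2)} x \<partial>(lborel::'a measure)) \<partial>lborel)"
      using p by (intro layer_cake) auto
    also have "\<dots> \<le> ennreal (p - 1 + 1) * (\<integral>\<^sup>+l. ennreal (l powr (p - 1)) * indicator {0<..} l * m l
         + ennreal c * (ennreal (l powr (p - 3)) * indicator {0<..} l * A l + ennreal (l powr (p - 2)) * indicator {0<..} l * B l) \<partial>lborel)"
    proof (intro mult_left_mono nn_integral_mono)
      fix l :: real
      show "ennreal (l powr (p - 1)) * indicator {0<..} l *
         (\<integral>\<^sup>+x. 1 * indicator {x. ennreal l < ennreal_powr (?T x) (1/2)} x \<partial>(lborel::'a measure))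
         \<le> ennreal (l powr (p - 1)) * indicator {0<..} l * m l
         + ennreal c * (ennreal (l powr (p - 3)) * indicator {0<..} l * A l + ennreal (l powr (p - 2)) * indicator {0<..} l * B l)"
      proof (cases "0 < l")
        case l: True
        have l3: "ennreal (l powr (p - 1)) * ennreal (c / l\<^sup>2) = ennreal c * ennreal (l powr (p - 3))"
        proof -
          have "l powr (p - 1) = l powr (p - 3) * l powr 2" by (simp add: powr_add[symmetric])
          then have "l powr (p - 1) * (c / l\<^sup>2) = c * l powr (p - 3)" using l by simp
          then show ?thesis using c by (simp add: ennreal_mult[symmetric])
        qed
        have l2: "ennreal (l powr (p - 3)) * ennreal l = ennreal (l powr (p - 2))"
        proof -
          have "l powr (p - 3) * l = l powr (p - 2)"
            using powr_add[of l "p - 3" 1] l by simp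
          then show ?thesis using l by (simp add: ennreal_mult[symmetric])
        qed
        have "ennreal (l powr (p - 1)) * emeasure lborel {x. ennreal l < ennreal_powr (?T x) (1/2)}
           \<le> ennreal (l powr (p - 1)) * (m l + ennreal (c / l\<^sup>2) * (A l + ennreal l * B l))"
          unfolding m_def A_def B_def c_def by (intro mult_left_mono disc_square_distribution \<alpha> J fm l G_def) simp
        also have "\<dots> = ennreal (l powr (p - 1)) * m l + ennreal (l powr (p - 1)) * ennreal (c / l\<^sup>2) * (A l + ennreal l * B l)"
          by (simp add: distrib_left mult.assoc)
        also have "\<dots> = ennreal (l powr (p - 1)) * m l + ennreal c * (ennreal (l powr (p - 3)) * A l + ennreal (l powr (p - 2)) * B l)"
          unfolding l3 l2[symmetric] by (simp add: distrib_left mult.assoc)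
        finally show ?thesis using l by simp
      qed simp
    qed simp
    also have "\<dots> = ennreal p * (\<integral>\<^sup>+l. ennreal (l powr (p - 1)) * indicator {0<..} l * m l \<partial>lborel)
       + ennreal p * (ennreal c * ((\<integral>\<^sup>+l. ennreal (l powr (p - 3)) * indicator {0<..} l * A l \<partial>lborel)
         + (\<integral>\<^sup>+l. ennreal (l powr (p - 2)) * indicator {0<..} l * B l \<partial>lborel)))"
      by (simp add: nn_integral_add nn_integral_cmult distrib_left)
    also have "\<dots> \<le> I + ennreal p * (ennreal c * (ennreal (1 / (2 - p)) * I + ennreal (1 / (p - 1)) * I))"
      unfolding 1 by (intro add_left_mono mult_left_mono add_mono 2 3) auto
    also have "\<dots> = ennreal D * I"
    proof -
      have "X + ennreal a * (ennreal b * (ennreal u * X + ennreal v * X)) = ennreal (1 + (a * b * u + a * b * v)) * X"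
        if "0 \<le> a" "0 \<le> b" "0 \<le> u" "0 \<le> v" for a b u v X
        using that by (simp add: ennreal_mult distrib_left distrib_right mult.assoc)
      from this[of p c "1 / (2 - p)" "1 / (p - 1)" I] show ?thesis
        using p c by (simp add: D_def)
    qed
    also have "I \<le> ennreal Q * (\<integral>\<^sup>+x. ennreal_powr (G x) p \<partial>lborel)"
      unfolding I_def Q_def using p by (intro hlmax_strong_type) auto
    also have "(\<integral>\<^sup>+x. ennreal_powr (G x) p \<partial>lborel) = (\<integral>\<^sup>+x. ennreal_powr (sq_sum f x) (p/2) \<partial>lborel)"
      using p by (simp add: G_def ennreal_powr_powr)
    finally show "(\<integral>\<^sup>+x. ennreal_powr (?T x) (p/2) \<partial>lborel) \<le> ennreal (D * Q) * (\<integral>\<^sup>+x. ennreal_powr (sq_sum f x) (p/2) \<partial>lborel)"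
      using D Q by (simp add: ennreal_mult mult_left_mono less_imp_le mult.assoc)
  qed
qed

lemma disc_square_Lp:
  assumes \<alpha>: "0 < \<alpha>" "\<alpha> \<le> 1" and p: "1 < p"
  obtains C where "0 < C" "\<And>(J :: (int \<times> 'a::euclidean_space) set) f. finite J \<Longrightarrow> J \<subseteq> grid \<Longrightarrow> (\<And>j. f j \<in> borel_measurable borel) \<Longrightarrow>
    (\<integral>\<^sup>+x. ennreal_powr (disc_square \<alpha> J f x) (p/2) \<partial>lborel) \<le> ennreal C * (\<integral>\<^sup>+x. ennreal_powr (sq_sum f x) (p/2) \<partial>lborel)"
proof (cases "p < 2")
  case True
  then show ?thesis using disc_square_Lp_less_2[OF \<alpha> p True, where 'a='a] that by blast
next
  case False
  then have "1 \<le> p / 2" by simp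
  then show ?thesis using disc_square_Lp_ge_2[OF \<alpha>, of "p/2", where 'a='a] that by blast
qed

subsection \<open>Discretisation of the square function\<close>

definition cone_integral :: "real \<Rightarrow> ('a::euclidean_space \<Rightarrow> complex) \<Rightarrow> 'a \<Rightarrow> ennreal" where
  "cone_integral \<alpha> f x =
     (\<integral>\<^sup>+q\<in>vertical_cone x. (intrinsic_sup \<alpha> f (fst q) (snd q))\<^sup>2 / ennreal (snd q ^ (DIM('a) + 1)) \<partial>lebesgue)"

lemma intrinsic_square_power2: "(intrinsic_square \<alpha> f x)\<^sup>2 = cone_integral \<alpha> f x"
  by (simp add: intrinsic_square_def cone_integral_def)

lemma mesh_bracket:
  assumes "0 < t"
  obtains k where "mesh k / 2 \<le> t" "t < mesh k"
proof
  let ?k = "\<lfloor>log 2 t\<rfloor> + 1"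
  have "2 powr (of_int \<lfloor>log 2 t\<rfloor>) \<le> 2 powr (log 2 t)" by (intro powr_mono) auto
  then show "mesh ?k / 2 \<le> t" using assms by (simp add: mesh_def powr_add)
  have "2 powr (log 2 t) < 2 powr (of_int ?k)" by (intro powr_less_mono) (linarith, simp)
  then show "t < mesh ?k" using assms by (simp add: mesh_def)
qed

text \<open>The squared factor is the loss in moving a cone point to a lattice ball; the rest bounds
  the measure of one cell with respect to dy dt / t^(n+1).\<close>

definition disc_const :: "'a::euclidean_space itself \<Rightarrow> real" where
  "disc_const _ = (((2 * (real DIM('a) + 1)) ^ (DIM('a) + 1))\<^sup>2) * ((2 * (real DIM('a) + 1)) ^ DIM('a) * ball_vol TYPE('a))"

lemma disc_const_pos: "0 < disc_const TYPE('a::euclidean_space)"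
  using ball_vol_pos[where 'a='a] by (simp add: disc_const_def add_nonneg_pos)

text \<open>An increasing exhaustion by finite sets, to which the L^p bounds apply, in preparation
  for monotone convergence.\<close>

definition grid_part :: "nat \<Rightarrow> (int \<times> 'a::euclidean_space) set" where
  "grid_part N = from_nat_into grid ` {..<N}"

lemma grid_nonempty: "(grid :: (int \<times> 'a::euclidean_space) set) \<noteq> {}"
  by (auto simp: grid_def)

lemma grid_part_finite: "finite (grid_part N)"
  by (simp add: grid_part_def)

lemma grid_part_subset: "grid_part N \<subseteq> (grid :: (int \<times> 'a::euclidean_space) set)"
  using from_nat_into[OF grid_nonempty] by (auto simp: grid_part_def)

lemma grid_part_mono: "N \<le> M \<Longrightarrow> grid_part N \<subseteq> grid_part M"
  by (auto simp: grid_part_def)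

lemma grid_part_exhausts:
  assumes "i \<in> grid"
  shows "\<exists>N. i \<in> (grid_part N :: (int \<times> 'a::euclidean_space) set)"
proof -
  obtain m where "from_nat_into grid m = i"
    using from_nat_into_surj[OF countable_grid assms] by blast
  then have "i \<in> grid_part (Suc m)" by (auto simp: grid_part_def)
  then show ?thesis by blast
qed

lemma emeasure_lborel_Times:
  assumes "A \<in> sets borel" "B \<in> sets borel"
  shows "emeasure lborel ((A :: 'a::euclidean_space set) \<times> (B :: 'b::euclidean_space set)) = emeasure lborel A * emeasure lborel B"
  unfolding lborel_prod[symmetric] using assms by (intro lborel.emeasure_pair_measure_Times) auto

text \<open>A cone point (y, t) is assigned to the scale with mesh/2 \<le> t < mesh and to the
  rounding of y. The resulting lattice ball contains \<open>ball y t\<close>, hence x, so its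
  coefficient occurs on the right. The integrand is majorised by a countable sum of constants on
  cells, which is then integrated.\<close>

lemma cone_integral_le_SUP:
  fixes x :: "'a::euclidean_space"
  assumes \<alpha>: "0 < \<alpha>" "\<alpha> \<le> 1" and f: "f \<in> borel_measurable borel"
  shows "cone_integral \<alpha> f x \<le> ennreal (disc_const TYPE('a)) *
     (SUP N. \<Sum>i\<in>grid_part N. (bump_sup \<alpha> f (snd i) (rad TYPE('a) (fst i)))\<^sup>2 * indicator (gball i) x)"
proof -
  let ?n = "DIM('a)" and ?r = "rad TYPE('a)" and ?o = "ball_vol TYPE('a)"
  let ?N = "real ?n + 1"
  define b where "b i = (bump_sup \<alpha> f (snd i) (?r (fst i)))\<^sup>2 * indicator (gball i) x" for i :: "int \<times> 'a"
  define c where "c = (2 * ?N) ^ (?n + 1)"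
  define cell where "cell i = gball i \<times> {mesh (fst i) / 2..<mesh (fst i)}" for i :: "int \<times> 'a"
  \<comment> \<open>On a cell t is at least mesh/2, so (2 / mesh)^(n+1) dominates the density of the
    cone measure; \<open>c\<close> dominates the factor of
    \<open>intrinsic_sup_le_bump_sup\<close>.\<close>
  define h where "h i q = ennreal (c\<^sup>2 * (2 / mesh (fst i)) ^ (?n + 1)) * b i * indicator (cell i) q" for i :: "int \<times> 'a" and q
  have cell[measurable]: "cell i \<in> sets borel" for i
    unfolding cell_def by (intro borel_Times) auto
  have [measurable]: "h i \<in> borel_measurable borel" for i unfolding h_def by measurable
  have o: "0 < ?o" by (rule ball_vol_pos)
  have N: "1 \<le> ?N" by simp
  have int_h: "(\<integral>\<^sup>+q. h i q \<partial>lborel) = ennreal (disc_const TYPE('a)) * b i" for i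
  proof -
    let ?m = "mesh (fst i)"
    have m: "0 < ?m" by simp
    have "emeasure lborel (cell i) = ennreal (?o * ?r (fst i) ^ ?n) * ennreal (?m / 2)"
      unfolding cell_def using m by (simp add: emeasure_lborel_Times emeasure_ball' less_imp_le[OF rad_pos])
    also have "\<dots> = ennreal (?o * ?r (fst i) ^ ?n * (?m / 2))"
      using m o by (intro ennreal_mult[symmetric]) (auto simp: less_imp_le)
    finally have e: "emeasure lborel (cell i) = ennreal (?o * ?r (fst i) ^ ?n * (?m / 2))" .
    have "(\<integral>\<^sup>+q. h i q \<partial>lborel) = ennreal (c\<^sup>2 * (2 / ?m) ^ (?n + 1)) * b i * emeasure lborel (cell i)"
      unfolding h_def by (rule nn_integral_cmult_indicator) measurable
    also have "\<dots> = ennreal (c\<^sup>2 * (2 / ?m) ^ (?n + 1)) * ennreal (?o * ?r (fst i) ^ ?n * (?m / 2)) * b i"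
      unfolding e by (simp only: mult.assoc mult.commute[of "b i"])
    also have "ennreal (c\<^sup>2 * (2 / ?m) ^ (?n + 1)) * ennreal (?o * ?r (fst i) ^ ?n * (?m / 2))
       = ennreal (c\<^sup>2 * (2 / ?m) ^ (?n + 1) * (?o * ?r (fst i) ^ ?n * (?m / 2)))"
      using m o by (intro ennreal_mult[symmetric]) (auto simp: less_imp_le)
    also have "c\<^sup>2 * (2 / ?m) ^ (?n + 1) * (?o * ?r (fst i) ^ ?n * (?m / 2)) = disc_const TYPE('a)"
    proof -
      have "(2 / a) ^ (?n + 1) * ((?N * a) ^ ?n * (a / 2)) = ((2 / a) * (?N * a)) ^ ?n * ((2 / a) * (a / 2))" for a :: real
        by (simp only: power_add power_one_right power_mult_distrib mult_ac)
      also have "((2 / ?m) * (?N * ?m)) ^ ?n * ((2 / ?m) * (?m / 2)) = (2 * ?N) ^ ?n"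
        using less_imp_neq[OF m] by simp
      finally have "(2 / ?m) ^ (?n + 1) * ((?N * ?m) ^ ?n * (?m / 2)) = (2 * ?N) ^ ?n" .
      then have "c\<^sup>2 * ?o * ((2 / ?m) ^ (?n + 1) * ((?N * ?m) ^ ?n * (?m / 2))) = c\<^sup>2 * ?o * (2 * ?N) ^ ?n"
        by (simp only:)
      then show ?thesis by (simp only: disc_const_def c_def rad_def mult_ac)
    qed
    finally show ?thesis .
  qed
  define H where "H N q = (\<Sum>i\<in>grid_part N. h i q)" for N q
  have [measurable]: "H N \<in> borel_measurable borel" for N
    unfolding H_def by measurable
  have H_mono: "incseq H"
    unfolding H_def incseq_def le_fun_def by (auto intro!: sum_mono2 grid_part_finite grid_part_mono)
  have "cone_integral \<alpha> f x \<le> (\<integral>\<^sup>+q. (SUP N. H N q) \<partial>lebesgue)"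
    unfolding cone_integral_def
  proof (rule nn_integral_mono)
    fix q :: "'a \<times> real"
    obtain y t where q: "q = (y, t)" by (cases q)
    show "(intrinsic_sup \<alpha> f (fst q) (snd q))\<^sup>2 / ennreal (snd q ^ (?n + 1)) * indicator (vertical_cone x) q \<le> (SUP N. H N q)"
    proof (cases "q \<in> vertical_cone x")
      case True
      then have t: "0 < t" and xy: "dist x y < t" by (auto simp: q vertical_cone_def dist_norm)
      obtain k where k: "mesh k / 2 \<le> t" "t < mesh k" using mesh_bracket[OF t] .
      define i where "i = (k, grid_round (mesh k) y)"
      have i: "i \<in> grid" by (auto simp: i_def grid_def)
      have dy: "dist y (grid_round (mesh k) y) \<le> real ?n * mesh k" by (rule dist_grid_round) simp
      have r: "?r k = real ?n * mesh k + mesh k" by (simp add: rad_def distrib_right)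
      \<comment> \<open>Rounding moves y by at most n meshes and t is less than one mesh; their sum
        is \<open>rad\<close>.\<close>
      have sub: "ball y t \<subseteq> ball (snd i) (?r (fst i))"
      proof
        fix z assume "z \<in> ball y t"
        then show "z \<in> ball (snd i) (?r (fst i))"
          using dy k(2) dist_triangle[of "grid_round (mesh k) y" z y] by (simp add: i_def r dist_commute)
      qed
      have xin: "x \<in> gball i" using subsetD[OF sub, of x] xy by (simp add: dist_commute)
      have yin: "y \<in> gball i" using subsetD[OF sub, of y] t by simp
      have "intrinsic_sup \<alpha> f y t \<le> ennreal ((?r k / t) powr (real ?n + \<alpha>)) * bump_sup \<alpha> f (snd i) (?r (fst i))"
        using intrinsic_sup_le_bump_sup[OF \<alpha>(1) t rad_pos sub f] by (simp add: i_def)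
      also have "\<dots> \<le> ennreal c * bump_sup \<alpha> f (snd i) (?r (fst i))"
      proof (intro mult_right_mono ennreal_leI)
        have "?r k / t \<le> 2 * ?N"
        proof -
          have "?r k \<le> ?N * (2 * t)" unfolding rad_def using k by (intro mult_left_mono) auto
          then show ?thesis using t by (simp add: pos_divide_le_eq mult_ac)
        qed
        then have "(?r k / t) powr (real ?n + \<alpha>) \<le> (2 * ?N) powr (real ?n + \<alpha>)"
          using t \<alpha> by (intro powr_mono2) (auto simp: less_imp_le)
        also have "\<dots> \<le> (2 * ?N) powr (real (?n + 1))"
          using \<alpha> N by (intro powr_mono) auto
        also have "\<dots> = c" unfolding c_def using N by (intro powr_realpow) auto
        finally show "(?r k / t) powr (real ?n + \<alpha>) \<le> c" .
      qed simp
      finally have "(intrinsic_sup \<alpha> f y t)\<^sup>2 \<le> (ennreal c * bump_sup \<alpha> f (snd i) (?r (fst i)))\<^sup>2"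
        by (intro power_mono) auto
      also have "\<dots> = ennreal (c\<^sup>2) * b i"
        using xin N by (simp add: power_mult_distrib ennreal_power c_def b_def)
      finally have A: "(intrinsic_sup \<alpha> f y t)\<^sup>2 \<le> ennreal (c\<^sup>2) * b i" .
      have "(intrinsic_sup \<alpha> f y t)\<^sup>2 / ennreal (t ^ (?n + 1)) \<le> h i q"
      proof -
        have tp: "0 < t ^ (?n + 1)" using t by simp
        have "1 \<le> (2 / mesh k) ^ (?n + 1) * t ^ (?n + 1)"
        proof -
          have "1 \<le> 2 / mesh k * t" using k by (simp add: field_simps)
          then have "1 \<le> (2 / mesh k * t) ^ (?n + 1)" by (rule one_le_power)
          then show ?thesis by (simp only: power_mult_distrib)
        qed
        then have "1 * (ennreal (c\<^sup>2) * b i) \<le> ennreal ((2 / mesh k) ^ (?n + 1) * t ^ (?n + 1)) * (ennreal (c\<^sup>2) * b i)"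
          by (intro mult_right_mono) (auto simp: ennreal_ge_1)
        also have "\<dots> = ennreal (t ^ (?n + 1)) * (ennreal (c\<^sup>2 * (2 / mesh k) ^ (?n + 1)) * b i)"
        proof -
          have eq: "ennreal (u * v) * (ennreal w * X) = ennreal v * (ennreal (w * u) * X)" if "0 \<le> u" "0 \<le> v" "0 \<le> w" for u v w X
            using that by (simp add: ennreal_mult mult_ac)
          show ?thesis by (rule eq) (use t less_imp_le[OF mesh_pos[of k]] in auto)
        qed
        finally have "(intrinsic_sup \<alpha> f y t)\<^sup>2 \<le> ennreal (t ^ (?n + 1)) * (ennreal (c\<^sup>2 * (2 / mesh k) ^ (?n + 1)) * b i)"
          using A by simp
        then have "(intrinsic_sup \<alpha> f y t)\<^sup>2 / ennreal (t ^ (?n + 1)) \<le> ennreal (c\<^sup>2 * (2 / mesh k) ^ (?n + 1)) * b i"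
          unfolding ennreal_divide_le_iff[OF tp] .
        moreover have "q \<in> cell i" using yin k by (simp add: cell_def q i_def)
        ultimately show ?thesis by (simp add: h_def i_def)
      qed
      also have "h i q \<le> (SUP N. H N q)"
      proof -
        obtain N where N: "i \<in> grid_part N" using grid_part_exhausts[OF i] by blast
        have "h i q \<le> H N q"
          unfolding H_def using grid_part_finite N by (intro member_le_sum) auto
        then show ?thesis by (rule order_trans) (intro SUP_upper, simp)
      qed
      finally show ?thesis using True by (simp add: q)
    qed simp
  qed
  also have "\<dots> = (\<integral>\<^sup>+q. (SUP N. H N q) \<partial>lborel)" by (rule nn_integral_completion)
  also have "\<dots> = (SUP N. \<integral>\<^sup>+q. H N q \<partial>lborel)"
    by (rule nn_integral_monotone_convergence_SUP[OF H_mono]) measurable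
  also have "\<dots> = (SUP N. ennreal (disc_const TYPE('a)) * (\<Sum>i\<in>grid_part N. b i))"
    unfolding H_def by (intro SUP_cong refl) (simp add: nn_integral_sum int_h sum_distrib_left)
  also have "\<dots> = ennreal (disc_const TYPE('a)) * (SUP N. \<Sum>i\<in>grid_part N. b i)"
    by (rule SUP_mult_left_ennreal[symmetric])
  finally show ?thesis by (simp add: b_def)
qed

lemma sum_cone_integral_le_SUP:
  fixes x :: "'a::euclidean_space"
  assumes \<alpha>: "0 < \<alpha>" "\<alpha> \<le> 1" and f: "\<And>j. f j \<in> borel_measurable borel"
  shows "(\<Sum>j. cone_integral \<alpha> (f j) x) \<le> ennreal (disc_const TYPE('a)) * (SUP N. disc_square \<alpha> (grid_part N) f x)"
proof -
  let ?g = "\<lambda>N j. \<Sum>i\<in>grid_part N. (bump_sup \<alpha> (f j) (snd i) (rad TYPE('a) (fst i)))\<^sup>2 * indicator (gball i) x"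
  have "(\<Sum>j. cone_integral \<alpha> (f j) x) \<le> (\<Sum>j. ennreal (disc_const TYPE('a)) * (SUP N. ?g N j))"
    by (intro suminf_le summableI cone_integral_le_SUP \<alpha> f)
  also have "\<dots> = ennreal (disc_const TYPE('a)) * (\<Sum>j. SUP N. ?g N j)"
    by (simp add: ennreal_suminf_cmult)
  also have "(\<Sum>j. SUP N. ?g N j) = (SUP N. \<Sum>j. ?g N j)"
    by (rule ennreal_suminf_SUP_eq) (auto simp: incseq_def intro!: sum_mono2 grid_part_finite grid_part_mono)
  also have "(SUP N. \<Sum>j. ?g N j) = (SUP N. disc_square \<alpha> (grid_part N) f x)"
  proof (intro SUP_cong refl)
    fix N
    have "(\<Sum>j. ?g N j) = (\<Sum>i\<in>grid_part N. \<Sum>j. (bump_sup \<alpha> (f j) (snd i) (rad TYPE('a) (fst i)))\<^sup>2 * indicator (gball i) x)"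
      by (intro suminf_sum summableI)
    then show "(\<Sum>j. ?g N j) = disc_square \<alpha> (grid_part N) f x"
      by (simp add: disc_square_def bump_coeff_def)
  qed
  finally show ?thesis .
qed

subsection \<open>Measurability of the square function\<close>

text \<open>Dominated convergence. Once the centre is within t of y and the scale lies between t/2
  and 2t, all dilates live in \<open>ball y (3 * t)\<close> and are bounded by 3 / (t/2)^n.\<close>

lemma dilate_integral_continuous:
  fixes f :: "'a::euclidean_space \<Rightarrow> complex"
  assumes \<alpha>: "0 < \<alpha>" "\<alpha> \<le> 1" and f[measurable]: "f \<in> borel_measurable borel"
    and loc: "\<And>y r. integrable lborel (\<lambda>z. f z * indicator (ball y r) z)" and \<phi>: "\<phi> \<in> test_functions \<alpha>"
  shows "continuous_on (UNIV \<times> {0<..}) (\<lambda>q. \<integral>z. dilate (snd q) \<phi> (fst q - z) * f z \<partial>lborel)"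
proof (rule continuous_on_sequentiallyI)
  fix u :: "nat \<Rightarrow> 'a \<times> real" and q
  assume u: "\<forall>m. u m \<in> UNIV \<times> {0<..}" and q: "q \<in> UNIV \<times> {0<..}" and lim: "u \<longlonglongrightarrow> q"
  define y t where "y = fst q" and "t = snd q"
  have t: "0 < t" using q by (auto simp: t_def)
  have ly: "(\<lambda>m. fst (u m)) \<longlonglongrightarrow> y" and lt: "(\<lambda>m. snd (u m)) \<longlonglongrightarrow> t"
    unfolding y_def t_def using lim by (auto intro: tendsto_fst tendsto_snd)
  have cont: "continuous_on UNIV \<phi>"
    using \<alpha> \<phi> hoelder_continuous[of \<alpha> \<phi> 1] by (auto simp: test_functions_def)
  have [measurable]: "\<phi> \<in> borel_measurable borel" using cont by (rule borel_measurable_continuous_onI)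
  have "\<forall>\<^sub>F m in sequentially. dist (fst (u m)) y < t"
    using ly t by (rule tendstoD)
  moreover have "\<forall>\<^sub>F m in sequentially. dist (snd (u m)) t < t / 2"
    using t by (intro tendstoD[OF lt]) auto
  ultimately have "\<forall>\<^sub>F m in sequentially. dist (fst (u m)) y < t \<and> dist (snd (u m)) t < t / 2"
    by (rule eventually_conj)
  then obtain m0 where m0: "\<And>m. m0 \<le> m \<Longrightarrow> dist (fst (u m)) y < t \<and> dist (snd (u m)) t < t / 2"
    unfolding eventually_sequentially by blast
  let ?s = "\<lambda>m z. dilate (snd (u (m + m0))) \<phi> (fst (u (m + m0)) - z) * f z"
  have "(\<lambda>m. \<integral>z. ?s m z \<partial>lborel) \<longlonglongrightarrow> (\<integral>z. dilate t \<phi> (y - z) * f z \<partial>lborel)"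
  proof (rule integral_dominated_convergence)
    show "(\<lambda>z. dilate t \<phi> (y - z) * f z) \<in> borel_measurable lborel" unfolding dilate_def by measurable
    show "?s m \<in> borel_measurable lborel" for m unfolding dilate_def by measurable
    show "integrable lborel (\<lambda>z. 3 / (t/2) ^ DIM('a) * norm (f z * indicator (ball y (3 * t)) z))"
      using loc[of y "3 * t"] by (intro integrable_mult_right integrable_norm)
    show "AE z in lborel. (\<lambda>m. ?s m z) \<longlonglongrightarrow> dilate t \<phi> (y - z) * f z"
    proof (intro always_eventually allI)
      fix z
      have ly': "(\<lambda>m. fst (u (m + m0))) \<longlonglongrightarrow> y" using ly by (rule LIMSEQ_ignore_initial_segment)
      have lt': "(\<lambda>m. snd (u (m + m0))) \<longlonglongrightarrow> t" using lt by (rule LIMSEQ_ignore_initial_segment)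
      have "(\<lambda>m. \<phi> ((fst (u (m + m0)) - z) /\<^sub>R snd (u (m + m0)))) \<longlonglongrightarrow> \<phi> ((y - z) /\<^sub>R t)"
        using t by (intro isCont_tendsto_compose[of _ \<phi>] tendsto_intros ly' lt')
          (use cont in \<open>auto simp: continuous_on_eq_continuous_at\<close>)
      then show "(\<lambda>m. ?s m z) \<longlonglongrightarrow> dilate t \<phi> (y - z) * f z"
        unfolding dilate_def using t by (intro tendsto_intros lt') auto
    qed
    show "AE z in lborel. norm (?s m z) \<le> 3 / (t/2) ^ DIM('a) * norm (f z * indicator (ball y (3 * t)) z)" for m
    proof (intro always_eventually allI)
      fix z
      define y' t' where "y' = fst (u (m + m0))" and "t' = snd (u (m + m0))"
      have y': "dist y' y < t" and "\<bar>t' - t\<bar> < t / 2"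
        using m0[of "m + m0"] by (auto simp: y'_def t'_def dist_real_def)
      then have t': "t / 2 < t'" "t' < 2 * t" using t by linarith+
      have bp: "bump \<alpha> y' t' (\<lambda>z. dilate t' \<phi> (y' - z))"
        using t t' by (intro bump_dilate \<alpha> \<phi>) auto
      show "norm (?s m z) \<le> 3 / (t/2) ^ DIM('a) * norm (f z * indicator (ball y (3 * t)) z)"
        unfolding y'_def[symmetric] t'_def[symmetric]
      proof (cases "z \<in> ball y' t'")
        case True
        then have "z \<in> ball y (3 * t)"
          using y' t' dist_triangle[of y z y'] by (simp add: dist_commute)
        moreover have "norm (dilate t' \<phi> (y' - z)) \<le> 3 / (t/2) ^ DIM('a)"
        proof -
          have "norm (dilate t' \<phi> (y' - z)) \<le> 3 / t' ^ DIM('a)"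
            using t t' by (intro bump_bound[OF \<alpha> _ bp]) auto
          also have "\<dots> \<le> 3 / (t/2) ^ DIM('a)"
            using t t' by (intro divide_left_mono power_mono mult_pos_pos) auto
          finally show ?thesis .
        qed
        ultimately show "norm (dilate t' \<phi> (y' - z) * f z) \<le> 3 / (t/2) ^ DIM('a) * norm (f z * indicator (ball y (3 * t)) z)"
          unfolding norm_mult[of "dilate _ _ _"] by (intro mult_mono) (use t in auto)
      next
        case False
        then show "norm (dilate t' \<phi> (y' - z) * f z) \<le> 3 / (t/2) ^ DIM('a) * norm (f z * indicator (ball y (3 * t)) z)"
          using bump_outside[OF bp False] t by simp
      qed
    qed
  qed
  then have "(\<lambda>m. \<integral>z. dilate (snd (u m)) \<phi> (fst (u m) - z) * f z \<partial>lborel) \<longlonglongrightarrow> (\<integral>z. dilate t \<phi> (y - z) * f z \<partial>lborel)"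
    by (rule LIMSEQ_offset)
  then show "(\<lambda>m. \<integral>z. dilate (snd (u m)) \<phi> (fst (u m) - z) * f z \<partial>lborel) \<longlonglongrightarrow> (\<integral>z. dilate (snd q) \<phi> (fst q - z) * f z \<partial>lborel)"
    by (simp add: y_def t_def)
qed

text \<open>An uncountable supremum of continuous functions is lower semicontinuous: its upper level
  sets are unions of open sets. The indicator restricts to the open half space on which the
  continuity holds.\<close>

lemma intrinsic_sup_measurable:
  fixes f :: "'a::euclidean_space \<Rightarrow> complex"
  assumes \<alpha>: "0 < \<alpha>" "\<alpha> \<le> 1" and f[measurable]: "f \<in> borel_measurable borel"
    and loc: "\<And>y r. integrable lborel (\<lambda>z. f z * indicator (ball y r) z)"
  shows "(\<lambda>q. intrinsic_sup \<alpha> f (fst q) (snd q) * indicator {0<..} (snd q)) \<in> borel_measurable borel"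
proof (rule borel_measurableI_greater)
  fix c
  let ?g = "\<lambda>\<phi> q. \<integral>z. dilate (snd q) \<phi> (fst q - z) * f z \<partial>lborel"
  let ?H = "UNIV \<times> {0<..} :: ('a \<times> real) set"
  have eq: "{q \<in> space borel. c < intrinsic_sup \<alpha> f (fst q) (snd q) * indicator {0<..} (snd q)}
    = (\<Union>\<phi>\<in>test_functions \<alpha>. {q \<in> ?H. c < ennreal (norm (?g \<phi> q))})" (is "?L = ?R")
  proof
    show "?L \<subseteq> ?R"
    proof
      fix q assume "q \<in> ?L"
      then have c: "c < intrinsic_sup \<alpha> f (fst q) (snd q)" and t: "0 < snd q"
        by (cases "0 < snd q"; simp)+
      then obtain \<phi> where "\<phi> \<in> test_functions \<alpha>" "c < ennreal (norm (?g \<phi> q))"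
        unfolding intrinsic_sup_lborel[OF \<alpha>(1) t f] less_SUP_iff by blast
      then show "q \<in> ?R" using t by (cases q) auto
    qed
    show "?R \<subseteq> ?L"
    proof
      fix q assume "q \<in> ?R"
      then obtain \<phi> where \<phi>: "\<phi> \<in> test_functions \<alpha>" "c < ennreal (norm (?g \<phi> q))" and t: "0 < snd q"
        by (cases q) auto
      then have "c < intrinsic_sup \<alpha> f (fst q) (snd q)"
        unfolding intrinsic_sup_lborel[OF \<alpha>(1) t f] less_SUP_iff by blast
      then show "q \<in> ?L" using t by simp
    qed
  qed
  have "open {q \<in> ?H. c < ennreal (norm (?g \<phi> q))}" if \<phi>: "\<phi> \<in> test_functions \<alpha>" for \<phi>
  proof -
    have H: "open ?H" by (intro open_Times) auto
    have "continuous_on ?H (\<lambda>q. ennreal (norm (?g \<phi> q)))"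
      by (intro continuous_on_ennreal continuous_on_norm dilate_integral_continuous[OF \<alpha> f loc \<phi>])
    then have "open ((\<lambda>q. ennreal (norm (?g \<phi> q))) -` {c<..} \<inter> ?H)"
      using continuous_on_open_vimage[OF H] open_greaterThan by blast
    moreover have "(\<lambda>q. ennreal (norm (?g \<phi> q))) -` {c<..} \<inter> ?H = {q \<in> ?H. c < ennreal (norm (?g \<phi> q))}" by auto
    ultimately show ?thesis by simp
  qed
  then show "{q \<in> space borel. c < intrinsic_sup \<alpha> f (fst q) (snd q) * indicator {0<..} (snd q)} \<in> sets borel"
    unfolding eq by (intro borel_open open_UN) auto
qed

lemma cone_integral_measurable:
  fixes f :: "'a::euclidean_space \<Rightarrow> complex"
  assumes \<alpha>: "0 < \<alpha>" "\<alpha> \<le> 1" and f: "f \<in> borel_measurable borel"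
    and loc: "\<And>y r. integrable lborel (\<lambda>z. f z * indicator (ball y r) z)"
  shows "cone_integral \<alpha> f \<in> borel_measurable borel"
proof -
  let ?A = "\<lambda>q. intrinsic_sup \<alpha> f (fst q) (snd q) * indicator {0<..} (snd q)"
  have [measurable]: "?A \<in> borel_measurable (borel :: ('a \<times> real) measure)" by (rule intrinsic_sup_measurable[OF \<alpha> f loc])
  have [measurable]: "(\<lambda>q. snd q) \<in> borel_measurable (borel :: ('a \<times> real) measure)" "(\<lambda>q. fst q) \<in> borel_measurable (borel :: ('a \<times> real) measure)"
    by (intro borel_measurable_continuous_onI continuous_intros)+
  have "cone_integral \<alpha> f = (\<lambda>x. \<integral>\<^sup>+q. (?A q)\<^sup>2 / ennreal (snd q ^ (DIM('a) + 1)) * of_bool (0 < snd q \<and> norm (x - fst q) < snd q) \<partial>lborel)"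
    unfolding cone_integral_def nn_integral_completion
    by (intro ext nn_integral_cong) (auto simp: vertical_cone_def indicator_def)
  also have "\<dots> \<in> borel_measurable (borel :: 'a measure)"
    by measurable
  finally show ?thesis .
qed

subsection \<open>The Morrey estimate\<close>

text \<open>Doubling is iterated m times, with m the least integer such that R \<le> 2^m r. Since
  2^m \<le> 2R/r, the factor D^m = (2^m)^(log 2 D) is a power of the ratio of radii; the exponent is
  below n exactly when D < 2^n.\<close>

lemma growth_bound:
  fixes \<Phi> :: "real \<Rightarrow> real"
  assumes pos: "\<And>r. r > 0 \<Longrightarrow> \<Phi> r > 0" and mono: "mono_on {0<..} \<Phi>"
    and dbl: "\<And>r. r > 0 \<Longrightarrow> \<Phi> (2 * r) \<le> D * \<Phi> r" and D: "1 \<le> D" and r: "0 < r" "r \<le> R"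
  shows "\<Phi> R \<le> (2 * R / r) powr (log 2 D) * \<Phi> r"
proof -
  have iter: "\<Phi> (2 ^ m * r) \<le> D ^ m * \<Phi> r" for m
  proof (induction m)
    case (Suc m)
    have "\<Phi> (2 * (2 ^ m * r)) \<le> D * \<Phi> (2 ^ m * r)" using r by (intro dbl) simp
    also have "\<dots> \<le> D * (D ^ m * \<Phi> r)" using D Suc by (intro mult_left_mono) auto
    finally show ?case by (simp add: mult_ac)
  qed simp
  define m where "m = nat \<lceil>log 2 (R / r)\<rceil>"
  have Rr: "1 \<le> R / r" using r by simp
  then have l: "0 \<le> log 2 (R / r)" by simp
  have m: "log 2 (R / r) \<le> real m" "real m \<le> log 2 (R / r) + 1"
    using l unfolding m_def by linarith+
  have "R / r = 2 powr (log 2 (R / r))" using Rr by simp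
  also have "\<dots> \<le> 2 powr (real m)" using m by (intro powr_mono) auto
  also have "\<dots> = 2 ^ m" by (simp add: powr_realpow)
  finally have "R \<le> 2 ^ m * r" using r by (simp add: pos_divide_le_eq)
  then have "\<Phi> R \<le> \<Phi> (2 ^ m * r)" using r by (intro mono_onD[OF mono]) auto
  also have "\<dots> \<le> D ^ m * \<Phi> r" by (rule iter)
  also have "D ^ m \<le> (2 * R / r) powr (log 2 D)"
  proof -
    have "D ^ m = (2 powr (log 2 D)) powr (real m)"
      using D by (simp add: powr_realpow)
    also have "\<dots> = (2 powr (real m)) powr (log 2 D)" by (simp add: powr_powr mult.commute)
    also have "\<dots> \<le> (2 * R / r) powr (log 2 D)"
    proof (intro powr_mono2)
      have "2 powr (real m) \<le> 2 powr (log 2 (R / r) + 1)" using m by (intro powr_mono) auto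
      also have "\<dots> = 2 * R / r" using Rr by (simp add: powr_add)
      finally show "2 powr (real m) \<le> 2 * R / r" .
    qed (use D in auto)
    finally show ?thesis .
  qed
  finally show ?thesis using pos[OF r(1)] by (simp add: mult_right_mono)
qed

text \<open>Hoelder's inequality, from \<open>g \<le> \<tau> + \<tau>\<^sup>1\<^sup>-\<^sup>p g\<^sup>p\<close> with the optimal \<open>\<tau>\<close>.\<close>

lemma ball_integral_le_Lp:
  fixes G :: "'a::euclidean_space \<Rightarrow> ennreal"
  assumes [measurable]: "G \<in> borel_measurable borel" and p: "1 < p" and R: "0 < R" and m: "0 < m"
    and le: "(\<integral>\<^sup>+x\<in>ball y R. ennreal_powr (G x) p \<partial>lborel) \<le> ennreal m"
  shows "(\<integral>\<^sup>+x\<in>ball y R. G x \<partial>lborel)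
    \<le> ennreal (2 * (m / (ball_vol TYPE('a) * R ^ DIM('a))) powr (1/p) * (ball_vol TYPE('a) * R ^ DIM('a)))"
proof -
  define V where "V = ball_vol TYPE('a) * R ^ DIM('a)"
  have V: "0 < V" using ball_vol_pos[where 'a='a] R by (simp add: V_def)
  \<comment> \<open>The choice that makes both resulting terms equal to \<tau> V, whence the factor
    2.\<close>
  define \<tau> where "\<tau> = (m / V) powr (1/p)"
  have \<tau>: "0 < \<tau>" using m V by (simp add: \<tau>_def)
  have \<tau>p: "\<tau> powr p = m / V" using m V p by (simp add: \<tau>_def powr_powr)
  have young: "G x \<le> ennreal \<tau> + ennreal (\<tau> powr (1 - p)) * ennreal_powr (G x) p" for x
  proof (cases "G x")
    case (real g)
    have "g \<le> \<tau> + \<tau> powr (1 - p) * g powr p"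
    proof (cases "g \<le> \<tau>")
      case False
      then have g: "0 < g" "\<tau> \<le> g" using \<tau> by auto
      have "g powr (1 - p) \<le> \<tau> powr (1 - p)"
        using g \<tau> p by (intro powr_mono2') auto
      then have "g powr (1 - p) * g powr p \<le> \<tau> powr (1 - p) * g powr p" by (rule mult_right_mono) simp
      moreover have "g powr (1 - p) * g powr p = g" using g by (simp add: powr_add[symmetric])
      ultimately show ?thesis using \<tau> by simp
    qed (simp add: add_increasing2)
    then have "ennreal g \<le> ennreal (\<tau> + \<tau> powr (1 - p) * g powr p)" by (rule ennreal_leI)
    then show ?thesis using real \<tau> by (simp add: ennreal_mult)
  next
    case top
    then show ?thesis using \<tau> by (simp add: ennreal_mult_top)
  qed
  have "(\<integral>\<^sup>+x\<in>ball y R. G x \<partial>lborel)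
     \<le> (\<integral>\<^sup>+x. ennreal \<tau> * indicator (ball y R) x + ennreal (\<tau> powr (1 - p)) * (ennreal_powr (G x) p * indicator (ball y R) x) \<partial>lborel)"
    using young by (intro nn_integral_mono) (auto simp: indicator_def)
  also have "\<dots> = ennreal \<tau> * emeasure lborel (ball y R) + ennreal (\<tau> powr (1 - p)) * (\<integral>\<^sup>+x\<in>ball y R. ennreal_powr (G x) p \<partial>lborel)"
    by (subst nn_integral_add) (auto simp: nn_integral_cmult nn_integral_cmult_indicator)
  also have "\<dots> \<le> ennreal \<tau> * ennreal V + ennreal (\<tau> powr (1 - p)) * ennreal m"
    using R by (intro add_mono mult_left_mono le) (auto simp: emeasure_ball' V_def)
  also have "\<dots> = ennreal (\<tau> * V + \<tau> powr (1 - p) * m)"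
    using \<tau> V m by (simp add: ennreal_mult)
  also have "\<tau> * V + \<tau> powr (1 - p) * m = 2 * \<tau> * V"
  proof -
    have "m = \<tau> powr p * V" using \<tau>p V by simp
    then have "\<tau> powr (1 - p) * m = \<tau> powr (1 - p) * \<tau> powr p * V" by (simp only: mult.assoc)
    also have "\<tau> powr (1 - p) * \<tau> powr p = \<tau>" using \<tau> by (simp add: powr_add[symmetric])
    finally show ?thesis by simp
  qed
  finally show ?thesis by (simp add: \<tau>_def V_def)
qed

text \<open>For balls large compared with the given one no cancellation is exploited; the average of
  the l^2 norm suffices, because the growth condition makes it decay.\<close>

lemma bump_coeff_le_integral:
  fixes i :: "int \<times> 'a::euclidean_space"
  assumes \<alpha>: "0 < \<alpha>" "\<alpha> \<le> 1" and f[measurable]: "\<And>j. f j \<in> borel_measurable borel"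
  shows "bump_coeff \<alpha> f i \<le> (ennreal (3 / rad TYPE('a) (fst i) ^ DIM('a)) * (\<integral>\<^sup>+z\<in>gball i. ennreal_powr (sq_sum f z) (1/2) \<partial>lborel))\<^sup>2"
proof -
  let ?c = "ennreal (3 / rad TYPE('a) (fst i) ^ DIM('a))"
  have "bump_coeff \<alpha> f i \<le> (\<Sum>j. (\<integral>\<^sup>+z. ennreal (norm (f j z)) * (?c * indicator (gball i) z) \<partial>lborel)\<^sup>2)"
    unfolding bump_coeff_def by (intro suminf_le summableI power_mono bump_sup_le_integral \<alpha> rad_pos f) auto
  also have "\<dots> \<le> (\<integral>\<^sup>+z. ennreal_powr (sq_sum f z) (1/2) * (?c * indicator (gball i) z) \<partial>lborel)\<^sup>2"
    unfolding sq_sum_def by (rule minkowski_l2) measurable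
  also have "(\<integral>\<^sup>+z. ennreal_powr (sq_sum f z) (1/2) * (?c * indicator (gball i) z) \<partial>lborel)
     = ?c * (\<integral>\<^sup>+z\<in>gball i. ennreal_powr (sq_sum f z) (1/2) \<partial>lborel)"
    by (subst nn_integral_cmult[symmetric]) (auto simp: mult_ac)
  finally show ?thesis .
qed

text \<open>A ball of radius R that contains x and leaves \<open>ball x0 (2 * r)\<close> has r < 2R
  and lies in \<open>ball x0 (4 * R)\<close>. The Morrey bound there, Hoelder's inequality and
  \<open>growth_bound\<close> give coefficients of size (r/R)^(2 \<delta> / p), and the positive
  exponent makes the sum over scales converge, uniformly in x.\<close>

lemma disc_square_far:
  fixes f :: "nat \<Rightarrow> 'a::euclidean_space \<Rightarrow> complex"
  assumes \<alpha>: "0 < \<alpha>" "\<alpha> \<le> 1" and p: "1 < p" and f[measurable]: "\<And>j. f j \<in> borel_measurable borel"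
    and \<Phi>: "\<And>r. r > 0 \<Longrightarrow> \<Phi> r > 0" "mono_on {0<..} \<Phi>" "\<And>r. r > 0 \<Longrightarrow> \<Phi> (2 * r) \<le> D * \<Phi> r"
    and D: "1 \<le> D" "D < 2 ^ DIM('a)"
    and c: "0 < c" and le: "\<And>x0 r. r > 0 \<Longrightarrow> (\<integral>\<^sup>+x\<in>ball x0 r. ennreal_powr (sq_sum f x) (p/2) \<partial>lborel) \<le> ennreal (c powr p * \<Phi> r)"
    and J: "finite J" "J \<subseteq> grid" and r: "0 < r" and x: "x \<in> ball x0 r" and far: "\<And>i. i \<in> J \<Longrightarrow> \<not> gball i \<subseteq> ball x0 (2 * r)"
    and \<delta>_def: "\<delta> = real DIM('a) - log 2 D"
    and K_def: "K = (6 * (ball_vol TYPE('a) * 4 ^ DIM('a)))\<^sup>2 * (2 ^ DIM('a) / ball_vol TYPE('a)) powr (2/p)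
        * ((4 * (real DIM('a) + 1) + 1) ^ DIM('a) * (3 powr (\<delta> * (2/p)) * geo (\<delta> * (2/p))))"
  shows "disc_square \<alpha> J f x \<le> ennreal (K * (c\<^sup>2 * (\<Phi> r / r ^ DIM('a)) powr (2/p)))"
proof -
  let ?n = "DIM('a)" and ?r = "rad TYPE('a)" and ?o = "ball_vol TYPE('a)"
  have o: "0 < ?o" by (rule ball_vol_pos)
  define \<beta> where "\<beta> = \<delta> * (2/p)"
  have "log 2 D < log 2 (2 ^ ?n)" using D by (subst log_less_cancel_iff) auto
  also have "\<dots> = real ?n" by (simp add: log_nat_power)
  finally have \<delta>: "0 < \<delta>" by (simp add: \<delta>_def)
  have \<beta>: "0 < \<beta>" using \<delta> p by (simp add: \<beta>_def)
  \<comment> \<open>In the first factor, 6 combines the 3 of the size estimate with the 2 of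
    Hoelder's inequality. The 2^n is the growth factor 8^n divided by the 4^n in the volume of the
    ball of radius 4R.\<close>
  define W where "W = (6 * (?o * 4 ^ ?n))\<^sup>2 * (c\<^sup>2 * (2 ^ ?n / ?o * (\<Phi> r / r ^ ?n)) powr (2/p))"
  have W: "0 \<le> W" by (simp add: W_def)
  have coeff: "bump_coeff \<alpha> f i \<le> ennreal (W * (r / ?r (fst i)) powr \<beta>)" and near: "r \<le> 3 * ?r (fst i)"
    if i: "i \<in> J" and xi: "x \<in> gball i" for i
  proof -
    define R where "R = ?r (fst i)"
    have R: "0 < R" by (simp add: R_def)
    obtain z where z: "z \<in> gball i" "z \<notin> ball x0 (2 * r)" using far[OF i] by blast
    have zd: "dist x0 w < r + 2 * R" if "w \<in> gball i" for w
    proof -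
      have "dist x0 w \<le> dist x0 x + (dist (snd i) x + dist (snd i) w)"
        using dist_triangle[of x0 w x] dist_triangle3[of x w "snd i"] by linarith
      then show ?thesis using x xi that by (simp add: R_def)
    qed
    \<comment> \<open>A point of the ball outside \<open>ball x0 (2 * r)\<close> is nevertheless
      within r + 2R of \<open>x0\<close>; then r + 2R < 4R.\<close>
    have rR: "r < 2 * R" using zd[OF z(1)] z(2) by simp
    then show "r \<le> 3 * ?r (fst i)" using R unfolding R_def by linarith
    have sub: "gball i \<subseteq> ball x0 (4 * R)" using zd rR by fastforce
    define m where "m = c powr p * \<Phi> (4 * R)"
    have m: "0 < m" using c \<Phi>(1)[of "4 * R"] R by (simp add: m_def)
    define \<tau> where "\<tau> = (m / (?o * (4 * R) ^ ?n)) powr (1/p)"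
    have "(\<integral>\<^sup>+z\<in>gball i. ennreal_powr (sq_sum f z) (1/2) \<partial>lborel) \<le> (\<integral>\<^sup>+z\<in>ball x0 (4 * R). ennreal_powr (sq_sum f z) (1/2) \<partial>lborel)"
      using sub by (intro nn_integral_mono) (auto simp: indicator_def)
    also have "\<dots> \<le> ennreal (2 * \<tau> * (?o * (4 * R) ^ ?n))"
      unfolding \<tau>_def
    proof (rule ball_integral_le_Lp[OF _ p _ m])
      show "(\<integral>\<^sup>+x\<in>ball x0 (4 * R). ennreal_powr (ennreal_powr (sq_sum f x) (1/2)) p \<partial>lborel) \<le> ennreal m"
        using le[of "4 * R" x0] R p by (simp add: m_def ennreal_powr_powr)
    qed (use R in auto)
    finally have "bump_coeff \<alpha> f i \<le> (ennreal (3 / R ^ ?n) * ennreal (2 * \<tau> * (?o * (4 * R) ^ ?n)))\<^sup>2"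
      using bump_coeff_le_integral[OF \<alpha> f, where i=i] unfolding R_def[symmetric]
      by (meson mult_left_mono order_trans power_mono zero_le)
    also have "ennreal (3 / R ^ ?n) * ennreal (2 * \<tau> * (?o * (4 * R) ^ ?n)) = ennreal (3 / R ^ ?n * (2 * \<tau> * (?o * (4 * R) ^ ?n)))"
      using R o by (intro ennreal_mult[symmetric]) (auto simp: \<tau>_def)
    also have "3 / R ^ ?n * (2 * \<tau> * (?o * (4 * R) ^ ?n)) = 6 * (?o * 4 ^ ?n) * \<tau>"
      using R by (simp add: power_mult_distrib)
    also have "(ennreal (6 * (?o * 4 ^ ?n) * \<tau>))\<^sup>2 = ennreal ((6 * (?o * 4 ^ ?n))\<^sup>2 * \<tau>\<^sup>2)"
      using o by (simp add: ennreal_power \<tau>_def power_mult_distrib)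
    also have "\<dots> \<le> ennreal (W * (r / R) powr \<beta>)"
    proof (rule ennreal_leI)
      have "\<tau>\<^sup>2 = \<tau> powr 2" by (simp add: \<tau>_def)
      also have "\<dots> = (m / (?o * (4 * R) ^ ?n)) powr (2/p)" by (simp add: \<tau>_def powr_powr)
      also have "\<dots> \<le> (c powr p * ((2 ^ ?n / ?o * (\<Phi> r / r ^ ?n)) * (r / R) powr \<delta>)) powr (2/p)"
      proof (intro powr_mono2)
        have "\<Phi> (4 * R) \<le> (2 * (4 * R) / r) powr (log 2 D) * \<Phi> r"
          using r rR by (intro growth_bound \<Phi> D(1)) auto
        also have "2 * (4 * R) / r = 8 * (R / r)" by simp
        also have "(8 * (R / r)) powr (log 2 D) = 8 powr (log 2 D) * (R / r) powr (log 2 D)"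
          using R r powr_mult[of 8 "R / r" "log 2 D"] by simp
        also have "\<dots> \<le> 8 ^ ?n * (R / r) powr (log 2 D)"
        proof (rule mult_right_mono)
          have "8 powr (log 2 D) \<le> 8 powr (real ?n)" using \<delta> by (intro powr_mono) (auto simp: \<delta>_def)
          then show "8 powr (log 2 D) \<le> 8 ^ ?n" by (simp add: powr_realpow)
        qed simp
        finally have "\<Phi> (4 * R) \<le> 8 ^ ?n * (R / r) powr (log 2 D) * \<Phi> r"
          using \<Phi>(1)[OF r] by (simp add: mult_right_mono)
        moreover have "(R / r) powr (log 2 D) = (R / r) ^ ?n * (r / R) powr \<delta>"
        proof -
          have "(R / r) powr (log 2 D) = (R / r) powr (real ?n) * (R / r) powr (- \<delta>)"
            by (simp add: \<delta>_def powr_add[symmetric])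
          also have "(R / r) powr (- \<delta>) = (r / R) powr \<delta>"
            using R r by (simp add: powr_minus powr_divide)
          finally show ?thesis using R r by (simp add: powr_realpow)
        qed
        ultimately have "\<Phi> (4 * R) \<le> 8 ^ ?n * ((R / r) ^ ?n * (r / R) powr \<delta>) * \<Phi> r" by simp
        then have "\<Phi> (4 * R) / (?o * (4 * R) ^ ?n) \<le> 8 ^ ?n * ((R / r) ^ ?n * (r / R) powr \<delta>) * \<Phi> r / (?o * (4 * R) ^ ?n)"
          using o R by (intro divide_right_mono) auto
        also have "\<dots> = (2 ^ ?n / ?o * (\<Phi> r / r ^ ?n)) * (r / R) powr \<delta>"
        proof -
          have "(8::real) ^ ?n = 2 ^ ?n * 4 ^ ?n" by (simp add: power_mult_distrib[symmetric])
          then show ?thesis using R r o less_imp_neq[OF o] by (simp add: power_mult_distrib power_divide mult_ac)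
        qed
        finally have "c powr p * (\<Phi> (4 * R) / (?o * (4 * R) ^ ?n)) \<le> c powr p * ((2 ^ ?n / ?o * (\<Phi> r / r ^ ?n)) * (r / R) powr \<delta>)"
          by (rule mult_left_mono) simp
        then show "m / (?o * (4 * R) ^ ?n) \<le> c powr p * ((2 ^ ?n / ?o * (\<Phi> r / r ^ ?n)) * (r / R) powr \<delta>)"
          by (simp add: m_def)
      qed (use m o R p in auto)
      also have "\<dots> = c\<^sup>2 * ((2 ^ ?n / ?o * (\<Phi> r / r ^ ?n)) powr (2/p) * (r / R) powr \<beta>)"
      proof -
        have eq: "(c powr p * (a * b powr \<delta>)) powr (2/p) = c\<^sup>2 * (a powr (2/p) * b powr \<beta>)" if "0 \<le> a" for a b
        proof -
          have "(c powr p * (a * b powr \<delta>)) powr (2/p) = (c powr p) powr (2/p) * (a powr (2/p) * (b powr \<delta>) powr (2/p))"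
            using that powr_mult[of "c powr p" "a * b powr \<delta>" "2/p"] powr_mult[of a "b powr \<delta>" "2/p"] by simp
          also have "(c powr p) powr (2/p) = c\<^sup>2" using c p by (simp add: powr_powr)
          also have "(b powr \<delta>) powr (2/p) = b powr \<beta>" by (simp add: powr_powr \<beta>_def)
          finally show ?thesis .
        qed
        show ?thesis using o r \<Phi>(1)[OF r] by (intro eq) auto
      qed
      finally have "(6 * (?o * 4 ^ ?n))\<^sup>2 * \<tau>\<^sup>2 \<le> (6 * (?o * 4 ^ ?n))\<^sup>2 * (c\<^sup>2 * ((2 ^ ?n / ?o * (\<Phi> r / r ^ ?n)) powr (2/p) * (r / R) powr \<beta>))"
        by (rule mult_left_mono) simp
      then show "(6 * (?o * 4 ^ ?n))\<^sup>2 * \<tau>\<^sup>2 \<le> W * (r / R) powr \<beta>"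
        by (simp only: W_def mult.assoc)
    qed
    finally show "bump_coeff \<alpha> f i \<le> ennreal (W * (r / ?r (fst i)) powr \<beta>)" by (simp add: R_def)
  qed
  define t where "t i = (if x \<in> ball (snd i) (2 * ?r (fst i)) \<and> r \<le> 3 * ?r (fst i) then (r / ?r (fst i)) powr \<beta> else 0)" for i :: "int \<times> 'a"
  have t0: "0 \<le> t i" for i by (simp add: t_def)
  have "disc_square \<alpha> J f x \<le> (\<Sum>i\<in>J. ennreal (W * t i))"
    unfolding disc_square_def
  proof (rule sum_mono)
    fix i assume i: "i \<in> J"
    show "bump_coeff \<alpha> f i * indicator (gball i) x \<le> ennreal (W * t i)"
    proof (cases "x \<in> gball i")
      case True
      have "x \<in> ball (snd i) (2 * ?r (fst i))" using True rad_pos[where 'a='a, of "fst i"] unfolding mem_ball by linarith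
      then have "t i = (r / ?r (fst i)) powr \<beta>" using near[OF i True] by (simp add: t_def)
      then show ?thesis using coeff[OF i True] True by simp
    qed simp
  qed
  also have "\<dots> = ennreal (W * (\<Sum>i\<in>J. t i))"
    using W t0 by (simp add: sum_ennreal sum_distrib_left)
  also have "\<dots> \<le> ennreal (W * ((4 * (real ?n + 1) + 1) ^ ?n * (3 powr \<beta> * geo \<beta>)))"
    unfolding t_def by (intro ennreal_leI mult_left_mono grid_distance_sum \<beta> J r W)
  also have "W * ((4 * (real ?n + 1) + 1) ^ ?n * (3 powr \<beta> * geo \<beta>)) = K * (c\<^sup>2 * (\<Phi> r / r ^ ?n) powr (2/p))"
  proof -
    have "(2 ^ ?n / ?o * (\<Phi> r / r ^ ?n)) powr (2/p) = (2 ^ ?n / ?o) powr (2/p) * (\<Phi> r / r ^ ?n) powr (2/p)"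
      by (rule powr_mult)
    then show ?thesis by (simp only: W_def K_def \<beta>_def mult_ac)
  qed
  finally show ?thesis .
qed

text \<open>The constant is fixed before the sequence and before its Morrey bound \<open>c\<close>,
  so the estimate later passes to the infimum over \<open>c\<close>. The integrand is the sum of the
  \<open>cone_integral\<close> values, whose exponent p/2 replaces p for its square root.\<close>

lemma morrey_bound_borel:
  fixes \<Phi> :: "real \<Rightarrow> real"
  assumes \<alpha>: "0 < \<alpha>" "\<alpha> \<le> 1" and p: "1 < p"
    and \<Phi>: "\<And>r. r > 0 \<Longrightarrow> \<Phi> r > 0" "mono_on {0<..} \<Phi>" "\<And>r. r > 0 \<Longrightarrow> \<Phi> (2 * r) \<le> D * \<Phi> r"
    and D: "1 \<le> D" "D < 2 ^ DIM('a::euclidean_space)"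
  obtains C where "0 < C"
    "\<And>(f :: nat \<Rightarrow> 'a \<Rightarrow> complex) c x0 r. (\<And>j. f j \<in> borel_measurable borel) \<Longrightarrow> 0 < c \<Longrightarrow>
       (\<And>x0 r. r > 0 \<Longrightarrow> (\<integral>\<^sup>+x\<in>ball x0 r. ennreal_powr (sq_sum f x) (p/2) \<partial>lborel) \<le> ennreal (c powr p * \<Phi> r)) \<Longrightarrow> 0 < r \<Longrightarrow>
       (\<integral>\<^sup>+x\<in>ball x0 r. ennreal_powr (\<Sum>j. cone_integral \<alpha> (f j) x) (p/2) \<partial>lborel) \<le> ennreal ((C * c) powr p * \<Phi> r)"
proof -
  let ?n = "DIM('a)" and ?o = "ball_vol TYPE('a)"
  have o: "0 < ?o" by (rule ball_vol_pos)
  obtain L where L: "0 < L" "\<And>(J :: (int \<times> 'a) set) f. finite J \<Longrightarrow> J \<subseteq> grid \<Longrightarrow> (\<And>j. f j \<in> borel_measurable borel) \<Longrightarrow>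
    (\<integral>\<^sup>+x. ennreal_powr (disc_square \<alpha> J f x) (p/2) \<partial>lborel) \<le> ennreal L * (\<integral>\<^sup>+x. ennreal_powr (sq_sum f x) (p/2) \<partial>lborel)"
    using disc_square_Lp[OF \<alpha> p, where 'a='a] by blast
  define \<delta> where "\<delta> = real ?n - log 2 D"
  define K where "K = (6 * (?o * 4 ^ ?n))\<^sup>2 * (2 ^ ?n / ?o) powr (2/p)
        * ((4 * (real ?n + 1) + 1) ^ ?n * (3 powr (\<delta> * (2/p)) * geo (\<delta> * (2/p))))"
  have "log 2 D < log 2 (2 ^ ?n)" using D by (subst log_less_cancel_iff) auto
  also have "\<dots> = real ?n" by (simp add: log_nat_power)
  finally have "0 < \<delta> * (2/p)" using p by (simp add: \<delta>_def)
  then have "0 < geo (\<delta> * (2/p))" by (rule geo_pos)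
  moreover have "0 < (6 * (?o * 4 ^ ?n))\<^sup>2" using o by (intro zero_less_power mult_pos_pos) auto
  moreover have "0 < (2 ^ ?n / ?o) powr (2/p)" using less_imp_neq[OF o] by simp
  moreover have "0 < (4 * (real ?n + 1) + 1) ^ ?n" by (intro zero_less_power) simp
  ultimately have K: "0 < K" unfolding K_def by (intro mult_pos_pos) auto
  \<comment> \<open>\<open>L * D\<close> stems from the balls inside the doubled ball, through
    \<open>\<Phi> (2 * r) \<le> D * \<Phi> r\<close>; the other term is the uniform far bound
    integrated over the ball; the power of 2 separates the two.\<close>
  define B where "B = 2 powr (p/2) * (L * D + K powr (p/2) * ?o)"
  have B: "0 < B" using L D K o p by (simp add: B_def add_pos_nonneg)
  define E where "E = (disc_const TYPE('a)) powr (p/2) * B"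
  have E: "0 < E" using disc_const_pos[where 'a='a] B by (simp add: E_def)
  show ?thesis
  proof (rule that[of "E powr (1/p)"])
    show "0 < E powr (1/p)" using E by simp
  next
    fix f :: "nat \<Rightarrow> 'a \<Rightarrow> complex" and c r :: real and x0 :: 'a
    assume f: "\<And>j. f j \<in> borel_measurable borel" and c: "0 < c" and r: "0 < r"
      and le: "\<And>x0 r. r > 0 \<Longrightarrow> (\<integral>\<^sup>+x\<in>ball x0 r. ennreal_powr (sq_sum f x) (p/2) \<partial>lborel) \<le> ennreal (c powr p * \<Phi> r)"
    note f[measurable]
    have \<Phi>r: "0 < \<Phi> r" by (rule \<Phi>(1)[OF r])
    have part: "(\<integral>\<^sup>+x\<in>ball x0 r. ennreal_powr (disc_square \<alpha> J f x) (p/2) \<partial>lborel) \<le> ennreal (B * (c powr p * \<Phi> r))"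
      if J: "finite J" "J \<subseteq> grid" for J :: "(int \<times> 'a) set"
    proof -
      define J1 where "J1 = {i\<in>J. gball i \<subseteq> ball x0 (2 * r)}"
      define J2 where "J2 = {i\<in>J. \<not> gball i \<subseteq> ball x0 (2 * r)}"
      have J1: "finite J1" "J1 \<subseteq> grid" and J2: "finite J2" "J2 \<subseteq> grid" using J by (auto simp: J1_def J2_def)
      have split: "disc_square \<alpha> J f x = disc_square \<alpha> J1 f x + disc_square \<alpha> J2 f x" for x
        unfolding disc_square_def using J
        by (subst sum.union_disjoint[symmetric]) (auto simp: J1_def J2_def intro!: sum.cong)
      let ?g = "\<lambda>j x. f j x * indicator (ball x0 (2 * r)) x :: complex"
      have "disc_square \<alpha> J1 f x = disc_square \<alpha> J1 ?g x" for x
        unfolding disc_square_def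
      proof (intro sum.cong refl arg_cong2[where f="(*)"] bump_coeff_cong)
        fix i j z assume "i \<in> J1" "z \<in> gball i"
        then have "z \<in> ball x0 (2 * r)" by (auto simp: J1_def)
        then show "f j z = f j z * indicator (ball x0 (2 * r)) z" by simp
      qed
      then have "(\<integral>\<^sup>+x. ennreal_powr (disc_square \<alpha> J1 f x) (p/2) \<partial>lborel) \<le> ennreal L * (\<integral>\<^sup>+x. ennreal_powr (sq_sum ?g x) (p/2) \<partial>lborel)"
        using L(2)[OF J1, of ?g] by simp
      also have "\<dots> \<le> ennreal L * ennreal (c powr p * (D * \<Phi> r))"
      proof (rule mult_left_mono)
        have "(\<integral>\<^sup>+x. ennreal_powr (sq_sum ?g x) (p/2) \<partial>lborel) = (\<integral>\<^sup>+x\<in>ball x0 (2 * r). ennreal_powr (sq_sum f x) (p/2) \<partial>lborel)"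
          unfolding sq_sum_indicator by (intro nn_integral_cong) (auto simp: indicator_def)
        also have "\<dots> \<le> ennreal (c powr p * \<Phi> (2 * r))" using r by (intro le) simp
        also have "\<dots> \<le> ennreal (c powr p * (D * \<Phi> r))" by (intro ennreal_leI mult_left_mono \<Phi>(3) r) simp
        finally show "(\<integral>\<^sup>+x. ennreal_powr (sq_sum ?g x) (p/2) \<partial>lborel) \<le> ennreal (c powr p * (D * \<Phi> r))" .
      qed simp
      also have "\<dots> = ennreal (L * (c powr p * (D * \<Phi> r)))"
        using L D \<Phi>r by (intro ennreal_mult[symmetric]) auto
      also have "L * (c powr p * (D * \<Phi> r)) = L * D * (c powr p * \<Phi> r)" by simp
      finally have N1: "(\<integral>\<^sup>+x. ennreal_powr (disc_square \<alpha> J1 f x) (p/2) \<partial>lborel) \<le> ennreal (L * D * (c powr p * \<Phi> r))" .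
      have N2: "ennreal_powr (disc_square \<alpha> J2 f x) (p/2) \<le> ennreal (K powr (p/2) * (c powr p * (\<Phi> r / r ^ ?n)))" if x: "x \<in> ball x0 r" for x
      proof -
        have "disc_square \<alpha> J2 f x \<le> ennreal (K * (c\<^sup>2 * (\<Phi> r / r ^ ?n) powr (2/p)))"
          by (rule disc_square_far[OF \<alpha> p f \<Phi> D c le J2 r x _ \<delta>_def K_def]) (auto simp: J2_def)
        then have "ennreal_powr (disc_square \<alpha> J2 f x) (p/2) \<le> ennreal_powr (ennreal (K * (c\<^sup>2 * (\<Phi> r / r ^ ?n) powr (2/p)))) (p/2)"
          using p by (intro ennreal_powr_mono) auto
        also have "\<dots> = ennreal ((K * (c\<^sup>2 * (\<Phi> r / r ^ ?n) powr (2/p))) powr (p/2))"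
          using K by (intro ennreal_powr_ennreal) auto
        also have "(K * (c\<^sup>2 * (\<Phi> r / r ^ ?n) powr (2/p))) powr (p/2) = K powr (p/2) * (c powr p * (\<Phi> r / r ^ ?n))"
        proof -
          have "(K * (c\<^sup>2 * v powr (2/p))) powr (p/2) = K powr (p/2) * (c powr p * v)" if v: "0 < v" for v
          proof -
            have "c\<^sup>2 = c powr 2" using c by simp
            then have "(K * (c\<^sup>2 * v powr (2/p))) powr (p/2) = K powr (p/2) * ((c powr 2) powr (p/2) * (v powr (2/p)) powr (p/2))"
              using K powr_mult[of K "c powr 2 * v powr (2/p)" "p/2"] powr_mult[of "c powr 2" "v powr (2/p)" "p/2"] by simp
            also have "(c powr 2) powr (p/2) = c powr p" by (simp add: powr_powr)
            also have "(v powr (2/p)) powr (p/2) = v" using v p by (simp add: powr_powr)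
            finally show ?thesis .
          qed
          then show ?thesis using \<Phi>r r by simp
        qed
        finally show ?thesis .
      qed
      let ?M = "K powr (p/2) * (c powr p * (\<Phi> r / r ^ ?n))"
      have "(\<integral>\<^sup>+x\<in>ball x0 r. ennreal_powr (disc_square \<alpha> J f x) (p/2) \<partial>lborel)
        \<le> (\<integral>\<^sup>+x. ennreal (2 powr (p/2)) * (ennreal_powr (disc_square \<alpha> J1 f x) (p/2) + ennreal ?M * indicator (ball x0 r) x) \<partial>lborel)"
      proof (rule nn_integral_mono)
        fix x
        show "ennreal_powr (disc_square \<alpha> J f x) (p/2) * indicator (ball x0 r) x
          \<le> ennreal (2 powr (p/2)) * (ennreal_powr (disc_square \<alpha> J1 f x) (p/2) + ennreal ?M * indicator (ball x0 r) x)"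
        proof (cases "x \<in> ball x0 r")
          case True
          have "ennreal_powr (disc_square \<alpha> J f x) (p/2) \<le> ennreal (2 powr (p/2)) * (ennreal_powr (disc_square \<alpha> J1 f x) (p/2) + ennreal_powr (disc_square \<alpha> J2 f x) (p/2))"
            unfolding split using p by (intro ennreal_powr_add_le) auto
          also have "\<dots> \<le> ennreal (2 powr (p/2)) * (ennreal_powr (disc_square \<alpha> J1 f x) (p/2) + ennreal ?M)"
            by (intro mult_left_mono add_left_mono N2 True) simp
          finally show ?thesis using True by simp
        qed simp
      qed
      also have "\<dots> = ennreal (2 powr (p/2)) * ((\<integral>\<^sup>+x. ennreal_powr (disc_square \<alpha> J1 f x) (p/2) \<partial>lborel) + ennreal ?M * emeasure lborel (ball x0 r))"
        by (subst nn_integral_cmult) (auto simp: nn_integral_add nn_integral_cmult_indicator)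
      also have "\<dots> \<le> ennreal (2 powr (p/2)) * (ennreal (L * D * (c powr p * \<Phi> r)) + ennreal ?M * ennreal (?o * r ^ ?n))"
        using r by (intro mult_left_mono add_mono N1) (auto simp: emeasure_ball')
      also have "\<dots> = ennreal (2 powr (p/2) * (L * D * (c powr p * \<Phi> r) + ?M * (?o * r ^ ?n)))"
      proof -
        have "ennreal a * (ennreal b + ennreal u * ennreal v) = ennreal (a * (b + u * v))" if "0 \<le> a" "0 \<le> b" "0 \<le> u" "0 \<le> v" for a b u v
          using that by (simp add: ennreal_mult)
        then show ?thesis using L D o r \<Phi>r by simp
      qed
      also have "2 powr (p/2) * (L * D * (c powr p * \<Phi> r) + ?M * (?o * r ^ ?n)) = B * (c powr p * \<Phi> r)"
        using r by (simp add: B_def algebra_simps)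
      finally show ?thesis .
    qed
    have inc: "incseq (\<lambda>N x. ennreal_powr (disc_square \<alpha> (grid_part N) f x) (p/2) * indicator (ball x0 r) x)"
      unfolding incseq_def le_fun_def disc_square_def using p
      by (auto intro!: mult_right_mono ennreal_powr_mono sum_mono2 grid_part_finite grid_part_mono)
    have "(\<integral>\<^sup>+x\<in>ball x0 r. ennreal_powr (\<Sum>j. cone_integral \<alpha> (f j) x) (p/2) \<partial>lborel)
       \<le> (\<integral>\<^sup>+x. ennreal (disc_const TYPE('a) powr (p/2)) * (SUP N. ennreal_powr (disc_square \<alpha> (grid_part N) f x) (p/2) * indicator (ball x0 r) x) \<partial>lborel)"
    proof (rule nn_integral_mono)
      fix x
      have "ennreal_powr (\<Sum>j. cone_integral \<alpha> (f j) x) (p/2)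
         \<le> ennreal_powr (ennreal (disc_const TYPE('a)) * (SUP N. disc_square \<alpha> (grid_part N) f x)) (p/2)"
        using p by (intro ennreal_powr_mono sum_cone_integral_le_SUP \<alpha> f) auto
      also have "\<dots> = ennreal (disc_const TYPE('a) powr (p/2)) * (SUP N. ennreal_powr (disc_square \<alpha> (grid_part N) f x) (p/2))"
        using p disc_const_pos[where 'a='a] by (simp add: ennreal_powr_mult ennreal_powr_SUP less_imp_le)
      finally show "ennreal_powr (\<Sum>j. cone_integral \<alpha> (f j) x) (p/2) * indicator (ball x0 r) x
         \<le> ennreal (disc_const TYPE('a) powr (p/2)) * (SUP N. ennreal_powr (disc_square \<alpha> (grid_part N) f x) (p/2) * indicator (ball x0 r) x)"
        by (cases "x \<in> ball x0 r") auto
    qed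
    also have "\<dots> = ennreal (disc_const TYPE('a) powr (p/2)) *
        (\<integral>\<^sup>+x. (SUP N. ennreal_powr (disc_square \<alpha> (grid_part N) f x) (p/2) * indicator (ball x0 r) x) \<partial>lborel)"
      by (rule nn_integral_cmult) measurable
    \<comment> \<open>The bound \<open>part\<close> holds uniformly over finite subfamilies, so
      monotone convergence along the exhaustion preserves it.\<close>
    also have "(\<integral>\<^sup>+x. (SUP N. ennreal_powr (disc_square \<alpha> (grid_part N) f x) (p/2) * indicator (ball x0 r) x) \<partial>lborel)
       = (SUP N. \<integral>\<^sup>+x\<in>ball x0 r. ennreal_powr (disc_square \<alpha> (grid_part N) f x) (p/2) \<partial>lborel)"
      by (rule nn_integral_monotone_convergence_SUP[OF inc]) measurable
    also have "\<dots> \<le> ennreal (B * (c powr p * \<Phi> r))"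
      by (intro SUP_least part grid_part_finite grid_part_subset)
    also have "ennreal (disc_const TYPE('a) powr (p/2)) * ennreal (B * (c powr p * \<Phi> r)) = ennreal (disc_const TYPE('a) powr (p/2) * (B * (c powr p * \<Phi> r)))"
      using B \<Phi>r by (intro ennreal_mult[symmetric]) auto
    also have "disc_const TYPE('a) powr (p/2) * (B * (c powr p * \<Phi> r)) = (E powr (1/p) * c) powr p * \<Phi> r"
    proof -
      have "(E powr (1/p) * c) powr p = (E powr (1/p)) powr p * c powr p"
      by (rule powr_mult)
      also have "(E powr (1/p)) powr p = E" using E p by (simp add: powr_powr)
      finally show ?thesis by (simp add: E_def mult_ac)
    qed
    finally show "(\<integral>\<^sup>+x\<in>ball x0 r. ennreal_powr (\<Sum>j. cone_integral \<alpha> (f j) x) (p/2) \<partial>lborel) \<le> ennreal ((E powr (1/p) * c) powr p * \<Phi> r)"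
      by (simp add: mult_left_mono)
  qed
qed

subsection \<open>Borel representatives\<close>

lemma complex_borel_version:
  fixes f :: "'a \<Rightarrow> complex"
  assumes [measurable]: "f \<in> borel_measurable (completion M)"
  shows "\<exists>g\<in>borel_measurable M. AE x in M. f x = g x"
proof -
  have "(\<lambda>x. Re (f x)) \<in> borel_measurable (completion M)" "(\<lambda>x. Im (f x)) \<in> borel_measurable (completion M)"
    by measurable
  from this[THEN completion_ex_borel_measurable_real]
  obtain u v where u: "u \<in> borel_measurable M" "AE x in M. Re (f x) = u x"
    and v: "v \<in> borel_measurable M" "AE x in M. Im (f x) = v x" by blast
  have "(\<lambda>x. Complex (u x) (v x)) \<in> borel_measurable M"
    unfolding Complex_eq using u(1) v(1) by measurable
  moreover have "AE x in M. f x = Complex (u x) (v x)"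
    using u(2) v(2) by eventually_elim (simp add: complex_eq_iff)
  ultimately show ?thesis by (intro bexI[of _ "\<lambda>x. Complex (u x) (v x)"])
qed

lemma locally_integrable_measurable:
  fixes f :: "'a::euclidean_space \<Rightarrow> complex"
  assumes "locally_integrable f"
  shows "f \<in> borel_measurable lebesgue"
proof (rule borel_measurable_LIMSEQ_metric)
  show "(\<lambda>x. indicator (cball 0 (real m)) x *\<^sub>R f x) \<in> borel_measurable lebesgue" for m
  proof -
    have "set_integrable lebesgue (cball 0 (real m)) f"
      using spec[OF assms[unfolded locally_integrable_def], of "cball 0 (real m)"] compact_cball by (rule mp)
    then show ?thesis unfolding set_integrable_def by (rule borel_measurable_integrable)
  qed
  fix x :: 'a
  obtain m0 :: nat where "norm x \<le> real m0" using real_arch_simple by blast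
  then have "\<forall>m\<ge>m0. indicator (cball 0 (real m)) x *\<^sub>R f x = f x"
    by (auto simp: indicator_def)
  then show "(\<lambda>m. indicator (cball 0 (real m)) x *\<^sub>R f x) \<longlonglongrightarrow> f x"
    by (intro tendsto_eventually) (auto simp: eventually_sequentially)
qed

text \<open>The square function does not see null sets, while Fubini and the semicontinuity argument
  are carried out for Borel functions; integrability over balls is what the continuity of the
  convolutions requires.\<close>

lemma borel_representative:
  fixes f :: "'a::euclidean_space \<Rightarrow> complex"
  assumes f: "locally_integrable f"
  obtains g where "g \<in> borel_measurable borel" "AE x in lebesgue. f x = g x"
    "\<And>y r. integrable lborel (\<lambda>z. g z * indicator (ball y r) z)"
proof -
  obtain g where g[measurable]: "g \<in> borel_measurable borel" and "AE x in lborel. f x = g x"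
    using complex_borel_version[OF locally_integrable_measurable[OF f]] by auto
  then have ae: "AE x in lebesgue. f x = g x" by (simp add: AE_completion)
  have "integrable lborel (\<lambda>z. g z * indicator (ball y r) z)" for y r
  proof -
    have "set_integrable lebesgue (cball y r) f"
      using f unfolding locally_integrable_def by simp
    then have "set_integrable lebesgue (ball y r) f"
      by (rule set_integrable_subset) auto
    then have i: "integrable lebesgue (\<lambda>z. indicator (ball y r) z *\<^sub>R f z)"
      by (simp add: set_integrable_def)
    have gm: "(\<lambda>z. g z * indicator (ball y r) z) \<in> borel_measurable lborel" by measurable
    have "integrable lebesgue (\<lambda>z. g z * indicator (ball y r) z)"
    proof (subst integrable_cong_AE)
      show "AE z in lebesgue. g z * indicator (ball y r) z = indicator (ball y r) z *\<^sub>R f z"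
        using ae by eventually_elim (auto simp: indicator_def)
    qed (use i measurable_completion[OF gm] in auto)
    then show ?thesis using integrable_completion[OF gm] by simp
  qed
  then show ?thesis using that[OF g ae] by blast
qed

lemma intrinsic_sup_cong_AE:
  fixes f g :: "'a::euclidean_space \<Rightarrow> complex"
  assumes \<alpha>: "0 < \<alpha>" and t: "0 < t" and fm: "f \<in> borel_measurable lebesgue" and gm: "g \<in> borel_measurable lebesgue"
    and ae: "AE x in lebesgue. f x = g x"
  shows "intrinsic_sup \<alpha> f y t = intrinsic_sup \<alpha> g y t"
  unfolding intrinsic_sup_def
proof (intro SUP_cong refl arg_cong[where f="\<lambda>z. ennreal (norm z)"])
  fix \<phi> :: "'a \<Rightarrow> complex" assume "\<phi> \<in> test_functions \<alpha>"
  then have "(\<lambda>z. dilate t \<phi> (y - z)) \<in> borel_measurable lborel"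
    using bump_measurable[OF \<alpha> bump_dilate[OF \<alpha> t]] by simp
  then have [measurable]: "(\<lambda>z. dilate t \<phi> (y - z)) \<in> borel_measurable lebesgue"
    by (rule measurable_completion)
  show "(\<integral>z. dilate t \<phi> (y - z) * f z \<partial>lebesgue) = (\<integral>z. dilate t \<phi> (y - z) * g z \<partial>lebesgue)"
    using ae fm gm by (intro integral_cong_AE) (auto elim!: eventually_mono)
qed

lemma cone_integral_cong_AE:
  fixes f g :: "'a::euclidean_space \<Rightarrow> complex"
  assumes "0 < \<alpha>" "f \<in> borel_measurable lebesgue" "g \<in> borel_measurable lebesgue" "AE x in lebesgue. f x = g x"
  shows "cone_integral \<alpha> f x = cone_integral \<alpha> g x"
  unfolding cone_integral_def
proof (rule nn_integral_cong)
  fix q :: "'a \<times> real"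
  show "(intrinsic_sup \<alpha> f (fst q) (snd q))\<^sup>2 / ennreal (snd q ^ (DIM('a) + 1)) * indicator (vertical_cone x) q
     = (intrinsic_sup \<alpha> g (fst q) (snd q))\<^sup>2 / ennreal (snd q ^ (DIM('a) + 1)) * indicator (vertical_cone x) q"
    using intrinsic_sup_cong_AE[OF assms(1) _ assms(2-4), of "snd q" "fst q"]
    by (cases "q \<in> vertical_cone x") (auto simp: vertical_cone_def)
qed

theorem theorem1p3:
  fixes \<alpha> p D :: real and \<Phi> :: "real \<Rightarrow> real"
  assumes "0 < \<alpha>" and "\<alpha> \<le> 1" and "1 < p"
    and "\<And>r. r > 0 \<Longrightarrow> \<Phi> r > 0"
    and "mono_on {0<..} \<Phi>"
    and "\<And>r. r > 0 \<Longrightarrow> \<Phi> (2 * r) \<le> D * \<Phi> r"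
    and "1 \<le> D" and "D < 2 ^ DIM('a::euclidean_space)"
  shows "\<exists>C>0. \<forall>f :: nat \<Rightarrow> 'a \<Rightarrow> complex. (\<forall>j. locally_integrable (f j)) \<longrightarrow>
           morrey_norm p \<Phi> (l2_seq (\<lambda>j. intrinsic_square \<alpha> (f j)))
             \<le> ennreal C * morrey_norm p \<Phi> (l2_seq (\<lambda>j x. ennreal (norm (f j x))))"
proof -
  obtain C where C: "0 < C"
    and bound: "\<And>(f :: nat \<Rightarrow> 'a \<Rightarrow> complex) c x0 r. (\<And>j. f j \<in> borel_measurable borel) \<Longrightarrow> 0 < c \<Longrightarrow>
       (\<And>x0 r. r > 0 \<Longrightarrow> (\<integral>\<^sup>+x\<in>ball x0 r. ennreal_powr (sq_sum f x) (p/2) \<partial>lborel) \<le> ennreal (c powr p * \<Phi> r)) \<Longrightarrow> 0 < r \<Longrightarrow>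
       (\<integral>\<^sup>+x\<in>ball x0 r. ennreal_powr (\<Sum>j. cone_integral \<alpha> (f j) x) (p/2) \<partial>lborel) \<le> ennreal ((C * c) powr p * \<Phi> r)"
    using morrey_bound_borel[OF assms] by blast
  show ?thesis
  proof (intro exI[of _ C] conjI C allI impI)
    fix f :: "nat \<Rightarrow> 'a \<Rightarrow> complex"
    assume f: "\<forall>j. locally_integrable (f j)"
    have "\<exists>g. g \<in> borel_measurable borel \<and> (AE x in lebesgue. f j x = g x)
       \<and> (\<forall>y r. integrable lborel (\<lambda>z. g z * indicator (ball y r) z))" for j
      using borel_representative[of "f j"] f by metis
    then obtain g where g[measurable]: "\<And>j. g j \<in> borel_measurable borel"
      and ae: "\<And>j. AE x in lebesgue. f j x = g j x"
      and gi: "\<And>j y r. integrable lborel (\<lambda>z. g j z * indicator (ball y r) z)"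
      by metis
    let ?S = "l2_seq (\<lambda>j. intrinsic_square \<alpha> (f j))" and ?F = "l2_seq (\<lambda>j x. ennreal (norm (f j x)))"
    have gl: "g j \<in> borel_measurable lebesgue" for j
      by (rule measurable_completion) simp
    have S: "?S x = ennreal_powr (\<Sum>j. cone_integral \<alpha> (g j) x) (1/2)" for x
    proof -
      have "cone_integral \<alpha> (f j) x = cone_integral \<alpha> (g j) x" for j
        using f by (intro cone_integral_cong_AE assms(1) gl ae locally_integrable_measurable) auto
      then show ?thesis by (simp add: l2_seq_def intrinsic_square_power2)
    qed
    have [measurable]: "cone_integral \<alpha> (g j) \<in> borel_measurable borel" for j
      by (rule cone_integral_measurable[OF assms(1,2) g gi])
    have Sm: "?S \<in> borel_measurable lborel"
      unfolding S by measurable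
    \<comment> \<open>Only countably many null sets are involved, one for each member of the
      sequence.\<close>
    have F: "AE x in lborel. ?F x = ennreal_powr (sq_sum g x) (1/2)"
    proof -
      have "AE x in lebesgue. \<forall>j. f j x = g j x" using ae by (simp add: AE_all_countable)
      then have "AE x in lborel. \<forall>j. f j x = g j x" by (simp add: AE_completion_iff)
      then show ?thesis by eventually_elim (simp add: l2_seq_def sq_sum_def)
    qed
    \<comment> \<open>Every admissible constant \<open>c\<close> on the right makes
      \<open>C * c\<close> admissible on the left.\<close>
    have step: "morrey_norm p \<Phi> ?S \<le> ennreal (C * c)"
      if c: "0 < c" and le: "\<And>x0 r. r > 0 \<Longrightarrow> (\<integral>\<^sup>+x\<in>ball x0 r. ennreal_powr (?F x) p \<partial>lebesgue) \<le> ennreal (c powr p * \<Phi> r)" for c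
    proof -
      have le': "(\<integral>\<^sup>+x\<in>ball x0 r. ennreal_powr (sq_sum g x) (p/2) \<partial>lborel) \<le> ennreal (c powr p * \<Phi> r)" if r: "0 < r" for x0 r
      proof -
        have "(\<integral>\<^sup>+x\<in>ball x0 r. ennreal_powr (sq_sum g x) (p/2) \<partial>lborel) = (\<integral>\<^sup>+x\<in>ball x0 r. ennreal_powr (?F x) p \<partial>lborel)"
          by (intro nn_integral_cong_AE, use F in eventually_elim) (use assms(3) in \<open>simp add: ennreal_powr_powr\<close>)
        then show ?thesis using le[OF r, of x0] by (simp add: nn_integral_completion)
      qed
      have Sle: "(\<integral>\<^sup>+x\<in>ball x0 r. ennreal_powr (?S x) p \<partial>lebesgue) \<le> ennreal ((C * c) powr p * \<Phi> r)" if r: "0 < r" for x0 r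
        using bound[OF g c le' r, of x0] assms(3)
        by (simp add: nn_integral_completion S ennreal_powr_powr)
      \<comment> \<open>Local integrability is part of having a finite norm and follows from the
        bound just proved, since S \<le> 1 + S^p.\<close>
      have "locally_integrable_ext ?S"
        unfolding locally_integrable_ext_def
      proof (intro conjI allI impI)
        show "?S \<in> borel_measurable lebesgue" using Sm by (rule measurable_completion)
        fix K :: "'a set" assume "compact K"
        then obtain R where R: "0 < R" "K \<subseteq> ball 0 R"
          using bounded_subset_ballD[of K 0] compact_imp_bounded by blast
        have [measurable]: "?S \<in> borel_measurable borel" using Sm by simp
        have "(\<integral>\<^sup>+x\<in>K. ?S x \<partial>lebesgue) \<le> (\<integral>\<^sup>+x. indicator (ball 0 R) x + ennreal_powr (?S x) p * indicator (ball 0 R) x \<partial>lebesgue)"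
          using R(2) ennreal_le_one_plus_powr[of p] assms(3)
          by (intro nn_integral_mono) (auto simp: indicator_def)
        also have "\<dots> = emeasure lborel (ball (0::'a) R) + (\<integral>\<^sup>+x\<in>ball 0 R. ennreal_powr (?S x) p \<partial>lborel)"
          unfolding nn_integral_completion by (subst nn_integral_add) auto
        also have "\<dots> < \<infinity>"
          using Sle[OF R(1), of 0] emeasure_lborel_ball_finite[of "0::'a" R]
          by (simp add: nn_integral_completion le_less_trans)
        finally show "(\<integral>\<^sup>+x\<in>K. ?S x \<partial>lebesgue) < \<infinity>" .
      qed
      then show ?thesis
        unfolding morrey_norm_def using C c Sle by (intro Inf_lower CollectI exI[of _ "C * c"]) auto
    qed
    \<comment> \<open>After division by \<open>C\<close> the claim is that a number is a lower bound
      of the admissible constants; if there are none, the infimum is infinite and the claim is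
      vacuous.\<close>
    have "morrey_norm p \<Phi> ?S / ennreal C \<le> morrey_norm p \<Phi> ?F"
      unfolding morrey_norm_def[of p \<Phi> ?F]
    proof (rule Inf_greatest)
      fix y
      assume "y \<in> {ennreal C | C. C > 0 \<and> locally_integrable_ext ?F \<and>
            (\<forall>x0 r. r > 0 \<longrightarrow> (\<integral>\<^sup>+x\<in>ball x0 r. ennreal_powr (?F x) p \<partial>lebesgue) \<le> ennreal (C powr p * \<Phi> r))}"
      then obtain c where "y = ennreal c" "0 < c"
        "\<And>x0 r. r > 0 \<Longrightarrow> (\<integral>\<^sup>+x\<in>ball x0 r. ennreal_powr (?F x) p \<partial>lebesgue) \<le> ennreal (c powr p * \<Phi> r)" by blast
      then show "morrey_norm p \<Phi> ?S / ennreal C \<le> y"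
        using step[of c] C by (simp add: ennreal_divide_le_iff ennreal_mult)
    qed
    then show "morrey_norm p \<Phi> ?S \<le> ennreal C * morrey_norm p \<Phi> ?F"
      by (simp only: ennreal_divide_le_iff[OF C])
  qed
qed

end
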